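(* Let $\lambda^*=\delta(1-\pi+\sigma^2/\alpha^2)$ and assume $\lambda^*>0$. Let $\mathrm{Bias}=\sqrt{\lim_{d\to\infty}\mathrm{Bias}^2(\lambda^* )}\ge0$ and $\mathrm{Var}=\lim_{d\to\infty}\mathrm{Var}(\lambda^* )$. Then for any $\pi$, $\delta$ and $\alpha$, $$\mathrm{Var}=\mathrm{Bias}\cdot(\alpha-\mathrm{Bias}).$$
   Context: Setting. $\alpha>0$, $\sigma\ge 0$ are fixed. For each $d$ let $p=p_d\le d$ and $n=n_d$, with $p/d\to\pi\in(0,1]$ and $d/n\to\delta\in(0,\infty)$. $X\in\mathbb{R}^{n\times d}$ has i.i.d. entries (from a fixed distribution) with mean $0$, variance $1$ and finite $(8+\eta)$-th moment for some $\eta>0$. $\theta\sim N(0,\alpha^2 I_d/d)$, $\mathcal{E}\sim N(0,\sigma^2 I_n)$, $Y=X\theta+\mathcal{E}$. $W$ is a $p\times d$ random matrix uniformly distributed on $\{W:WW^\top=I_p\}$. The test point $x\in\mathbb{R}^d$ is distributed as a row of $X$. $X,\mathcal{E},W,\theta,x$ are independent. For $\lambda>0$ the predictor is $\hat f(x)=x^\top W^\top(\tfrac{1}{n}WX^\top XW^\top+\lambda I_p)^{-1}\tfrac1n WX^\top Y .$ $\mathrm{Bias}^2(\lambda)=\mathbb{E}_{\theta,x}(\mathbb{E}_{X,\mathcal{E},W}\hat f(x)-x^\top\theta)^2$; $\mathrm{Var}(\lambda)=\mathbb{E}_{\theta,x}\mathbb{E}_{X,\mathcal{E},W}(\hat f(x)-\mathbb{E}_{X,\mathcal{E},W}\hat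 f(x))^2$. For fixed $\lambda>0$ both converge as $d\to\infty$; $\lambda^*$ is the minimizer over $\lambda$ of the limiting value of $\mathrm{MSE}(\lambda)=\mathrm{Bias}^2(\lambda)+\mathrm{Var}(\lambda)+\sigma^2$. *)

theory Defs
  imports "HOL-Probability.Probability" "Jordan_Normal_Form.Gauss_Jordan_Elimination"
begin

text \<open>Random matrices and vectors are represented by their laws: measures on the space of
  entry functions (index sets are initial segments of the naturals, or products of two such),
  turned into library matrices and vectors by \<^const>\<open>Matrix.mat\<close> and \<^const>\<open>Matrix.vec\<close>.
  Independence is expressed by product measures.\<close>

text \<open>The inverse is taken of a positive definite matrix whenever \<open>l > 0\<close>, so
  \<^const>\<open>mat_inverse\<close> (which is option-valued) then returns \<^const>\<open>Some\<close> inverse.\<close>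

definition ridge_predictor ::
  "real \<Rightarrow> real Matrix.mat \<Rightarrow> real Matrix.mat \<Rightarrow> real Matrix.vec \<Rightarrow> real Matrix.vec \<Rightarrow> real" where
  "ridge_predictor l W X Y x =
     (let n = real (dim_row X) in
      scalar_prod x
        (transpose_mat W *\<^sub>v
          (the (mat_inverse ((1 / n) \<cdot>\<^sub>m (W * transpose_mat X * X * transpose_mat W)
                             + l \<cdot>\<^sub>m 1\<^sub>m (dim_row W)))
            *\<^sub>v ((1 / n) \<cdot>\<^sub>v ((W * transpose_mat X) *\<^sub>v Y)))))"

text \<open>\<open>centered_normal s\<close> is N(0, s^2), as the law of \<open>s Z\<close> with \<open>Z\<close> standard normal; this includes
  the degenerate case \<open>s = 0\<close> (point mass at 0), where \<^const>\<open>normal_density\<close> is not a density.\<close>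

definition centered_normal :: "real \<Rightarrow> real measure" where
  "centered_normal s = distr (density lborel std_normal_density) borel (\<lambda>z. s * z)"

definition iid_vec :: "real measure \<Rightarrow> nat \<Rightarrow> (nat \<Rightarrow> real) measure" where
  "iid_vec \<mu> k = PiM {..<k} (\<lambda>_. \<mu>)"

definition iid_mat :: "real measure \<Rightarrow> nat \<Rightarrow> nat \<Rightarrow> (nat \<times> nat \<Rightarrow> real) measure" where
  "iid_mat \<mu> n d = PiM ({..<n} \<times> {..<d}) (\<lambda>_. \<mu>)"

text \<open>The uniform distribution on the p by d matrices with orthonormal rows (p at most d) is the
  unique probability measure on this set invariant under right multiplication by the
  orthogonal group O(d), which acts transitively on it.\<close>

definition uniform_orthonormal_rows ::
  "nat \<Rightarrow> nat \<Rightarrow> (nat \<times> nat \<Rightarrow> real) measure \<Rightarrow> bool" where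
  "uniform_orthonormal_rows p d M \<longleftrightarrow>
     prob_space M \<and>
     sets M = sets (PiM ({..<p} \<times> {..<d}) (\<lambda>_. borel :: real measure)) \<and>
     (AE w in M. Matrix.mat p d w * transpose_mat (Matrix.mat p d w) = 1\<^sub>m p) \<and>
     (\<forall>U \<in> carrier_mat d d. U * transpose_mat U = 1\<^sub>m d \<longrightarrow>
        distr M M (\<lambda>w. restrict (\<lambda>ij. (Matrix.mat p d w * U) $$ ij) ({..<p} \<times> {..<d})) = M)"

text \<open>Joint law of \<open>(X, E, W)\<close>; \<open>\<nu>\<close> is the law of \<open>W\<close>.\<close>

definition train_law ::
  "real measure \<Rightarrow> real \<Rightarrow> (nat \<times> nat \<Rightarrow> real) measure \<Rightarrow> nat \<Rightarrow> nat \<Rightarrow>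
   ((nat \<times> nat \<Rightarrow> real) \<times> (nat \<Rightarrow> real) \<times> (nat \<times> nat \<Rightarrow> real)) measure" where
  "train_law \<mu> \<sigma> \<nu> n d = iid_mat \<mu> n d \<Otimes>\<^sub>M (iid_vec (centered_normal \<sigma>) n \<Otimes>\<^sub>M \<nu>)"

text \<open>Joint law of \<open>(\<theta>, x)\<close>.\<close>

definition test_law ::
  "real measure \<Rightarrow> real \<Rightarrow> nat \<Rightarrow> ((nat \<Rightarrow> real) \<times> (nat \<Rightarrow> real)) measure" where
  "test_law \<mu> \<alpha> d = iid_vec (centered_normal (\<alpha> / sqrt (real d))) d \<Otimes>\<^sub>M iid_vec \<mu> d"

definition prediction ::
  "real \<Rightarrow> nat \<Rightarrow> nat \<Rightarrow> nat \<Rightarrow> (nat \<Rightarrow> real) \<Rightarrow> (nat \<Rightarrow> real) \<Rightarrow>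
   (nat \<times> nat \<Rightarrow> real) \<times> (nat \<Rightarrow> real) \<times> (nat \<times> nat \<Rightarrow> real) \<Rightarrow> real" where
  "prediction l n p d \<theta> x = (\<lambda>(X, E, W).
     ridge_predictor l (Matrix.mat p d W) (Matrix.mat n d X)
       (Matrix.mat n d X *\<^sub>v Matrix.vec d \<theta> + Matrix.vec n E) (Matrix.vec d x))"

definition mean_prediction ::
  "real measure \<Rightarrow> real \<Rightarrow> (nat \<times> nat \<Rightarrow> real) measure \<Rightarrow> real \<Rightarrow> nat \<Rightarrow> nat \<Rightarrow> nat \<Rightarrow>
   (nat \<Rightarrow> real) \<Rightarrow> (nat \<Rightarrow> real) \<Rightarrow> real" where
  "mean_prediction \<mu> \<sigma> \<nu> l n p d \<theta> x =
     (LINT \<omega>|train_law \<mu> \<sigma> \<nu> n d. prediction l n p d \<theta> x \<omega>)"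

definition bias_sq ::
  "real measure \<Rightarrow> real \<Rightarrow> real \<Rightarrow> (nat \<times> nat \<Rightarrow> real) measure \<Rightarrow> real \<Rightarrow> nat \<Rightarrow> nat \<Rightarrow> nat \<Rightarrow> real" where
  "bias_sq \<mu> \<alpha> \<sigma> \<nu> l n p d =
     (LINT (\<theta>, x)|test_law \<mu> \<alpha> d.
        (mean_prediction \<mu> \<sigma> \<nu> l n p d \<theta> x
         - scalar_prod (Matrix.vec d x) (Matrix.vec d \<theta>))\<^sup>2)"

definition variance_pred ::
  "real measure \<Rightarrow> real \<Rightarrow> real \<Rightarrow> (nat \<times> nat \<Rightarrow> real) measure \<Rightarrow> real \<Rightarrow> nat \<Rightarrow> nat \<Rightarrow> nat \<Rightarrow> real" where
  "variance_pred \<mu> \<alpha> \<sigma> \<nu> l n p d =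
     (LINT (\<theta>, x)|test_law \<mu> \<alpha> d. LINT \<omega>|train_law \<mu> \<sigma> \<nu> n d.
        (prediction l n p d \<theta> x \<omega> - mean_prediction \<mu> \<sigma> \<nu> l n p d \<theta> x)\<^sup>2)"

end

(* Write S = X^T X / n, P = W^T W, Q = 1 - P and A = W^T (W S W^T + l)^(-1) W, so that the predictor
   is x^T (M theta + A X^T E / n) with M = A S.  Integrating out theta, x and E gives
     Bias^2 = (alpha^2/d) |E M - 1|^2,
     Var    = (alpha^2/d) (E|M|^2 - |E M|^2) + sigma^2 E T,   T = |A X^T / n|^2  (Frobenius norms).
   Permutation invariance makes E M equal to m I plus a constant off-diagonal part, which is negligible,
   with m = E tr M / d; so Bias = alpha (1 - m) in the limit.  Removing one row of X at a time shows
   that r = tr A / n nearly solves l r + r / (1 + r) = p/n, whose left-hand side has slope at least l,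
   so m converges.  The identity A S P + l A = P gives
     |M|^2 = tr M - l n T + tr (A S Q S A),
   and removing one row again shows that the last term is (d - p) T up to o(d), because A Q = 0.
   Hence E|M|^2/d = m + (1 - p/d - l n/d) E T + o(1), and for l = lambda^* the terms in T cancel
   against sigma^2 E T, which leaves Var = alpha^2 (m - m^2). *)

theory Submission
  imports Defs "Jordan_Normal_Form.Determinant"
begin

unbundle no inner_syntax and no vec_syntax

section \<open>Traces and Frobenius norms\<close>

text \<open>The law of \<open>W\<close> is invariant under all of O(d), but the entries of
  \<open>X\<close> are merely i.i.d., so the symmetries known for both are the permutations of
  coordinates. They leave two free parameters in \<open>E M\<close>, a diagonal and an off-diagonal
  value; the second is controlled by testing \<open>M\<close> against the all-ones vector.

  \<open>S\<close> has no deterministic bound. Only \<open>A\<close>, of norm at most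
  \<open>1/l\<close>, and the projection \<open>Q\<close> are bounded, so errors are measured by
  Frobenius norms, and that of \<open>S\<close> has a square of expectation of order d. A quadratic
  form in one row of \<open>X\<close>, with a matrix independent of that row, misses its trace in
  mean by a constant times such a norm, hence by order sqrt d, while the quantities compared are of
  order d.

  The limit of \<open>T\<close> is never computed. \<open>T\<close> stays below \<open>1/l\<close>,
  and at \<open>lambda^*\<close> its total coefficient
  \<open>alpha^2 (1 - p/d - l n/d) + sigma^2\<close> tends to 0. This is what turns bias and
  variance into functions of the single number \<open>m\<close>.\<close>

definition tr :: "real Matrix.mat \<Rightarrow> real" where
  "tr A = (\<Sum>i<dim_row A. A $$ (i, i))"

definition frob_sq :: "real Matrix.mat \<Rightarrow> real" where
  "frob_sq A = (\<Sum>i<dim_row A. \<Sum>j<dim_col A. (A $$ (i, j))\<^sup>2)"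

lemma scalar_prod_sum: "v \<in> carrier_vec n \<Longrightarrow> scalar_prod u v = (\<Sum>i<n. u $ i * v $ i)"
  by (simp add: scalar_prod_def atLeast0LessThan carrier_vecD)

lemma index_mult_mat_sum:
  assumes "A \<in> carrier_mat n k" "B \<in> carrier_mat k m" "i < n" "j < m"
  shows "(A * B) $$ (i, j) = (\<Sum>r<k. A $$ (i, r) * B $$ (r, j))"
proof -
  have "(A * B) $$ (i, j) = scalar_prod (Matrix.row A i) (Matrix.col B j)"
    using assms by auto
  also have "\<dots> = (\<Sum>r<k. Matrix.row A i $ r * Matrix.col B j $ r)"
    using assms by (intro scalar_prod_sum) auto
  also have "\<dots> = (\<Sum>r<k. A $$ (i, r) * B $$ (r, j))"
    using assms by (intro sum.cong) auto
  finally show ?thesis .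
qed

lemma index_mult_mat_vec_sum:
  assumes "A \<in> carrier_mat n k" "v \<in> carrier_vec k" "i < n"
  shows "(A *\<^sub>v v) $ i = (\<Sum>r<k. A $$ (i, r) * v $ r)"
proof -
  have "(A *\<^sub>v v) $ i = scalar_prod (Matrix.row A i) v"
    using assms by auto
  also have "\<dots> = (\<Sum>r<k. Matrix.row A i $ r * v $ r)"
    using assms by (intro scalar_prod_sum) auto
  also have "\<dots> = (\<Sum>r<k. A $$ (i, r) * v $ r)"
    using assms by (intro sum.cong) auto
  finally show ?thesis .
qed

lemma tr_eq: "A \<in> carrier_mat n n \<Longrightarrow> tr A = (\<Sum>i<n. A $$ (i, i))"
  by (auto simp: tr_def)

lemma tr_comm:
  assumes "A \<in> carrier_mat n k" "B \<in> carrier_mat k n"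
  shows "tr (A * B) = tr (B * A)"
proof -
  have "tr (A * B) = (\<Sum>i<n. \<Sum>r<k. A $$ (i, r) * B $$ (r, i))"
    using assms by (subst tr_eq[of _ n]) (auto intro!: sum.cong index_mult_mat_sum[of _ n k] simp del: index_mult_mat)
  also have "\<dots> = (\<Sum>r<k. \<Sum>i<n. B $$ (r, i) * A $$ (i, r))"
    by (subst sum.swap) (simp add: mult.commute)
  also have "\<dots> = tr (B * A)"
    using assms by (subst tr_eq[of _ k]) (auto intro!: sum.cong index_mult_mat_sum[of _ k n, symmetric] simp del: index_mult_mat)
  finally show ?thesis .
qed

lemma tr_add: "A \<in> carrier_mat n n \<Longrightarrow> B \<in> carrier_mat n n \<Longrightarrow> tr (A + B) = tr A + tr B"
  by (auto simp: tr_def sum.distrib)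

lemma tr_minus: "A \<in> carrier_mat n n \<Longrightarrow> B \<in> carrier_mat n n \<Longrightarrow> tr (A - B) = tr A - tr B"
  by (auto simp: tr_def sum_subtractf)

lemma tr_smult: "A \<in> carrier_mat n n \<Longrightarrow> tr (c \<cdot>\<^sub>m A) = c * tr A"
  by (auto simp: tr_def sum_distrib_left)

lemma tr_one: "tr (1\<^sub>m n) = real n"
  by (auto simp: tr_def)

lemma frob_sq_eq: "A \<in> carrier_mat n k \<Longrightarrow> frob_sq A = (\<Sum>i<n. \<Sum>j<k. (A $$ (i, j))\<^sup>2)"
  by (auto simp: frob_sq_def)

lemma frob_sq_nonneg: "0 \<le> frob_sq A"
  by (auto simp: frob_sq_def intro!: sum_nonneg)

lemma frob_sq_tr:
  assumes "A \<in> carrier_mat n k"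
  shows "frob_sq A = tr (A * transpose_mat A)"
  using assms
  by (subst frob_sq_eq, assumption, subst tr_eq[of _ n])
     (auto intro!: sum.cong simp: index_mult_mat_sum[of _ n k _ n] power2_eq_square simp del: index_mult_mat)

lemma frob_sq_transpose: "frob_sq (transpose_mat A) = frob_sq A"
  unfolding frob_sq_def by (subst sum.swap) auto

lemma scalar_prod_self_nonneg: "0 \<le> scalar_prod v (v :: real Matrix.vec)"
  by (auto simp: scalar_prod_def intro!: sum_nonneg)

lemma scalar_prod_Cauchy_Schwarz:
  assumes "u \<in> carrier_vec n" "v \<in> carrier_vec n"
  shows "(scalar_prod u v)\<^sup>2 \<le> scalar_prod u u * scalar_prod v (v :: real Matrix.vec)"
  using Cauchy_Schwarz_ineq_sum[of "($) u" "($) v" "{..<n}"] assms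
  by (simp add: scalar_prod_sum[of _ n] power2_eq_square)

lemma frob_sq_cols:
  assumes "A \<in> carrier_mat n k"
  shows "frob_sq A = (\<Sum>j<k. scalar_prod (Matrix.col A j) (Matrix.col A j))"
proof -
  have "frob_sq A = (\<Sum>j<k. \<Sum>i<n. (A $$ (i, j))\<^sup>2)"
    using assms by (subst frob_sq_eq, assumption, subst sum.swap) simp
  also have "\<dots> = (\<Sum>j<k. scalar_prod (Matrix.col A j) (Matrix.col A j))"
    using assms by (intro sum.cong refl) (auto simp: scalar_prod_sum[of _ n] power2_eq_square)
  finally show ?thesis .
qed

text \<open>Left multiplication acts on the columns separately, so a bound on vectors sums up to one
  on the Frobenius norm. The hypothesis \<open>bnd\<close> plays the part of an operator norm
  bound.\<close>

lemma frob_sq_mult_le: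
  assumes A: "A \<in> carrier_mat m n" and B: "B \<in> carrier_mat n k"
    and bnd: "\<And>v. v \<in> carrier_vec n \<Longrightarrow>
        scalar_prod (A *\<^sub>v v) (A *\<^sub>v v) \<le> c * scalar_prod v (v :: real Matrix.vec)"
  shows "frob_sq (A * B) \<le> c * frob_sq B"
proof -
  have "frob_sq (A * B) = (\<Sum>j<k. scalar_prod (A *\<^sub>v Matrix.col B j) (A *\<^sub>v Matrix.col B j))"
    using A B by (subst frob_sq_cols[of _ m k]) (auto intro!: sum.cong simp: col_mult2)
  also have "\<dots> \<le> (\<Sum>j<k. c * scalar_prod (Matrix.col B j) (Matrix.col B j))"
    using B by (intro sum_mono bnd) auto
  also have "\<dots> = c * frob_sq B"
    using B by (simp add: frob_sq_cols[of _ n k] sum_distrib_left)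
  finally show ?thesis .
qed

lemma scalar_prod_mat_symm:
  assumes "A \<in> carrier_mat n n" "transpose_mat A = A" "u \<in> carrier_vec n" "v \<in> carrier_vec n"
  shows "scalar_prod u (A *\<^sub>v v) = scalar_prod (A *\<^sub>v u) (v :: real Matrix.vec)"
  using transpose_vec_mult_scalar[of A n n v u] assms by simp

lemma transpose_smult_mat: "transpose_mat (c \<cdot>\<^sub>m A) = c \<cdot>\<^sub>m transpose_mat A"
  by (intro eq_matI) auto

lemma eq_minus_mat:
  assumes "A \<in> carrier_mat n k" "B \<in> carrier_mat n k" "A + B = (C :: real Matrix.mat)"
  shows "A = C - B"
  using assms by (intro eq_matI) auto

section \<open>The resolvent as the solution of matrix equations\<close>

text \<open>For \<open>P = W\<^sup>T W\<close> with \<open>W W\<^sup>T = 1\<close> the matrix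
  \<open>A = W\<^sup>T (W S W\<^sup>T + l 1)\<^sup>-\<^sup>1 W\<close> satisfies these equations, and they determine it. Working with
  \<open>A\<close> instead of the inverse keeps everything of size \<open>d\<close> and removes \<open>W\<close> from the algebra.\<close>

locale resolvent =
  fixes d :: nat and l :: real and P S A :: "real Matrix.mat"
  assumes P [simp]: "P \<in> carrier_mat d d" and S [simp]: "S \<in> carrier_mat d d"
    and A [simp]: "A \<in> carrier_mat d d"
    and P_sym: "transpose_mat P = P" and S_sym: "transpose_mat S = S"
    and A_sym: "transpose_mat A = A"
    and P_idem: "P * P = P" and A_P: "A * P = A"
    and A_eq: "A * S * P + l \<cdot>\<^sub>m A = P"
    and S_psd: "\<And>v. v \<in> carrier_vec d \<Longrightarrow> 0 \<le> scalar_prod v (S *\<^sub>v v)"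
    and l_pos: "0 < l"
begin

lemma mult_closed [simp]:
  "B \<in> carrier_mat d d \<Longrightarrow> C \<in> carrier_mat d d \<Longrightarrow> B * C \<in> carrier_mat d d"
  by (rule mult_carrier_mat)

lemmas assoc_d = assoc_mult_mat[of _ d d _ d _ d]

lemma P_A: "P * A = A"
proof -
  have "P * A = transpose_mat (A * P)" unfolding transpose_mult[OF A P] A_sym P_sym ..
  then show ?thesis unfolding A_P A_sym .
qed

lemma A_eq': "P * S * A + l \<cdot>\<^sub>m A = P"
proof -
  have "P = transpose_mat (A * S * P + l \<cdot>\<^sub>m A)" unfolding A_eq P_sym ..
  also have "\<dots> = transpose_mat (A * S * P) + transpose_mat (l \<cdot>\<^sub>m A)"
    by (rule transpose_add[OF mult_carrier_mat[OF mult_carrier_mat[OF A S] P] smult_carrier_mat[OF A]])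
  also have "\<dots> = P * S * A + l \<cdot>\<^sub>m A"
    unfolding transpose_mult[OF mult_carrier_mat[OF A S] P] transpose_mult[OF A S]
      transpose_smult_mat A_sym S_sym P_sym assoc_mult_mat[OF P S A] ..
  finally show ?thesis by (rule sym)
qed

lemma vec_carrier [simp]:
  "v \<in> carrier_vec d \<Longrightarrow> A *\<^sub>v v \<in> carrier_vec d"
  "v \<in> carrier_vec d \<Longrightarrow> S *\<^sub>v v \<in> carrier_vec d"
  "v \<in> carrier_vec d \<Longrightarrow> P *\<^sub>v v \<in> carrier_vec d"
  by (auto intro: mult_mat_vec_carrier[of _ d d])

lemma P_A_vec: "v \<in> carrier_vec d \<Longrightarrow> P *\<^sub>v (A *\<^sub>v v) = A *\<^sub>v v"
  using assoc_mult_mat_vec[of P d d A d v] P_A by simp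

lemma A_P_vec: "v \<in> carrier_vec d \<Longrightarrow> A *\<^sub>v (P *\<^sub>v v) = A *\<^sub>v v"
  using assoc_mult_mat_vec[of A d d P d v] A_P by simp

lemma smult_mat_vec: "v \<in> carrier_vec d \<Longrightarrow> (c \<cdot>\<^sub>m A) *\<^sub>v v = c \<cdot>\<^sub>v (A *\<^sub>v v)"
  by (intro eq_vecI) (auto simp: carrier_matD[OF A])

lemma A_eq_vec:
  assumes v [simp]: "v \<in> carrier_vec d"
  shows "A *\<^sub>v (S *\<^sub>v (P *\<^sub>v v)) + l \<cdot>\<^sub>v (A *\<^sub>v v) = P *\<^sub>v v"
proof -
  have "P *\<^sub>v v = (A * S * P + l \<cdot>\<^sub>m A) *\<^sub>v v" by (simp add: A_eq)
  also have "\<dots> = (A * S * P) *\<^sub>v v + (l \<cdot>\<^sub>m A) *\<^sub>v v"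
    by (rule add_mult_distrib_mat_vec[of _ d d]) auto
  also have "(A * S * P) *\<^sub>v v = A *\<^sub>v (S *\<^sub>v (P *\<^sub>v v))"
    by (simp add: assoc_mult_mat_vec[of _ d d _ d] assoc_d)
  finally show ?thesis by (simp add: smult_mat_vec)
qed

lemma A_eq'_vec:
  assumes v [simp]: "v \<in> carrier_vec d"
  shows "P *\<^sub>v (S *\<^sub>v (A *\<^sub>v v)) + l \<cdot>\<^sub>v (A *\<^sub>v v) = P *\<^sub>v v"
proof -
  have "P *\<^sub>v v = (P * S * A + l \<cdot>\<^sub>m A) *\<^sub>v v" by (simp add: A_eq')
  also have "\<dots> = (P * S * A) *\<^sub>v v + (l \<cdot>\<^sub>m A) *\<^sub>v v"
    by (rule add_mult_distrib_mat_vec[of _ d d]) auto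
  also have "(P * S * A) *\<^sub>v v = P *\<^sub>v (S *\<^sub>v (A *\<^sub>v v))"
    by (simp add: assoc_mult_mat_vec[of _ d d _ d] assoc_d)
  finally show ?thesis by (simp add: smult_mat_vec)
qed

text \<open>\<open>A v\<close> lies in the range of \<open>P\<close>, so \<open>v\<close> may be
  replaced by \<open>P v\<close> and expanded with \<open>A_eq'_vec\<close>. Both summands are
  nonnegative, which yields the positivity of \<open>A\<close> as well as its norm bound.\<close>

lemma quad_A:
  assumes v [simp]: "v \<in> carrier_vec d"
  shows "scalar_prod v (A *\<^sub>v v) =
    scalar_prod (A *\<^sub>v v) (S *\<^sub>v (A *\<^sub>v v)) + l * scalar_prod (A *\<^sub>v v) (A *\<^sub>v v)"
proof -
  have "scalar_prod v (A *\<^sub>v v) = scalar_prod v (P *\<^sub>v (A *\<^sub>v v))" by (simp add: P_A_vec)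
  also have "\<dots> = scalar_prod (P *\<^sub>v v) (A *\<^sub>v v)" by (simp add: scalar_prod_mat_symm[OF P P_sym])
  also have "\<dots> = scalar_prod (P *\<^sub>v (S *\<^sub>v (A *\<^sub>v v)) + l \<cdot>\<^sub>v (A *\<^sub>v v)) (A *\<^sub>v v)"
    by (simp add: A_eq'_vec)
  also have "\<dots> = scalar_prod (P *\<^sub>v (S *\<^sub>v (A *\<^sub>v v))) (A *\<^sub>v v) + l * scalar_prod (A *\<^sub>v v) (A *\<^sub>v v)"
    by (subst add_scalar_prod_distrib[of _ d]) auto
  also have "scalar_prod (P *\<^sub>v (S *\<^sub>v (A *\<^sub>v v))) (A *\<^sub>v v) = scalar_prod (S *\<^sub>v (A *\<^sub>v v)) (P *\<^sub>v (A *\<^sub>v v))"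
    by (simp add: scalar_prod_mat_symm[OF P P_sym])
  also have "\<dots> = scalar_prod (A *\<^sub>v v) (S *\<^sub>v (A *\<^sub>v v))"
    by (simp add: P_A_vec comm_scalar_prod[of _ d])
  finally show ?thesis .
qed

lemma A_sq_le_quad:
  assumes v [simp]: "v \<in> carrier_vec d"
  shows "l * scalar_prod (A *\<^sub>v v) (A *\<^sub>v v) \<le> scalar_prod v (A *\<^sub>v v)"
  using quad_A[OF v] S_psd[of "A *\<^sub>v v"] by simp

lemma A_psd: "v \<in> carrier_vec d \<Longrightarrow> 0 \<le> scalar_prod v (A *\<^sub>v v)"
  using A_sq_le_quad[of v] l_pos scalar_prod_self_nonneg[of "A *\<^sub>v v"]
  by (meson mult_nonneg_nonneg order_trans less_imp_le)

text \<open>Cauchy-Schwarz turns \<open>l |A v|^2 \<le> v . A v\<close> into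
  \<open>l |A v| \<le> |v|\<close>. The bound does not involve \<open>S\<close>, so it survives a
  random \<open>S\<close> of any size.\<close>

lemma A_norm_le:
  assumes v [simp]: "v \<in> carrier_vec d"
  shows "scalar_prod (A *\<^sub>v v) (A *\<^sub>v v) \<le> 1 / l\<^sup>2 * scalar_prod v v"
proof -
  let ?a = "scalar_prod (A *\<^sub>v v) (A *\<^sub>v v)" and ?v = "scalar_prod v v"
  have "(l * ?a)\<^sup>2 \<le> (scalar_prod v (A *\<^sub>v v))\<^sup>2"
    using A_sq_le_quad[OF v] l_pos scalar_prod_self_nonneg[of "A *\<^sub>v v"] by (intro power_mono) auto
  also have "\<dots> \<le> ?v * ?a" by (rule scalar_prod_Cauchy_Schwarz[of _ d]) auto
  finally have "?a * (l\<^sup>2 * ?a) \<le> ?a * ?v" by (simp add: power2_eq_square mult_ac)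
  then have "l\<^sup>2 * ?a \<le> ?v"
    using scalar_prod_self_nonneg[of "A *\<^sub>v v"] scalar_prod_self_nonneg[of v]
    by (cases "?a = 0") (auto simp: mult_le_cancel_left)
  then show ?thesis using l_pos by (simp add: field_simps)
qed

lemma frob_sq_A_mult_le: "B \<in> carrier_mat d k \<Longrightarrow> frob_sq (A * B) \<le> 1 / l\<^sup>2 * frob_sq B"
  by (rule frob_sq_mult_le[OF A _ A_norm_le])

lemma frob_sq_mult_A_le:
  assumes B [simp]: "B \<in> carrier_mat k d"
  shows "frob_sq (B * A) \<le> 1 / l\<^sup>2 * frob_sq B"
proof -
  have "frob_sq (B * A) = frob_sq (transpose_mat (B * A))" by (simp add: frob_sq_transpose)
  also have "\<dots> = frob_sq (A * transpose_mat B)"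
    by (simp add: transpose_mult[of _ k d _ d] A_sym)
  also have "\<dots> \<le> 1 / l\<^sup>2 * frob_sq (transpose_mat B)"
    using B by (intro frob_sq_A_mult_le[of _ k]) simp
  finally show ?thesis by (simp add: frob_sq_transpose)
qed

lemma frob_sq_A_le: "frob_sq A \<le> real d / l\<^sup>2"
proof -
  have "frob_sq (1\<^sub>m d) = real d" by (subst frob_sq_tr[of _ d d]) (auto simp: tr_one)
  with frob_sq_A_mult_le[of "1\<^sub>m d" d] show ?thesis by (simp add: right_mult_one_mat[OF A])
qed

definition Q :: "real Matrix.mat" where "Q = 1\<^sub>m d - P"

lemma Q [simp]: "Q \<in> carrier_mat d d" by (simp add: Q_def minus_carrier_mat)

lemma Q_sym: "transpose_mat Q = Q"
  by (simp add: Q_def transpose_minus[of _ d d] P_sym)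

lemma Q_vec [simp]: "v \<in> carrier_vec d \<Longrightarrow> Q *\<^sub>v v \<in> carrier_vec d"
  by (auto intro: mult_mat_vec_carrier[of _ d d])

lemma P_plus_Q: "P + Q = 1\<^sub>m d" by (intro eq_matI) (auto simp: Q_def carrier_matD[OF P])

lemma Q_idem: "Q * Q = Q"
proof -
  have "Q * Q = Q * 1\<^sub>m d - Q * P"
    by (subst (2) Q_def, subst mult_minus_distrib_mat[of _ d d]) auto
  also have "Q * P = 0\<^sub>m d d"
    unfolding Q_def by (subst minus_mult_distrib_mat[of _ d d]) (auto simp: P_idem carrier_matD[OF P])
  also have "Q * 1\<^sub>m d - 0\<^sub>m d d = Q" by (intro eq_matI) (auto simp: carrier_matD[OF Q] right_mult_one_mat[OF Q])
  finally show ?thesis .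
qed

lemma A_Q: "A * Q = 0\<^sub>m d d"
  unfolding Q_def by (subst mult_minus_distrib_mat[of _ d d]) (auto simp: A_P carrier_matD[OF A])

text \<open>A symmetric idempotent satisfies \<open>v . Q v = |Q v|^2\<close>, and Cauchy-Schwarz
  does the rest. The factor 1 is written out to fit the hypothesis of
  \<open>frob_sq_mult_le\<close>.\<close>

lemma Q_norm_le:
  assumes v [simp]: "v \<in> carrier_vec d"
  shows "scalar_prod (Q *\<^sub>v v) (Q *\<^sub>v v) \<le> 1 * scalar_prod v v"
proof -
  let ?a = "scalar_prod (Q *\<^sub>v v) (Q *\<^sub>v v)" and ?v = "scalar_prod v v"
  have "Q *\<^sub>v v = Q *\<^sub>v (Q *\<^sub>v v)"
    using assoc_mult_mat_vec[of Q d d Q d v] Q_idem by simp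
  then have eq: "scalar_prod v (Q *\<^sub>v v) = ?a"
    using scalar_prod_mat_symm[OF Q Q_sym v, of "Q *\<^sub>v v"] by simp
  have "?a\<^sup>2 \<le> ?v * ?a"
    using scalar_prod_Cauchy_Schwarz[of v d "Q *\<^sub>v v"] by (simp add: eq)
  then have "?a * ?a \<le> ?a * ?v" by (simp add: power2_eq_square mult_ac)
  then show ?thesis
    using scalar_prod_self_nonneg[of "Q *\<^sub>v v"] scalar_prod_self_nonneg[of v]
    by (cases "?a = 0") (auto simp: mult_le_cancel_left)
qed

lemma frob_sq_Q_mult_le: "B \<in> carrier_mat d k \<Longrightarrow> frob_sq (Q * B) \<le> frob_sq B"
  using frob_sq_mult_le[OF Q _ Q_norm_le, of B k] by simp

lemma frob_sq_Q_le: "frob_sq Q \<le> real d"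
proof -
  have "frob_sq (1\<^sub>m d) = real d" by (subst frob_sq_tr[of _ d d]) (auto simp: tr_one)
  with frob_sq_Q_mult_le[of "1\<^sub>m d" d] show ?thesis by (simp add: right_mult_one_mat[OF Q])
qed

text \<open>The traces of \<open>C1\<close> and \<open>C2\<close> vanish because \<open>A Q = 0\<close>, so their quadratic forms in an
  independent row have mean zero and are of lower order.\<close>

definition C1 :: "real Matrix.mat" where "C1 = Q * S * A"
definition C2 :: "real Matrix.mat" where "C2 = Q * S * A * A"

lemma C_carrier [simp]: "C1 \<in> carrier_mat d d" "C2 \<in> carrier_mat d d"
  unfolding C1_def C2_def by (intro mult_carrier_mat[of _ d d _ d] A S Q)+

text \<open>Cyclicity of the trace brings \<open>A\<close> next to \<open>Q\<close>, where
  \<open>A_Q\<close> annihilates the product.\<close>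

lemma tr_A_Q_mult:
  assumes "B \<in> carrier_mat d d"
  shows "tr (Q * B * A) = 0"
proof -
  have QB: "Q * B \<in> carrier_mat d d" using assms by (intro mult_carrier_mat[of _ d d _ d] Q)
  have "tr (Q * B * A) = tr (A * (Q * B))" using QB A by (rule tr_comm)
  also have "A * (Q * B) = A * Q * B" using assoc_mult_mat[OF A Q assms] by (rule sym)
  finally show ?thesis using assms by (simp add: A_Q tr_def)
qed

lemma tr_C1: "tr C1 = 0"
  unfolding C1_def by (rule tr_A_Q_mult) (rule S)

lemma tr_C2: "tr C2 = 0"
  unfolding C2_def assoc_mult_mat[OF Q S A] by (rule tr_A_Q_mult) (rule mult_carrier_mat[OF S A])

text \<open>\<open>Q\<close> is a contraction on the left and \<open>A\<close> has norm at most
  \<open>1/l\<close> on the right. The norm of \<open>S\<close> is left standing because it can be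
  bounded only in expectation.\<close>

lemma frob_sq_C1_le: "frob_sq C1 \<le> frob_sq S / l\<^sup>2"
proof -
  have "frob_sq C1 \<le> 1 / l\<^sup>2 * frob_sq (Q * S)"
    unfolding C1_def by (rule frob_sq_mult_A_le[of _ d]) simp
  also have "\<dots> \<le> 1 / l\<^sup>2 * frob_sq S"
    by (intro mult_left_mono frob_sq_Q_mult_le[of _ d]) auto
  finally show ?thesis by simp
qed

lemma frob_sq_C2_le: "frob_sq C2 \<le> frob_sq S / l\<^sup>2 / l\<^sup>2"
proof -
  have "frob_sq C2 \<le> 1 / l\<^sup>2 * frob_sq C1"
    unfolding C2_def C1_def by (rule frob_sq_mult_A_le[of _ d]) simp
  also have "\<dots> \<le> 1 / l\<^sup>2 * (frob_sq S / l\<^sup>2)"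
    by (intro mult_left_mono frob_sq_C1_le) auto
  finally show ?thesis by simp
qed

lemma frob_sq_A_S_le: "frob_sq (A * S) \<le> frob_sq S / l\<^sup>2"
  using frob_sq_A_mult_le[of S d] by simp

lemma tr_A_nonneg: "0 \<le> tr A"
proof -
  have "0 \<le> A $$ (i, i)" if "i < d" for i
  proof -
    have "A $$ (i, i) = scalar_prod (unit_vec d i) (A *\<^sub>v unit_vec d i)"
      using that by (simp add: carrier_matD[OF A])
    then show ?thesis using A_psd[of "unit_vec d i"] by simp
  qed
  then show ?thesis by (auto simp: tr_eq[of A d] intro!: sum_nonneg)
qed

text \<open>The trace of \<open>A_eq\<close>, with \<open>P\<close> moved round cyclically and
  absorbed by \<open>A\<close>. It exchanges the trace of \<open>A S\<close>, which governs the
  bias, for that of \<open>A\<close>, which nearly solves a scalar equation.\<close>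

lemma tr_A_S: "tr (A * S) = tr P - l * tr A"
proof -
  have "tr P = tr (A * S * P + l \<cdot>\<^sub>m A)" by (simp only: A_eq)
  also have "\<dots> = tr (A * S * P) + tr (l \<cdot>\<^sub>m A)" by (rule tr_add[of _ d]) simp_all
  also have "tr (l \<cdot>\<^sub>m A) = l * tr A" by (rule tr_smult) (rule A)
  also have "tr (A * S * P) = tr (P * (A * S))" by (rule tr_comm[of _ d d]) simp_all
  also have "P * (A * S) = A * S" unfolding assoc_mult_mat[OF P A S, symmetric] P_A ..
  finally show ?thesis by simp
qed

text \<open>\<open>P + Q = 1\<close> is inserted between the two copies of \<open>S\<close> in
  \<open>A S S A\<close>. In the \<open>P\<close> part \<open>A S P\<close> equals
  \<open>P - l A\<close>, which removes one copy of \<open>S\<close>; the \<open>Q\<close> part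
  admits no such reduction and is kept as the trace of \<open>C2 S\<close>.\<close>

lemma frob_sq_A_S:
  "frob_sq (A * S) = tr (A * S) - l * tr (A * A * S) + tr (C2 * S)"
proof -
  note carr = mult_closed A S P Q
  note assoc = assoc_d carr
  have 1: "frob_sq (A * S) = tr (A * S * (S * A))"
    using frob_sq_tr[of "A * S" d d] by (simp only: transpose_mult[OF A S] A_sym S_sym carr)
  have 2: "A * S * (S * A) = A * S * P * (S * A) + A * S * Q * (S * A)"
  proof -
    have "A * S * (S * A) = A * S * ((P + Q) * (S * A))"
      by (simp only: P_plus_Q left_mult_one_mat[OF mult_closed[OF S A]])
    also have "\<dots> = A * S * P * (S * A) + A * S * Q * (S * A)"
      by (simp only: add_mult_distrib_mat[of _ d d _ _ d] mult_add_distrib_mat[of _ d d _ d] assoc)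
    finally show ?thesis .
  qed
  have 3: "tr (A * S * P * (S * A) + A * S * Q * (S * A))
      = tr (A * S * P * (S * A)) + tr (A * S * Q * (S * A))"
    by (rule tr_add[of _ d]) simp_all
  have 4: "tr (A * S * Q * (S * A)) = tr (C2 * S)"
  proof -
    have "tr (A * S * Q * (S * A)) = tr ((A * S) * (Q * (S * A)))" by (simp only: assoc)
    also have "\<dots> = tr ((Q * (S * A)) * (A * S))" by (rule tr_comm[of _ d d]) simp_all
    also have "\<dots> = tr (C2 * S)" by (simp only: C2_def assoc)
    finally show ?thesis .
  qed
  have 5: "A * S * P = P - l \<cdot>\<^sub>m A"
    by (rule eq_minus_mat[of _ d d, OF _ _ A_eq]) simp_all
  have 6: "tr ((P - l \<cdot>\<^sub>m A) * (S * A)) = tr (P * (S * A)) - l * tr (A * (S * A))"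
  proof -
    have "(P - l \<cdot>\<^sub>m A) * (S * A) = P * (S * A) - (l \<cdot>\<^sub>m A) * (S * A)"
      by (rule minus_mult_distrib_mat[of _ d d _ _ d]) simp_all
    also have "(l \<cdot>\<^sub>m A) * (S * A) = l \<cdot>\<^sub>m (A * (S * A))"
      by (rule mult_smult_assoc_mat[of _ d d _ d]) simp_all
    finally have "tr ((P - l \<cdot>\<^sub>m A) * (S * A)) = tr (P * (S * A) - l \<cdot>\<^sub>m (A * (S * A)))"
      by simp
    also have "\<dots> = tr (P * (S * A)) - tr (l \<cdot>\<^sub>m (A * (S * A)))"
      by (rule tr_minus[of _ d]) simp_all
    also have "tr (l \<cdot>\<^sub>m (A * (S * A))) = l * tr (A * (S * A))"
      by (rule tr_smult[of _ d]) simp_all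
    finally show ?thesis .
  qed
  have 7: "tr (P * (S * A)) = tr (A * S)"
  proof -
    have "tr (P * (S * A)) = tr ((S * A) * P)" by (rule tr_comm[of _ d d]) simp_all
    also have "\<dots> = tr (S * A)" by (simp only: assoc A_P)
    also have "\<dots> = tr (A * S)" by (rule tr_comm[of _ d d]) simp_all
    finally show ?thesis .
  qed
  have 8: "tr (A * (S * A)) = tr (A * A * S)"
  proof -
    have "tr (A * (S * A)) = tr ((A * S) * A)" by (simp only: assoc)
    also have "\<dots> = tr (A * (A * S))" by (rule tr_comm[of _ d d]) simp_all
    finally show ?thesis by (simp only: assoc)
  qed
  show ?thesis unfolding 1 2 3 4 unfolding 5 6 7 8 ..
qed

end

section \<open>Rank-one updates of the resolvent\<close>

text \<open>\<open>S\<close> is the Gram matrix with the row \<open>x\<close>, \<open>S'\<close> the one in which that row is removed but the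
  normalisation \<open>N\<close> is kept; the lemmas are the Sherman-Morrison formula in this setting.\<close>

locale resolvent_update = R: resolvent d l P S A + R': resolvent d l P S' A'
  for d :: nat and l :: real and P S A S' A' :: "real Matrix.mat" +
  fixes x :: "real Matrix.vec" and N :: real
  assumes x [simp]: "x \<in> carrier_vec d" and N: "0 < N"
    and S_upd: "\<And>v. v \<in> carrier_vec d \<Longrightarrow>
      S *\<^sub>v v = S' *\<^sub>v v + (scalar_prod x v / N) \<cdot>\<^sub>v x"
begin

text \<open>The leverage of \<open>x\<close> measured by the resolvent that does not contain
  \<open>x\<close>. For a random row \<open>A'\<close> and \<open>x\<close> are independent, so
  \<open>q\<close> stays close to \<open>tr A' / N\<close>.\<close>

definition q :: real where "q = scalar_prod x (A' *\<^sub>v x) / N"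

lemma q_nonneg: "0 \<le> q"
  using R'.A_psd[OF x] N by (simp add: q_def)

text \<open>The resolvent identity \<open>A' = A + A (S - S') A'\<close>: the equation of
  \<open>A\<close> is applied to \<open>y = A' v\<close> and that of \<open>A'\<close> to
  \<open>v\<close>, and the two results differ only by the rank-one part of
  \<open>S\<close>.\<close>

lemma A'_vec:
  assumes v [simp]: "v \<in> carrier_vec d"
  shows "A' *\<^sub>v v = A *\<^sub>v v + (scalar_prod x (A' *\<^sub>v v) / N) \<cdot>\<^sub>v (A *\<^sub>v x)"
proof -
  define y where "y = A' *\<^sub>v v"
  define c where "c = scalar_prod x y / N"
  have y [simp]: "y \<in> carrier_vec d" by (simp add: y_def)
  have Py: "P *\<^sub>v y = y" by (simp add: y_def R'.P_A_vec)
  have 1: "y = A *\<^sub>v (S *\<^sub>v y) + l \<cdot>\<^sub>v (A *\<^sub>v y)"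
    using R.A_eq_vec[of y] by (simp add: Py)
  have "A *\<^sub>v (S *\<^sub>v y) = A *\<^sub>v (S' *\<^sub>v y + c \<cdot>\<^sub>v x)" by (simp add: S_upd c_def)
  also have "\<dots> = A *\<^sub>v (S' *\<^sub>v y) + c \<cdot>\<^sub>v (A *\<^sub>v x)"
    by (simp add: mult_add_distrib_mat_vec[of A d d] mult_mat_vec[of A d d])
  finally have 2: "A *\<^sub>v (S *\<^sub>v y) = A *\<^sub>v (S' *\<^sub>v y) + c \<cdot>\<^sub>v (A *\<^sub>v x)" .
  have "A *\<^sub>v v = A *\<^sub>v (P *\<^sub>v v)" by (simp add: R.A_P_vec)
  also have "\<dots> = A *\<^sub>v (P *\<^sub>v (S' *\<^sub>v y) + l \<cdot>\<^sub>v y)"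
    using R'.A_eq'_vec[of v] by (simp add: y_def)
  also have "\<dots> = A *\<^sub>v (S' *\<^sub>v y) + l \<cdot>\<^sub>v (A *\<^sub>v y)"
    by (simp add: mult_add_distrib_mat_vec[of A d d] mult_mat_vec[of A d d] R.A_P_vec)
  finally have 3: "A *\<^sub>v v = A *\<^sub>v (S' *\<^sub>v y) + l \<cdot>\<^sub>v (A *\<^sub>v y)" .
  have "y = (A *\<^sub>v (S' *\<^sub>v y) + c \<cdot>\<^sub>v (A *\<^sub>v x)) + l \<cdot>\<^sub>v (A *\<^sub>v y)"
    using 1 unfolding 2 .
  also have "\<dots> = (A *\<^sub>v (S' *\<^sub>v y) + l \<cdot>\<^sub>v (A *\<^sub>v y)) + c \<cdot>\<^sub>v (A *\<^sub>v x)"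
    by (intro eq_vecI) (auto simp: carrier_matD[OF R.A])
  also have "\<dots> = A *\<^sub>v v + c \<cdot>\<^sub>v (A *\<^sub>v x)" by (simp only: 3)
  finally show ?thesis unfolding y_def c_def .
qed

text \<open>At \<open>v = x\<close> the scalar in \<open>A'_vec\<close> is \<open>q\<close> itself,
  so \<open>A' x\<close> and \<open>A x\<close> are parallel. As \<open>q\<close> is nonnegative,
  \<open>1 + q\<close> can be divided out afterwards.\<close>

lemma A'_x: "A' *\<^sub>v x = (1 + q) \<cdot>\<^sub>v (A *\<^sub>v x)"
proof -
  have "A' *\<^sub>v x = A *\<^sub>v x + q \<cdot>\<^sub>v (A *\<^sub>v x)" using A'_vec[OF x] by (simp add: q_def)
  then show ?thesis
    by (metis add_smult_distrib_vec one_smult_vec)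
qed

lemma A_x: "A *\<^sub>v x = (1 / (1 + q)) \<cdot>\<^sub>v (A' *\<^sub>v x)"
  using q_nonneg unfolding A'_x by (auto simp: smult_smult_assoc)

lemma quad_A_x: "scalar_prod x (A *\<^sub>v x) = N * (q / (1 + q))"
proof -
  have "scalar_prod x (A *\<^sub>v x) = 1 / (1 + q) * scalar_prod x (A' *\<^sub>v x)"
    unfolding A_x by (rule scalar_prod_smult_distrib[of _ d]) simp_all
  then show ?thesis using N by (simp add: q_def)
qed

text \<open>The ratio \<open>q / (1 + q)\<close> saturates at 1, so the bound is independent of the
  size of \<open>x\<close>. This is the source of all deterministic bounds on
  \<open>A x\<close>.\<close>

lemma quad_A_x_le: "scalar_prod x (A *\<^sub>v x) \<le> N"
  unfolding quad_A_x using N q_nonneg by (simp add: field_simps)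

lemma sq_A_x_le: "scalar_prod (A *\<^sub>v x) (A *\<^sub>v x) \<le> N / l"
  using R.A_sq_le_quad[OF x] quad_A_x_le R.l_pos by (simp add: field_simps)

lemma sq_A'_x_le: "scalar_prod (A' *\<^sub>v x) (A' *\<^sub>v x) / N \<le> q / l"
proof -
  have "l * scalar_prod (A' *\<^sub>v x) (A' *\<^sub>v x) \<le> N * q"
    using R'.A_sq_le_quad[OF x] N by (simp add: q_def)
  then show ?thesis using R.l_pos N by (simp add: field_simps)
qed

text \<open>By \<open>A'_vec\<close> the difference of \<open>A'\<close> and \<open>A\<close> is the
  rank-one matrix \<open>(A x) (A' x)^T / N\<close>, whose trace is an inner product.\<close>

lemma tr_A': "tr A' = tr A + scalar_prod (A' *\<^sub>v x) (A *\<^sub>v x) / N"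
proof -
  have idx: "A' $$ (i, i) = A $$ (i, i) + (A' *\<^sub>v x) $ i / N * (A *\<^sub>v x) $ i" if i: "i < d" for i
  proof -
    let ?e = "unit_vec d i :: real Matrix.vec"
    have e: "?e \<in> carrier_vec d" by simp
    have "scalar_prod x (A' *\<^sub>v ?e) = scalar_prod (A' *\<^sub>v x) ?e"
      by (rule scalar_prod_mat_symm[OF R'.A R'.A_sym x e])
    also have "\<dots> = (A' *\<^sub>v x) $ i" using i by (simp add: carrier_matD[OF R'.A])
    finally have 1: "scalar_prod x (A' *\<^sub>v ?e) = (A' *\<^sub>v x) $ i" .
    have 2: "(B *\<^sub>v ?e) $ i = B $$ (i, i)" if "B \<in> carrier_mat d d" for B
      using that i by simp
    show ?thesis
      using arg_cong[OF A'_vec[OF e], of "\<lambda>v. v $ i"] i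
      unfolding 1 by (simp add: 2 carrier_matD[OF R.A] del: index_mult_mat_vec)
  qed
  have "tr A' = (\<Sum>i<d. A $$ (i, i) + (A' *\<^sub>v x) $ i * (A *\<^sub>v x) $ i / N)"
    by (subst tr_eq[OF R'.A]) (auto intro!: sum.cong simp: idx)
  also have "\<dots> = tr A + scalar_prod (A' *\<^sub>v x) (A *\<^sub>v x) / N"
    by (simp add: sum.distrib tr_eq[OF R.A] scalar_prod_sum[of _ d] sum_divide_distrib)
  finally show ?thesis .
qed

text \<open>By \<open>A_x\<close> the rank-one trace is \<open>|A' x|^2 / (N (1 + q))\<close>, and
  \<open>sq_A'_x_le\<close> bounds it by \<open>q / (l (1 + q))\<close>, in which the growth with
  \<open>x\<close> cancels.\<close>

lemma tr_diff: "\<bar>tr A' - tr A\<bar> \<le> 1 / l"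
proof -
  have "scalar_prod (A' *\<^sub>v x) (A *\<^sub>v x) / N = scalar_prod (A' *\<^sub>v x) (A' *\<^sub>v x) / N / (1 + q)"
    unfolding A_x by simp
  moreover have "0 \<le> scalar_prod (A' *\<^sub>v x) (A' *\<^sub>v x) / N / (1 + q)"
    using N q_nonneg by (intro divide_nonneg_nonneg scalar_prod_self_nonneg) auto
  moreover have "scalar_prod (A' *\<^sub>v x) (A' *\<^sub>v x) / N / (1 + q) \<le> q / l / (1 + q)"
    using q_nonneg by (intro divide_right_mono sq_A'_x_le) auto
  moreover have "q / l / (1 + q) \<le> 1 / l"
    using q_nonneg R.l_pos by (simp add: divide_le_eq)
  ultimately show ?thesis unfolding tr_A' by linarith
qed

text \<open>\<open>A'_vec\<close> at \<open>v = A' x\<close> expresses \<open>A (A' x)\<close>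
  through \<open>A'\<close>; with \<open>A_x\<close> the vector \<open>A (A x)\<close> is then
  written in terms of \<open>A'\<close> and \<open>x\<close>, which are independent for a random
  row.\<close>

lemma A_A_x:
  "A *\<^sub>v (A *\<^sub>v x) = (1 / (1 + q)) \<cdot>\<^sub>v (A' *\<^sub>v (A' *\<^sub>v x)) +
     (- (scalar_prod (A' *\<^sub>v x) (A' *\<^sub>v x) / N / (1 + q)\<^sup>2)) \<cdot>\<^sub>v (A' *\<^sub>v x)"
proof -
  let ?y = "A' *\<^sub>v x" and ?t = "scalar_prod (A' *\<^sub>v x) (A' *\<^sub>v x) / N"
  have t: "scalar_prod x (A' *\<^sub>v ?y) / N = ?t"
    using scalar_prod_mat_symm[OF R'.A R'.A_sym x, of ?y] by simp
  have "A' *\<^sub>v ?y = A *\<^sub>v ?y + (?t / (1 + q)) \<cdot>\<^sub>v ?y"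
    using A'_vec[of ?y] unfolding t A_x by (simp add: smult_smult_assoc)
  then have 1: "A *\<^sub>v ?y = A' *\<^sub>v ?y + (- (?t / (1 + q))) \<cdot>\<^sub>v ?y"
    by (auto intro!: eq_vecI simp: carrier_matD[OF R.A] carrier_matD[OF R'.A] simp del: index_mult_mat_vec)
  have "A *\<^sub>v (A *\<^sub>v x) = (1 / (1 + q)) \<cdot>\<^sub>v (A *\<^sub>v ?y)"
    unfolding A_x using R.A by (intro mult_mat_vec[of _ d d]) (simp_all add: mult_mat_vec_carrier[of _ d d])
  also have "\<dots> = (1 / (1 + q)) \<cdot>\<^sub>v (A' *\<^sub>v ?y) + (- (?t / (1 + q)\<^sup>2)) \<cdot>\<^sub>v ?y"
    unfolding 1 using q_nonneg
    by (intro eq_vecI)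
      (auto simp: carrier_matD[OF R'.A] power2_eq_square distrib_left distrib_right right_diff_distrib simp del: index_mult_mat_vec)
  finally show ?thesis .
qed

text \<open>Splitting \<open>S\<close> into \<open>S'\<close> and the rank-one part produces the
  product with \<open>x . Q x\<close>, which is the main term. By \<open>A_A_x\<close> the rest is a
  combination of the forms of \<open>C2\<close> and \<open>C1\<close> built from \<open>S'\<close>
  and \<open>A'\<close>, with coefficients at most 1 and \<open>1/l\<close>; these matrices have
  trace zero and do not contain \<open>x\<close>.\<close>

lemma quad_C2:
  "\<bar>scalar_prod x (R.C2 *\<^sub>v x) -
      scalar_prod (A *\<^sub>v x) (A *\<^sub>v x) / N * scalar_prod x (R.Q *\<^sub>v x)\<bar>
    \<le> \<bar>scalar_prod x (R'.C2 *\<^sub>v x)\<bar> + \<bar>scalar_prod x (R'.C1 *\<^sub>v x)\<bar> / l"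
proof -
  let ?Q = "R.Q" and ?t = "scalar_prod (A' *\<^sub>v x) (A' *\<^sub>v x) / N"
  have C2: "R.C2 *\<^sub>v x = ?Q *\<^sub>v (S *\<^sub>v (A *\<^sub>v (A *\<^sub>v x)))"
    unfolding R.C2_def by (simp add: assoc_mult_mat_vec[of _ d d _ d] R.assoc_d)
  have C2': "R'.C2 *\<^sub>v x = ?Q *\<^sub>v (S' *\<^sub>v (A' *\<^sub>v (A' *\<^sub>v x)))"
    unfolding R'.C2_def by (simp add: assoc_mult_mat_vec[of _ d d _ d] R.assoc_d)
  have C1': "R'.C1 *\<^sub>v x = ?Q *\<^sub>v (S' *\<^sub>v (A' *\<^sub>v x))"
    unfolding R'.C1_def by (simp add: assoc_mult_mat_vec[of _ d d _ d] R.assoc_d)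
  have "R.C2 *\<^sub>v x = ?Q *\<^sub>v (S' *\<^sub>v (A *\<^sub>v (A *\<^sub>v x)) +
      (scalar_prod x (A *\<^sub>v (A *\<^sub>v x)) / N) \<cdot>\<^sub>v x)"
    unfolding C2 by (simp add: S_upd)
  also have "scalar_prod x (A *\<^sub>v (A *\<^sub>v x)) = scalar_prod (A *\<^sub>v x) (A *\<^sub>v x)"
    by (simp add: scalar_prod_mat_symm[OF R.A R.A_sym])
  also have "?Q *\<^sub>v (S' *\<^sub>v (A *\<^sub>v (A *\<^sub>v x)) + (scalar_prod (A *\<^sub>v x) (A *\<^sub>v x) / N) \<cdot>\<^sub>v x)
      = ?Q *\<^sub>v (S' *\<^sub>v (A *\<^sub>v (A *\<^sub>v x))) + (scalar_prod (A *\<^sub>v x) (A *\<^sub>v x) / N) \<cdot>\<^sub>v (?Q *\<^sub>v x)"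
    by (simp add: mult_add_distrib_mat_vec[of _ d d] mult_mat_vec[of _ d d])
  also have "?Q *\<^sub>v (S' *\<^sub>v (A *\<^sub>v (A *\<^sub>v x))) =
      (1 / (1 + q)) \<cdot>\<^sub>v (R'.C2 *\<^sub>v x) + (- (?t / (1 + q)\<^sup>2)) \<cdot>\<^sub>v (R'.C1 *\<^sub>v x)"
    unfolding A_A_x C2' C1'
    by (simp add: mult_add_distrib_mat_vec[of _ d d] mult_mat_vec[of _ d d])
  finally have eq: "scalar_prod x (R.C2 *\<^sub>v x) -
      scalar_prod (A *\<^sub>v x) (A *\<^sub>v x) / N * scalar_prod x (?Q *\<^sub>v x)
      = 1 / (1 + q) * scalar_prod x (R'.C2 *\<^sub>v x) - ?t / (1 + q)\<^sup>2 * scalar_prod x (R'.C1 *\<^sub>v x)"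
    by (simp add: scalar_prod_add_distrib[of _ d] mult_mat_vec_carrier[of _ d d] scalar_prod_smult_distrib[of _ d])
  have t0: "0 \<le> ?t" using N by (intro divide_nonneg_nonneg scalar_prod_self_nonneg) auto
  have "?t / (1 + q)\<^sup>2 \<le> q / l / (1 + q)\<^sup>2"
    by (intro divide_right_mono sq_A'_x_le) auto
  also have "\<dots> \<le> 1 / l"
  proof -
    have "q \<le> (1 + q)\<^sup>2" using q_nonneg by (simp add: power2_eq_square algebra_simps)
    then show ?thesis using q_nonneg R.l_pos by (simp add: divide_le_eq)
  qed
  finally have t1: "?t / (1 + q)\<^sup>2 \<le> 1 / l" .
  have "\<bar>1 / (1 + q) * scalar_prod x (R'.C2 *\<^sub>v x) - ?t / (1 + q)\<^sup>2 * scalar_prod x (R'.C1 *\<^sub>v x)\<bar>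
      \<le> \<bar>1 / (1 + q) * scalar_prod x (R'.C2 *\<^sub>v x)\<bar> + \<bar>?t / (1 + q)\<^sup>2 * scalar_prod x (R'.C1 *\<^sub>v x)\<bar>"
    by (rule abs_triangle_ineq4)
  also have "\<bar>1 / (1 + q) * scalar_prod x (R'.C2 *\<^sub>v x)\<bar> \<le> 1 * \<bar>scalar_prod x (R'.C2 *\<^sub>v x)\<bar>"
    unfolding abs_mult using q_nonneg by (intro mult_right_mono) auto
  also have "\<bar>?t / (1 + q)\<^sup>2 * scalar_prod x (R'.C1 *\<^sub>v x)\<bar> \<le> 1 / l * \<bar>scalar_prod x (R'.C1 *\<^sub>v x)\<bar>"
  proof -
    have "0 \<le> ?t / (1 + q)\<^sup>2" using t0 by (rule divide_nonneg_nonneg) simp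
    then have "\<bar>?t / (1 + q)\<^sup>2\<bar> \<le> 1 / l" using t1 by (subst abs_of_nonneg)
    then show ?thesis unfolding abs_mult by (rule mult_right_mono) simp
  qed
  finally show ?thesis unfolding eq by simp
qed

end

section \<open>Gram matrices and the ridge inverse\<close>

definition gram :: "real Matrix.mat \<Rightarrow> real Matrix.mat" where
  "gram X = (1 / real (dim_row X)) \<cdot>\<^sub>m (transpose_mat X * X)"

text \<open>Bracketed exactly as inside \<open>ridge_predictor\<close>, so that the definition can
  be folded there.\<close>

definition ridge_matrix :: "real \<Rightarrow> real Matrix.mat \<Rightarrow> real Matrix.mat \<Rightarrow> real Matrix.mat" where
  "ridge_matrix l W X = (1 / real (dim_row X)) \<cdot>\<^sub>m (W * transpose_mat X * X * transpose_mat W)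
     + l \<cdot>\<^sub>m 1\<^sub>m (dim_row W)"

definition resol :: "real \<Rightarrow> real Matrix.mat \<Rightarrow> real Matrix.mat \<Rightarrow> real Matrix.mat" where
  "resol l W X = transpose_mat W * (the (mat_inverse (ridge_matrix l W X)) * W)"

text \<open>The row is overwritten by zeros and not deleted: the dimensions and the factor
  \<open>1/n\<close> in \<open>gram\<close> stay the same, as the rank-one update requires.\<close>

definition zero_row :: "nat \<Rightarrow> real Matrix.mat \<Rightarrow> real Matrix.mat" where
  "zero_row i X = Matrix.mat (dim_row X) (dim_col X) (\<lambda>(a, b). if a = i then 0 else X $$ (a, b))"

lemma zero_row_carrier [simp]: "X \<in> carrier_mat n d \<Longrightarrow> zero_row i X \<in> carrier_mat n d"
  by (auto simp: zero_row_def)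

lemma gram_carrier [simp]: "X \<in> carrier_mat n d \<Longrightarrow> gram X \<in> carrier_mat d d"
  by (auto simp: gram_def intro!: mult_carrier_mat[of _ d n])

lemma gram_index:
  assumes "X \<in> carrier_mat n d" "j < d" "k < d"
  shows "gram X $$ (j, k) = (\<Sum>i<n. X $$ (i, j) * X $$ (i, k)) / real n"
proof -
  have "(transpose_mat X * X) $$ (j, k) = (\<Sum>i<n. X $$ (i, j) * X $$ (i, k))"
    using assms by (subst index_mult_mat_sum[of _ d n _ d]) auto
  then show ?thesis using assms by (simp add: gram_def del: index_mult_mat(1))
qed

lemma gram_mult_vec_index:
  assumes X: "X \<in> carrier_mat n d" and v: "v \<in> carrier_vec d" and k: "k < d"
  shows "(gram X *\<^sub>v v) $ k = (\<Sum>i<n. scalar_prod (Matrix.row X i) v * X $$ (i, k)) / real n"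
proof -
  have "(gram X *\<^sub>v v) $ k = (\<Sum>r<d. gram X $$ (k, r) * v $ r)"
    using X v k by (intro index_mult_mat_vec_sum[of _ d d]) auto
  also have "\<dots> = (\<Sum>r<d. (\<Sum>i<n. X $$ (i, k) * X $$ (i, r) * v $ r) / real n)"
    using X k by (intro sum.cong) (auto simp: gram_index sum_distrib_right)
  also have "\<dots> = (\<Sum>i<n. (\<Sum>r<d. X $$ (i, k) * X $$ (i, r) * v $ r)) / real n"
    by (subst sum.swap) (simp add: sum_divide_distrib)
  also have "(\<Sum>i<n. (\<Sum>r<d. X $$ (i, k) * X $$ (i, r) * v $ r))
      = (\<Sum>i<n. scalar_prod (Matrix.row X i) v * X $$ (i, k))"
    using X v by (intro sum.cong) (auto simp: scalar_prod_sum[of _ d] sum_distrib_left mult_ac intro!: sum.cong)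
  finally show ?thesis .
qed

lemma scalar_prod_gram:
  assumes X: "X \<in> carrier_mat n d" and u: "u \<in> carrier_vec d" and v: "v \<in> carrier_vec d"
  shows "scalar_prod u (gram X *\<^sub>v v) =
    (\<Sum>i<n. scalar_prod (Matrix.row X i) u * scalar_prod (Matrix.row X i) v) / real n"
proof -
  have "scalar_prod u (gram X *\<^sub>v v) = (\<Sum>k<d. u $ k * (gram X *\<^sub>v v) $ k)"
    using X v by (intro scalar_prod_sum mult_mat_vec_carrier[of _ d d]) auto
  also have "\<dots> = (\<Sum>k<d. \<Sum>i<n. u $ k * scalar_prod (Matrix.row X i) v * X $$ (i, k)) / real n"
    by (auto simp: gram_mult_vec_index[OF X v] sum_divide_distrib sum_distrib_left mult_ac intro!: sum.cong
        simp del: index_mult_mat_vec)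
  also have "(\<Sum>k<d. \<Sum>i<n. u $ k * scalar_prod (Matrix.row X i) v * X $$ (i, k))
      = (\<Sum>i<n. (\<Sum>k<d. X $$ (i, k) * u $ k) * scalar_prod (Matrix.row X i) v)"
    by (subst sum.swap) (simp add: sum_distrib_left sum_distrib_right mult_ac)
  also have "\<dots> = (\<Sum>i<n. scalar_prod (Matrix.row X i) u * scalar_prod (Matrix.row X i) v)"
    using X u by (intro sum.cong) (auto simp: scalar_prod_sum[of u d])
  finally show ?thesis .
qed

text \<open>Each row \<open>x\<close> contributes \<open>x x^T / n\<close> to the Gram matrix, so a
  trace against it is an average of quadratic forms, one per row. This is the shape in which single
  rows can be taken out.\<close>

lemma tr_mult_gram:
  assumes X: "X \<in> carrier_mat n d" and B: "B \<in> carrier_mat d d"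
  shows "tr (B * gram X) = (\<Sum>i<n. scalar_prod (Matrix.row X i) (B *\<^sub>v Matrix.row X i)) / real n"
proof -
  have 1: "tr (B * gram X) = (\<Sum>j<d. \<Sum>k<d. B $$ (j, k) * gram X $$ (k, j))"
    using B X by (subst tr_eq[of _ d])
      (auto intro!: sum.cong index_mult_mat_sum[of _ d d] mult_carrier_mat[of _ d d] simp del: index_mult_mat)
  have 2: "scalar_prod (Matrix.row X i) (B *\<^sub>v Matrix.row X i)
      = (\<Sum>j<d. \<Sum>k<d. B $$ (j, k) * (X $$ (i, k) * X $$ (i, j)))" if "i < n" for i
  proof -
    have "scalar_prod (Matrix.row X i) (B *\<^sub>v Matrix.row X i)
        = (\<Sum>j<d. Matrix.row X i $ j * (B *\<^sub>v Matrix.row X i) $ j)"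
      using B X by (intro scalar_prod_sum mult_mat_vec_carrier[of _ d d]) auto
    also have "\<dots> = (\<Sum>j<d. X $$ (i, j) * (\<Sum>k<d. B $$ (j, k) * X $$ (i, k)))"
      using that X by (intro sum.cong refl)
        (auto simp: index_mult_mat_vec_sum[OF B] simp del: index_mult_mat_vec)
    finally show ?thesis by (simp add: sum_distrib_left mult_ac)
  qed
  have "tr (B * gram X) = (\<Sum>j<d. \<Sum>k<d. \<Sum>i<n. B $$ (j, k) * (X $$ (i, k) * X $$ (i, j))) / real n"
    unfolding 1 using X by (simp add: gram_index sum_distrib_left sum_divide_distrib)
  also have "(\<Sum>j<d. \<Sum>k<d. \<Sum>i<n. B $$ (j, k) * (X $$ (i, k) * X $$ (i, j)))
      = (\<Sum>i<n. \<Sum>j<d. \<Sum>k<d. B $$ (j, k) * (X $$ (i, k) * X $$ (i, j)))"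
  proof -
    have "(\<Sum>j<d. \<Sum>k<d. \<Sum>i<n. B $$ (j, k) * (X $$ (i, k) * X $$ (i, j)))
        = (\<Sum>j<d. \<Sum>i<n. \<Sum>k<d. B $$ (j, k) * (X $$ (i, k) * X $$ (i, j)))"
      by (rule sum.cong[OF refl], rule sum.swap)
    then show ?thesis by (simp only:) (rule sum.swap)
  qed
  finally show ?thesis by (simp add: 2)
qed

lemma smult_mat_mult_vec:
  assumes "B \<in> carrier_mat n k" "v \<in> carrier_vec k"
  shows "(c \<cdot>\<^sub>m B) *\<^sub>v v = c \<cdot>\<^sub>v (B *\<^sub>v (v :: real Matrix.vec))"
  using assms by (intro eq_vecI) auto

locale ridge =
  fixes d n p :: nat and l :: real and W X :: "real Matrix.mat"
  assumes W: "W \<in> carrier_mat p d" and X: "X \<in> carrier_mat n d"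
    and n: "0 < n" and l: "0 < l"
begin

lemma W_XT: "W * transpose_mat X \<in> carrier_mat p n"
  using W X by (intro mult_carrier_mat[of _ p d]) auto

lemma ZZT: "(W * transpose_mat X) * transpose_mat (W * transpose_mat X) \<in> carrier_mat p p"
  by (rule mult_carrier_mat[OF W_XT transpose_carrier_mat[THEN iffD2, OF W_XT]])

lemma W_XT_X_WT:
  "W * transpose_mat X * X * transpose_mat W = (W * transpose_mat X) * transpose_mat (W * transpose_mat X)"
  using W X W_XT transpose_mult[of W p d "transpose_mat X" n]
    assoc_mult_mat[of "W * transpose_mat X" p n X d "transpose_mat W" p] by simp

lemma ridge_matrix_carrier: "ridge_matrix l W X \<in> carrier_mat p p"
  using W ZZT unfolding ridge_matrix_def W_XT_X_WT by simp

lemma ridge_matrix_sym: "transpose_mat (ridge_matrix l W X) = ridge_matrix l W X"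
proof -
  let ?Z = "W * transpose_mat X"
  note ZZ = ZZT
  have "transpose_mat (?Z * transpose_mat ?Z) = ?Z * transpose_mat ?Z"
    using transpose_mult[of ?Z p n "transpose_mat ?Z" p] W_XT by simp
  then show ?thesis
    using ZZ W transpose_add[of "(1 / real (dim_row X)) \<cdot>\<^sub>m (?Z * transpose_mat ?Z)" p p "l \<cdot>\<^sub>m 1\<^sub>m p"]
    unfolding ridge_matrix_def W_XT_X_WT by (simp add: transpose_smult_mat)
qed

lemma ridge_matrix_vec:
  assumes v: "v \<in> carrier_vec p"
  shows "scalar_prod v (ridge_matrix l W X *\<^sub>v v) =
    scalar_prod (transpose_mat (W * transpose_mat X) *\<^sub>v v) (transpose_mat (W * transpose_mat X) *\<^sub>v v) / real n
     + l * scalar_prod v v"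
proof -
  let ?Z = "W * transpose_mat X" and ?c = "1 / real n"
  note ZZ = ZZT
  have Zv: "transpose_mat ?Z *\<^sub>v v \<in> carrier_vec n"
    using W_XT v by (intro mult_mat_vec_carrier[of _ n p]) auto
  have "ridge_matrix l W X *\<^sub>v v = (?c \<cdot>\<^sub>m (?Z * transpose_mat ?Z)) *\<^sub>v v + (l \<cdot>\<^sub>m 1\<^sub>m p) *\<^sub>v v"
    unfolding ridge_matrix_def W_XT_X_WT using X W ZZ v
    by (simp add: add_mult_distrib_mat_vec[of _ p p])
  also have "(?c \<cdot>\<^sub>m (?Z * transpose_mat ?Z)) *\<^sub>v v = ?c \<cdot>\<^sub>v (?Z *\<^sub>v (transpose_mat ?Z *\<^sub>v v))"
    unfolding smult_mat_mult_vec[OF ZZ v] using W_XT v by simp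
  also have "(l \<cdot>\<^sub>m 1\<^sub>m p) *\<^sub>v v = l \<cdot>\<^sub>v v"
    using smult_mat_mult_vec[OF one_carrier_mat v] v by simp
  finally have "scalar_prod v (ridge_matrix l W X *\<^sub>v v) =
      ?c * scalar_prod v (?Z *\<^sub>v (transpose_mat ?Z *\<^sub>v v)) + l * scalar_prod v v"
    using v W_XT Zv by (simp add: scalar_prod_add_distrib[of _ p] mult_mat_vec_carrier[of _ p n]
        scalar_prod_smult_distrib[of _ p])
  also have "scalar_prod v (?Z *\<^sub>v (transpose_mat ?Z *\<^sub>v v)) =
      scalar_prod (transpose_mat ?Z *\<^sub>v v) (transpose_mat ?Z *\<^sub>v v)"
    using transpose_vec_mult_scalar[of ?Z p n "transpose_mat ?Z *\<^sub>v v" v] W_XT v Zv by simp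
  finally show ?thesis by simp
qed

text \<open>By \<open>ridge_matrix_vec\<close> a kernel vector \<open>v\<close> would satisfy
  \<open>l |v|^2 \<le> 0\<close>.\<close>

lemma ridge_matrix_det: "Determinant.det (ridge_matrix l W X) \<noteq> 0"
proof
  assume "Determinant.det (ridge_matrix l W X) = 0"
  then obtain v where v: "v \<in> carrier_vec p" "v \<noteq> 0\<^sub>v p" "ridge_matrix l W X *\<^sub>v v = 0\<^sub>v p"
    using det_0_iff_vec_prod_zero[OF ridge_matrix_carrier] by blast
  have "0 = scalar_prod v (ridge_matrix l W X *\<^sub>v v)" using v by simp
  also have "\<dots> \<ge> l * scalar_prod v v"
    unfolding ridge_matrix_vec[OF v(1)] using n by (simp add: scalar_prod_self_nonneg)
  finally have "scalar_prod v v \<le> 0" using l by (simp add: mult_le_0_iff)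
  then have "(\<Sum>i<p. (v $ i)\<^sup>2) = 0"
    using v(1) by (simp add: scalar_prod_sum[of _ p] power2_eq_square antisym sum_nonneg)
  then have "v = 0\<^sub>v p"
    using v(1) by (intro eq_vecI) (auto simp: sum_nonneg_eq_0_iff)
  with v show False by simp
qed

lemma mat_inverse_ridge:
  obtains R where "mat_inverse (ridge_matrix l W X) = Some R" "R \<in> carrier_mat p p"
    "ridge_matrix l W X * R = 1\<^sub>m p" "R * ridge_matrix l W X = 1\<^sub>m p"
proof (cases "mat_inverse (ridge_matrix l W X)")
  case None
  then have "ridge_matrix l W X \<notin> Units (ring_mat TYPE(real) p ())"
    using mat_inverse(1)[OF ridge_matrix_carrier] by simp
  moreover have "ridge_matrix l W X \<in> Units (ring_mat TYPE(real) p ())"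
    using det_non_zero_imp_unit[OF ridge_matrix_carrier ridge_matrix_det] .
  ultimately show ?thesis by simp
next
  case (Some R)
  then show ?thesis using mat_inverse(2)[OF ridge_matrix_carrier, of R] that by auto
qed

text \<open>Cramer's formula, wanted for measurability: \<open>mat_inverse\<close> is defined by
  elimination, whereas determinant and adjugate are polynomials in the entries.\<close>

lemma mat_inverse_ridge_adj:
  "the (mat_inverse (ridge_matrix l W X)) =
     (1 / Determinant.det (ridge_matrix l W X)) \<cdot>\<^sub>m adj_mat (ridge_matrix l W X)"
proof -
  let ?B = "ridge_matrix l W X" and ?D = "Determinant.det (ridge_matrix l W X)"
  obtain R where R: "mat_inverse ?B = Some R" "R \<in> carrier_mat p p" "R * ?B = 1\<^sub>m p"
    by (rule mat_inverse_ridge)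
  note B = ridge_matrix_carrier and adj = adj_mat[OF ridge_matrix_carrier]
  have "adj_mat ?B = (R * ?B) * adj_mat ?B" using R adj by simp
  also have "\<dots> = R * (?D \<cdot>\<^sub>m 1\<^sub>m p)"
    using assoc_mult_mat[OF R(2) B adj(1)] adj(2) by simp
  also have "\<dots> = ?D \<cdot>\<^sub>m R"
    using mult_smult_distrib[OF R(2) one_carrier_mat] R(2) by simp
  finally have "adj_mat ?B = ?D \<cdot>\<^sub>m R" .
  then have "(1 / ?D) \<cdot>\<^sub>m adj_mat ?B = R"
    using R(2) ridge_matrix_det by (intro eq_matI) auto
  then show ?thesis using R by simp
qed

lemma resol_carrier: "resol l W X \<in> carrier_mat d d"
proof -
  obtain R where R: "mat_inverse (ridge_matrix l W X) = Some R" "R \<in> carrier_mat p p"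
    by (rule mat_inverse_ridge)
  show ?thesis unfolding resol_def R(1) using R(2) W by (auto intro!: mult_carrier_mat[of _ d p] mult_carrier_mat[of _ p p])
qed

text \<open>With \<open>R\<close> the inverse of the ridge matrix and \<open>A = W^T R W\<close>,
  the expression \<open>A S P + l A\<close> is \<open>W^T\<close> times
  \<open>R (W S W^T + l)\<close> times \<open>W\<close>, and the middle factor is 1. The remaining
  equations hold because \<open>W W^T = 1\<close> makes \<open>W P = W\<close>.\<close>

lemma resolvent_resol:
  assumes orth: "W * transpose_mat W = 1\<^sub>m p"
  shows "resolvent d l (transpose_mat W * W) (gram X) (resol l W X)"
proof
  let ?WT = "transpose_mat W" and ?S = "gram X" and ?B = "ridge_matrix l W X"
  let ?A = "resol l W X"
  obtain R where inv: "mat_inverse ?B = Some R" and R [simp]: "R \<in> carrier_mat p p"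
    and BR: "?B * R = 1\<^sub>m p" and RB: "R * ?B = 1\<^sub>m p" by (rule mat_inverse_ridge)
  have W' [simp]: "W \<in> carrier_mat p d" "?WT \<in> carrier_mat d p" using W by auto
  have S [simp]: "?S \<in> carrier_mat d d" using X by simp
  have A_def: "?A = ?WT * (R * W)" by (simp add: resol_def inv)
  have RW [simp]: "R * W \<in> carrier_mat p d" by (rule mult_carrier_mat[of _ p p]) simp_all
  have WTW [simp]: "?WT * W \<in> carrier_mat d d" by (rule mult_carrier_mat[of _ d p]) simp_all
  have WS [simp]: "W * ?S \<in> carrier_mat p d" by (rule mult_carrier_mat[of _ p d]) simp_all
  have SWT [simp]: "?S * ?WT \<in> carrier_mat d p" by (rule mult_carrier_mat[of _ d d]) simp_all
  show "?WT * W \<in> carrier_mat d d" "?S \<in> carrier_mat d d" by simp_all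
  show A: "?A \<in> carrier_mat d d" by (rule resol_carrier)
  show "transpose_mat (?WT * W) = ?WT * W"
    using transpose_mult[of ?WT d p W d] by simp
  show S_sym: "transpose_mat ?S = ?S"
    using X transpose_mult[of "transpose_mat X" d n X d] by (simp add: gram_def transpose_smult_mat)
  \<comment> \<open>The inverse of a symmetric matrix is symmetric:
    \<open>R^T = R^T (B R) = (B R)^T R = R\<close>.\<close>
  have R_sym: "transpose_mat R = R"
  proof -
    have RT: "transpose_mat R \<in> carrier_mat p p" by simp
    have "transpose_mat R = transpose_mat R * (?B * R)" by (simp add: BR right_mult_one_mat[OF RT])
    also have "\<dots> = transpose_mat R * ?B * R"
      using assoc_mult_mat[OF RT ridge_matrix_carrier R] by simp
    also have "transpose_mat R * ?B = transpose_mat (?B * R)"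
      using transpose_mult[OF ridge_matrix_carrier R] ridge_matrix_sym by simp
    finally show ?thesis by (simp add: BR left_mult_one_mat[OF R])
  qed
  show "transpose_mat ?A = ?A"
    unfolding A_def using transpose_mult[OF W'(2) RW] transpose_mult[OF R W'(1)] R_sym
      assoc_mult_mat[OF W'(2) R W'(1)] by simp
  have W_P: "W * (?WT * W) = W"
    using assoc_mult_mat[OF W'(1) W'(2) W'(1)] orth left_mult_one_mat[OF W'(1)] by simp
  show "?WT * W * (?WT * W) = ?WT * W"
    using assoc_mult_mat[OF W'(2) W'(1) WTW] W_P by simp
  show "?A * (?WT * W) = ?A"
    unfolding A_def using assoc_mult_mat[OF W'(2) RW WTW] assoc_mult_mat[OF R W'(1) WTW] W_P by simp
  have B_eq: "?B = W * (?S * ?WT) + l \<cdot>\<^sub>m 1\<^sub>m p"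
  proof -
    have "W * transpose_mat X * X * ?WT = W * (transpose_mat X * X * ?WT)"
      using X by (simp add: assoc_mult_mat[of _ p d _ n _ d] assoc_mult_mat[of W p d _ d ?WT p]
          mult_carrier_mat[of _ d n])
    moreover have "?S * ?WT = (1 / real n) \<cdot>\<^sub>m (transpose_mat X * X * ?WT)"
      using X mult_smult_assoc_mat[of "transpose_mat X * X" d d ?WT p "1 / real n"]
      by (simp add: gram_def mult_carrier_mat[of _ d n])
    moreover have "transpose_mat X * X * ?WT \<in> carrier_mat d p"
      using X by (intro mult_carrier_mat[of _ d d] mult_carrier_mat[of _ d n]) auto
    ultimately show ?thesis
      using X mult_smult_distrib[OF W'(1), of "transpose_mat X * X * ?WT" p "1 / real n"]
      by (simp add: ridge_matrix_def carrier_matD[OF W] del: assoc_mult_mat)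
  qed
  have "?A * ?S * (?WT * W) = ?WT * (R * (W * (?S * ?WT)) * W)"
  proof -
    have c1: "R * (W * (?S * ?WT)) \<in> carrier_mat p p"
      by (intro mult_carrier_mat[of _ p p] mult_carrier_mat[of _ p d]) simp_all
    have "?A * ?S * (?WT * W) = ?A * (?S * (?WT * W))"
      by (rule assoc_mult_mat[OF A S WTW])
    also have "?S * (?WT * W) = ?S * ?WT * W" by (rule assoc_mult_mat[symmetric, OF S W'(2) W'(1)])
    also have "?A * (?S * ?WT * W) = ?WT * (R * W * (?S * ?WT * W))"
      unfolding A_def by (rule assoc_mult_mat[OF W'(2) RW mult_carrier_mat[OF SWT W'(1)]])
    also have "R * W * (?S * ?WT * W) = R * W * (?S * ?WT) * W"
      by (rule assoc_mult_mat[symmetric, OF RW SWT W'(1)])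
    also have "R * W * (?S * ?WT) = R * (W * (?S * ?WT))"
      by (rule assoc_mult_mat[OF R W'(1) SWT])
    finally show ?thesis .
  qed
  moreover have "R * (W * (?S * ?WT)) + l \<cdot>\<^sub>m R = 1\<^sub>m p"
  proof -
    have c2: "W * (?S * ?WT) \<in> carrier_mat p p" by (rule mult_carrier_mat[OF W'(1) SWT])
    have "R * ?B = R * (W * (?S * ?WT)) + R * (l \<cdot>\<^sub>m 1\<^sub>m p)"
      unfolding B_eq by (rule mult_add_distrib_mat[OF R c2]) simp
    also have "R * (l \<cdot>\<^sub>m 1\<^sub>m p) = l \<cdot>\<^sub>m R"
      using mult_smult_distrib[OF R, of "1\<^sub>m p" p l] right_mult_one_mat[OF R] by simp
    finally show ?thesis using RB by simp
  qed
  moreover have "?WT * (R * (W * (?S * ?WT)) * W) + l \<cdot>\<^sub>m ?A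
      = ?WT * ((R * (W * (?S * ?WT)) + l \<cdot>\<^sub>m R) * W)"
  proof -
    let ?C = "R * (W * (?S * ?WT))"
    have C: "?C \<in> carrier_mat p p" by (rule mult_carrier_mat[OF R mult_carrier_mat[OF W'(1) SWT]])
    have "(?C + l \<cdot>\<^sub>m R) * W = ?C * W + (l \<cdot>\<^sub>m R) * W"
      by (rule add_mult_distrib_mat[OF C _ W'(1)]) simp
    also have "(l \<cdot>\<^sub>m R) * W = l \<cdot>\<^sub>m (R * W)" by (rule mult_smult_assoc_mat[OF R W'(1)])
    finally have "?WT * ((?C + l \<cdot>\<^sub>m R) * W) = ?WT * (?C * W + l \<cdot>\<^sub>m (R * W))" by simp
    also have "\<dots> = ?WT * (?C * W) + ?WT * (l \<cdot>\<^sub>m (R * W))"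
      by (rule mult_add_distrib_mat[OF W'(2) mult_carrier_mat[OF C W'(1)]]) simp
    also have "?WT * (l \<cdot>\<^sub>m (R * W)) = l \<cdot>\<^sub>m ?A"
      unfolding A_def by (rule mult_smult_distrib[OF W'(2) RW])
    finally show ?thesis by simp
  qed
  ultimately show "?A * ?S * (?WT * W) + l \<cdot>\<^sub>m ?A = ?WT * W"
    using left_mult_one_mat[OF W'(1)] by simp
  show "0 \<le> scalar_prod v (?S *\<^sub>v v)" if "v \<in> carrier_vec d" for v
    unfolding scalar_prod_gram[OF X that that] by (intro divide_nonneg_nonneg sum_nonneg) auto
  show "0 < l" by (rule l)
qed

end

section \<open>Removing the rows of a fixed data matrix one at a time\<close>

locale ridge_orth = ridge +
  assumes orth: "W * transpose_mat W = 1\<^sub>m p"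
begin

abbreviation "P \<equiv> transpose_mat W * W"
abbreviation "A \<equiv> resol l W X"
abbreviation "A' i \<equiv> resol l W (zero_row i X)"
abbreviation "x i \<equiv> Matrix.row X i"

lemma x_carrier [simp]: "x i \<in> carrier_vec d"
  using X by (auto intro!: carrier_vecI)

sublocale R: resolvent d l P "gram X" A
  by (rule resolvent_resol[OF orth])

lemma zero_row_resolvent: "resolvent d l P (gram (zero_row i X)) (A' i)"
proof -
  interpret Z: ridge d n p l W "zero_row i X"
    using W X n l by unfold_locales auto
  show ?thesis by (rule Z.resolvent_resol[OF orth])
qed

text \<open>A row of zeros contributes nothing to \<open>gram_mult_vec_index\<close>, so the two
  Gram matrices differ exactly in the summand of row \<open>i\<close>.\<close>

lemma update: "i < n \<Longrightarrow> resolvent_update d l P (gram X) A (gram (zero_row i X)) (A' i) (x i) (real n)"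
proof -
  assume i: "i < n"
  interpret R': resolvent d l P "gram (zero_row i X)" "A' i" by (rule zero_row_resolvent)
  show ?thesis
  proof
    show "0 < real n" using n by simp
    fix v :: "real Matrix.vec" assume v: "v \<in> carrier_vec d"
    show "gram X *\<^sub>v v = gram (zero_row i X) *\<^sub>v v + (scalar_prod (x i) v / real n) \<cdot>\<^sub>v x i"
    proof (intro eq_vecI)
      fix k assume "k < dim_vec (gram (zero_row i X) *\<^sub>v v + (scalar_prod (x i) v / real n) \<cdot>\<^sub>v x i)"
      then have k: "k < d" using carrier_matD[OF X] by simp
      have Z: "zero_row i X \<in> carrier_mat n d" using X by simp
      have row: "Matrix.row (zero_row i X) a = x a" if "a < n" "a \<noteq> i" for a
        using that X by (intro eq_vecI) (auto simp: zero_row_def)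
      let ?f = "\<lambda>a. scalar_prod (Matrix.row (zero_row i X) a) v * zero_row i X $$ (a, k)"
      let ?g = "\<lambda>a. scalar_prod (x a) v * X $$ (a, k)"
      have fi: "?f i = 0" using i k X by (simp add: zero_row_def)
      have fa: "?f a = ?g a" if "a \<in> {..<n} - {i}" for a
        using that k X by (simp add: row, simp add: zero_row_def)
      have "(\<Sum>a<n. ?f a) = (\<Sum>a\<in>{..<n} - {i}. ?g a)"
        using sum.remove[of "{..<n}" i ?f] i fi sum.cong[of "{..<n} - {i}" "{..<n} - {i}" ?f ?g, OF refl fa] by simp
      moreover have "(\<Sum>a<n. ?g a) = ?g i + (\<Sum>a\<in>{..<n} - {i}. ?g a)"
        using i by (intro sum.remove) auto
      ultimately have "(\<Sum>a<n. ?g a) = (\<Sum>a<n. ?f a) + ?g i" by simp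
      then show "(gram X *\<^sub>v v) $ k = (gram (zero_row i X) *\<^sub>v v + (scalar_prod (x i) v / real n) \<cdot>\<^sub>v x i) $ k"
        using k i X gram_mult_vec_index[OF X v k] gram_mult_vec_index[OF Z v k]
        by (simp add: add_divide_distrib del: index_mult_mat_vec)
    qed (simp add: carrier_matD[OF gram_carrier[OF X]] carrier_matD[OF X])
  qed simp_all
qed

lemma tr_P: "tr P = real p"
  using W orth by (subst tr_comm[of _ d p]) (auto simp: tr_one)

text \<open>\<open>A x_i / n\<close> is column \<open>i\<close> of \<open>A X^T / n\<close>, so this
  is the squared Frobenius norm of that matrix.\<close>

definition T :: real where
  "T = (\<Sum>i<n. scalar_prod (A *\<^sub>v x i) (A *\<^sub>v x i)) / (real n)\<^sup>2"

lemma T_nonneg: "0 \<le> T"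
  unfolding T_def by (intro divide_nonneg_nonneg sum_nonneg scalar_prod_self_nonneg) auto

text \<open>Each summand is at most \<open>n / l\<close> by \<open>sq_A_x_le\<close>, whatever the
  size of the row.\<close>

lemma T_le: "T \<le> 1 / l"
proof -
  have "(\<Sum>i<n. scalar_prod (A *\<^sub>v x i) (A *\<^sub>v x i)) \<le> (\<Sum>i<n. real n / l)"
  proof (rule sum_mono)
    fix i assume "i \<in> {..<n}"
    then interpret U: resolvent_update d l P "gram X" A "gram (zero_row i X)" "A' i" "x i" "real n"
      by (intro update) simp
    show "scalar_prod (A *\<^sub>v x i) (A *\<^sub>v x i) \<le> real n / l" by (rule U.sq_A_x_le)
  qed
  then show ?thesis using n l unfolding T_def by (simp add: power2_eq_square field_simps)
qed

lemma tr_A_S: "tr (A * gram X) = real p - l * tr A"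
  unfolding R.tr_A_S tr_P ..

text \<open>The equation holds exactly when \<open>r / (1 + r)\<close> is replaced by the mean of
  \<open>q_i / (1 + q_i)\<close>. Passing from \<open>q_i\<close> to \<open>r\<close> costs the
  deviation of one quadratic form from the trace of \<open>A'_i\<close>, and
  \<open>1 / (l n)\<close> for the change of trace when row \<open>i\<close> returns.\<close>

lemma fixed_point:
  fixes r defines "r \<equiv> tr A / real n"
  shows "\<bar>l * r + r / (1 + r) - real p / real n\<bar> \<le>
    (\<Sum>i<n. \<bar>scalar_prod (x i) (A' i *\<^sub>v x i) - tr (A' i)\<bar> / real n) / real n + 1 / (l * real n)"
proof -
  define q where "q i = scalar_prod (x i) (A' i *\<^sub>v x i) / real n" for i
  have r0: "0 \<le> r" unfolding r_def using R.tr_A_nonneg by simp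
  have q: "0 \<le> q i" "scalar_prod (x i) (A *\<^sub>v x i) = real n * (q i / (1 + q i))"
    "\<bar>tr (A' i) - tr A\<bar> \<le> 1 / l" if "i < n" for i
  proof -
    interpret U: resolvent_update d l P "gram X" A "gram (zero_row i X)" "A' i" "x i" "real n"
      using that by (rule update)
    have qe: "q i = U.q" by (simp add: q_def U.q_def)
    show "0 \<le> q i" "scalar_prod (x i) (A *\<^sub>v x i) = real n * (q i / (1 + q i))"
      "\<bar>tr (A' i) - tr A\<bar> \<le> 1 / l"
      unfolding qe by (rule U.q_nonneg U.quad_A_x U.tr_diff)+
  qed
  \<comment> \<open>The trace of \<open>A S\<close> is computed twice, by \<open>tr_A_S\<close> and
    as an average over the rows.\<close>
  have "real p - l * tr A = (\<Sum>i<n. q i / (1 + q i))"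
    using tr_mult_gram[OF X, of A] n by (simp add: tr_A_S q sum_divide_distrib)
  then have "real p / real n = l * r + (\<Sum>i<n. q i / (1 + q i)) / real n"
    using n by (simp add: r_def field_simps)
  moreover have "r / (1 + r) = (\<Sum>i<n. r / (1 + r)) / real n" using n by simp
  ultimately have "l * r + r / (1 + r) - real p / real n =
      (\<Sum>i<n. r / (1 + r) - q i / (1 + q i)) / real n"
    by (simp add: sum_subtractf diff_divide_distrib)
  then have "\<bar>l * r + r / (1 + r) - real p / real n\<bar> = \<bar>\<Sum>i<n. r / (1 + r) - q i / (1 + q i)\<bar> / real n"
    by simp
  also have "\<dots> \<le> (\<Sum>i<n. \<bar>r / (1 + r) - q i / (1 + q i)\<bar>) / real n"
    by (intro divide_right_mono sum_abs) simp
  also have "\<dots> \<le> (\<Sum>i<n. \<bar>scalar_prod (x i) (A' i *\<^sub>v x i) - tr (A' i)\<bar> / real n + 1 / (l * real n)) / real n"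
  proof (intro divide_right_mono sum_mono)
    fix i assume "i \<in> {..<n}"
    then have i: "i < n" by simp
    \<comment> \<open>The map sending \<open>t\<close> to \<open>t / (1 + t)\<close> is 1-Lipschitz
      on the nonnegative reals.\<close>
    have "r / (1 + r) - q i / (1 + q i) = (r - q i) / ((1 + r) * (1 + q i))"
      using r0 q(1)[OF i] by (simp add: field_simps)
    also have "\<bar>\<dots>\<bar> \<le> \<bar>r - q i\<bar> / 1"
    proof -
      have "1 * 1 \<le> (1 + r) * (1 + q i)" using r0 q(1)[OF i] by (intro mult_mono) auto
      then show ?thesis unfolding abs_divide by (intro divide_left_mono) auto
    qed
    finally have 1: "\<bar>r / (1 + r) - q i / (1 + q i)\<bar> \<le> \<bar>r - q i\<bar>" by simp
    have 2: "\<bar>q i - tr (A' i) / real n\<bar> = \<bar>scalar_prod (x i) (A' i *\<^sub>v x i) - tr (A' i)\<bar> / real n"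
      by (simp add: q_def diff_divide_distrib[symmetric])
    have "\<bar>tr (A' i) / real n - r\<bar> = \<bar>tr (A' i) - tr A\<bar> / real n"
      by (simp add: r_def diff_divide_distrib[symmetric])
    also have "\<dots> \<le> 1 / l / real n" using q(3)[OF i] by (rule divide_right_mono) simp
    finally have 3: "\<bar>tr (A' i) / real n - r\<bar> \<le> 1 / (l * real n)" by simp
    show "\<bar>r / (1 + r) - q i / (1 + q i)\<bar> \<le>
        \<bar>scalar_prod (x i) (A' i *\<^sub>v x i) - tr (A' i)\<bar> / real n + 1 / (l * real n)"
      using 1 2 3 by linarith
  qed simp
  also have "\<dots> = (\<Sum>i<n. \<bar>scalar_prod (x i) (A' i *\<^sub>v x i) - tr (A' i)\<bar> / real n) / real n + 1 / (l * real n)"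
    using n by (simp add: sum.distrib add_divide_distrib)
  finally show ?thesis .
qed

abbreviation "C1' i \<equiv> resolvent.C1 d P (gram (zero_row i X)) (A' i)"
abbreviation "C2' i \<equiv> resolvent.C2 d P (gram (zero_row i X)) (A' i)"

text \<open>The trace of \<open>A A S\<close> is \<open>n T\<close>, so only the trace of
  \<open>C2 S\<close> has to be estimated. Row by row, \<open>quad_C2\<close> replaces its quadratic
  form by \<open>|A x_i|^2 / n\<close> times \<open>x_i . Q x_i\<close>, and the last factor is
  replaced by its mean \<open>d - p\<close>; the weight \<open>|A x_i|^2 / n\<close> is at most
  \<open>1/l\<close>, and the weights average to \<open>T\<close>.\<close>

lemma frob_sq_A_S:
  "\<bar>frob_sq (A * gram X) - (tr (A * gram X) - l * real n * T + (real d - real p) * T)\<bar>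
    \<le> (\<Sum>i<n. \<bar>scalar_prod (x i) (R.Q *\<^sub>v x i) - (real d - real p)\<bar> / l
        + (\<bar>scalar_prod (x i) (C2' i *\<^sub>v x i)\<bar> + \<bar>scalar_prod (x i) (C1' i *\<^sub>v x i)\<bar> / l)) / real n"
proof -
  let ?s = "\<lambda>i. scalar_prod (A *\<^sub>v x i) (A *\<^sub>v x i)"
  let ?Q = "\<lambda>i. scalar_prod (x i) (R.Q *\<^sub>v x i)"
  have nT: "tr (A * A * gram X) = real n * T"
  proof -
    have "scalar_prod (x i) ((A * A) *\<^sub>v x i) = ?s i" for i
      using scalar_prod_mat_symm[OF R.A R.A_sym, of "x i" "A *\<^sub>v x i"]
      by (simp add: assoc_mult_mat_vec[of _ d d _ d])
    then show ?thesis using tr_mult_gram[OF X, of "A * A"] n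
      by (simp add: T_def power2_eq_square)
  qed
  have "frob_sq (A * gram X) - (tr (A * gram X) - l * real n * T + (real d - real p) * T)
      = tr (R.C2 * gram X) - (real d - real p) * T"
    unfolding R.frob_sq_A_S nT by simp
  also have "\<dots> = (\<Sum>i<n. scalar_prod (x i) (R.C2 *\<^sub>v x i) - (real d - real p) * (?s i / real n)) / real n"
    using tr_mult_gram[OF X, of R.C2] n
    by (simp add: T_def power2_eq_square sum_subtractf diff_divide_distrib sum_distrib_left sum_divide_distrib)
  finally have eq: "frob_sq (A * gram X) - (tr (A * gram X) - l * real n * T + (real d - real p) * T)
      = (\<Sum>i<n. scalar_prod (x i) (R.C2 *\<^sub>v x i) - (real d - real p) * (?s i / real n)) / real n" .
  have "\<bar>(\<Sum>i<n. scalar_prod (x i) (R.C2 *\<^sub>v x i) - (real d - real p) * (?s i / real n)) / real n\<bar>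
      \<le> (\<Sum>i<n. \<bar>scalar_prod (x i) (R.C2 *\<^sub>v x i) - (real d - real p) * (?s i / real n)\<bar>) / real n"
    by (simp add: divide_right_mono)
  also have "\<dots> \<le> (\<Sum>i<n. \<bar>?Q i - (real d - real p)\<bar> / l
        + (\<bar>scalar_prod (x i) (C2' i *\<^sub>v x i)\<bar> + \<bar>scalar_prod (x i) (C1' i *\<^sub>v x i)\<bar> / l)) / real n"
  proof (intro divide_right_mono sum_mono)
    fix i assume "i \<in> {..<n}"
    then interpret U: resolvent_update d l P "gram X" A "gram (zero_row i X)" "A' i" "x i" "real n"
      by (intro update) simp
    have "scalar_prod (x i) (R.C2 *\<^sub>v x i) - (real d - real p) * (?s i / real n)
        = (scalar_prod (x i) (R.C2 *\<^sub>v x i) - ?s i / real n * ?Q i)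
          + ?s i / real n * (?Q i - (real d - real p))"
      by (simp only: right_diff_distrib left_diff_distrib) (simp only: mult.commute)
    then have 1: "\<bar>scalar_prod (x i) (R.C2 *\<^sub>v x i) - (real d - real p) * (?s i / real n)\<bar>
        \<le> \<bar>scalar_prod (x i) (R.C2 *\<^sub>v x i) - ?s i / real n * ?Q i\<bar>
          + \<bar>?s i / real n * (?Q i - (real d - real p))\<bar>" by (simp only: abs_triangle_ineq)
    have 2: "\<bar>?s i / real n * (?Q i - (real d - real p))\<bar> \<le> 1 / l * \<bar>?Q i - (real d - real p)\<bar>"
      unfolding abs_mult using U.sq_A_x_le n l scalar_prod_self_nonneg[of "A *\<^sub>v x i"]
      by (intro mult_right_mono) (auto simp: field_simps)
    have 3: "\<bar>scalar_prod (x i) (R.C2 *\<^sub>v x i) - ?s i / real n * ?Q i\<bar> \<le>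
        \<bar>scalar_prod (x i) (C2' i *\<^sub>v x i)\<bar> + \<bar>scalar_prod (x i) (C1' i *\<^sub>v x i)\<bar> / l"
      by (rule U.quad_C2)
    show "\<bar>scalar_prod (x i) (R.C2 *\<^sub>v x i) - (real d - real p) * (?s i / real n)\<bar> \<le>
        \<bar>?Q i - (real d - real p)\<bar> / l
        + (\<bar>scalar_prod (x i) (C2' i *\<^sub>v x i)\<bar> + \<bar>scalar_prod (x i) (C1' i *\<^sub>v x i)\<bar> / l)"
      using 1 2 3 by simp
  qed simp
  finally show ?thesis unfolding eq .
qed

text \<open>\<open>A x_i\<close> is \<open>A'_i x_i\<close> divided by \<open>1 + q \<ge> 1\<close>,
  so under absolute values \<open>A\<close> may be traded for \<open>A'_i\<close>. Both factors are
  then linear in \<open>x_i\<close> with coefficients free of \<open>x_i\<close>, and their second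
  moments are explicit.\<close>

lemma quad_A_S_le:
  assumes u: "u \<in> carrier_vec d"
  shows "\<bar>scalar_prod u ((A * gram X) *\<^sub>v u)\<bar> \<le>
    (\<Sum>i<n. \<bar>scalar_prod (A' i *\<^sub>v u) (x i)\<bar> * \<bar>scalar_prod (x i) u\<bar>) / real n"
proof -
  have "scalar_prod u ((A * gram X) *\<^sub>v u) = scalar_prod (A *\<^sub>v u) (gram X *\<^sub>v u)"
    using u scalar_prod_mat_symm[OF R.A R.A_sym u, of "gram X *\<^sub>v u"]
    by (simp add: assoc_mult_mat_vec[of _ d d _ d])
  also have "\<dots> = (\<Sum>i<n. scalar_prod (x i) (A *\<^sub>v u) * scalar_prod (x i) u) / real n"
    using u by (intro scalar_prod_gram[OF X]) auto
  finally have "\<bar>scalar_prod u ((A * gram X) *\<^sub>v u)\<bar> = \<bar>\<Sum>i<n. scalar_prod (x i) (A *\<^sub>v u) * scalar_prod (x i) u\<bar> / real n"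
    by simp
  also have "\<dots> \<le> (\<Sum>i<n. \<bar>scalar_prod (x i) (A *\<^sub>v u)\<bar> * \<bar>scalar_prod (x i) u\<bar>) / real n"
    unfolding abs_mult[symmetric] by (intro divide_right_mono sum_abs) simp
  also have "\<dots> \<le> (\<Sum>i<n. \<bar>scalar_prod (A' i *\<^sub>v u) (x i)\<bar> * \<bar>scalar_prod (x i) u\<bar>) / real n"
  proof (intro divide_right_mono sum_mono mult_right_mono)
    fix i assume "i \<in> {..<n}"
    then interpret U: resolvent_update d l P "gram X" A "gram (zero_row i X)" "A' i" "x i" "real n"
      by (intro update) simp
    have "scalar_prod (x i) (A *\<^sub>v u) = scalar_prod (A *\<^sub>v x i) u"
      using u by (simp add: scalar_prod_mat_symm[OF R.A R.A_sym])
    also have "\<dots> = 1 / (1 + U.q) * scalar_prod (A' i *\<^sub>v x i) u"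
      unfolding U.A_x using u by (intro smult_scalar_prod_distrib[of _ d]) auto
    also have "scalar_prod (A' i *\<^sub>v x i) u = scalar_prod (A' i *\<^sub>v u) (x i)"
      using u scalar_prod_mat_symm[OF U.R'.A U.R'.A_sym u, of "x i"]
      by (simp add: comm_scalar_prod[of "A' i *\<^sub>v x i" d u])
    finally show "\<bar>scalar_prod (x i) (A *\<^sub>v u)\<bar> \<le> \<bar>scalar_prod (A' i *\<^sub>v u) (x i)\<bar>"
      using U.q_nonneg mult_right_mono[of "1 / (1 + U.q)" 1 "\<bar>scalar_prod (A' i *\<^sub>v u) (x i)\<bar>"]
      by (simp add: abs_mult)
  qed auto
  finally show ?thesis .
qed

end

section \<open>Moments of a row of independent entries\<close>

locale unit_entries = prob_space \<mu> for \<mu> :: "real measure" +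
  assumes sets_mu [measurable_cong, simp]: "sets \<mu> = sets borel"
    and mean0: "expectation (\<lambda>t. t) = 0"
    and second1: "expectation (\<lambda>t. t\<^sup>2) = 1"
    and fourth: "integrable \<mu> (\<lambda>t. t ^ 4)"
begin

lemma integrable_pow:
  assumes "k \<le> 4"
  shows "integrable \<mu> (\<lambda>t. t ^ k)"
proof (rule Bochner_Integration.integrable_bound)
  show "integrable \<mu> (\<lambda>t. 1 + t ^ 4)" using fourth by simp
  show "AE t in \<mu>. norm (t ^ k) \<le> norm (1 + t ^ 4)"
  proof (rule AE_I2)
    fix t :: real
    have "\<bar>t\<bar> ^ k \<le> 1 + \<bar>t\<bar> ^ 4"
    proof (cases "\<bar>t\<bar> \<le> 1")
      case True
      then have "\<bar>t\<bar> ^ k \<le> 1" by (simp add: power_le_one)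
      then show ?thesis by (smt (verit) zero_le_power abs_ge_zero)
    next
      case False
      then have "\<bar>t\<bar> ^ k \<le> \<bar>t\<bar> ^ 4" using assms by (intro power_increasing) auto
      then show ?thesis by simp
    qed
    then show "norm (t ^ k) \<le> norm (1 + t ^ 4)" by (simp add: power_abs)
  qed
qed simp

definition m3 :: real where "m3 = expectation (\<lambda>t. t ^ 3)"
definition m4 :: real where "m4 = expectation (\<lambda>t. t ^ 4)"
text \<open>\<open>m4\<close> comes from the squares of the entries, \<open>m3\<close> squared from
  the correlation of an entry with its square, and 4 absorbs the cross terms of a coefficient matrix
  that need not be symmetric.\<close>

definition \<kappa> :: real where "\<kappa> = m4 + m3\<^sup>2 + 4"

lemma m4_nonneg: "0 \<le> m4" unfolding m4_def by (rule Bochner_Integration.integral_nonneg) simp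

lemma \<kappa>_pos: "0 < \<kappa>" unfolding \<kappa>_def using m4_nonneg by (simp add: add_nonneg_pos)

lemma pow_simps:
  "integrable \<mu> (\<lambda>t. t)" "integrable \<mu> (\<lambda>t. t\<^sup>2)" "integrable \<mu> (\<lambda>t. t ^ 3)"
  using integrable_pow[of 1] integrable_pow[of 2] integrable_pow[of 3] by simp_all

lemma nn_integral_affine_sq:
  "(\<integral>\<^sup>+ y. ennreal ((s + a * y)\<^sup>2) \<partial>\<mu>) = ennreal (s\<^sup>2 + a\<^sup>2)"
proof -
  have eq: "(\<lambda>y. (s + a * y)\<^sup>2) = (\<lambda>y. s\<^sup>2 + 2 * s * a * y + a\<^sup>2 * y\<^sup>2)"
    by (rule ext) (simp add: power2_eq_square algebra_simps)
  have "(\<integral>\<^sup>+ y. ennreal ((s + a * y)\<^sup>2) \<partial>\<mu>) = ennreal (\<integral> y. (s + a * y)\<^sup>2 \<partial>\<mu>)"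
    by (rule nn_integral_eq_integral) (auto simp: eq pow_simps)
  also have "(\<integral> y. (s + a * y)\<^sup>2 \<partial>\<mu>) = s\<^sup>2 + a\<^sup>2"
    unfolding eq by (simp add: pow_simps mean0 second1 prob_space)
  finally show ?thesis .
qed

text \<open>The induction step for quadratic forms: \<open>u\<close> is the centred form in the
  earlier coordinates, \<open>c\<close> the new diagonal coefficient, \<open>L\<close> the
  interaction of the new coordinate with the earlier ones.\<close>

lemma nn_integral_quad_sq_le:
  "(\<integral>\<^sup>+ y. ennreal ((u + c * (y\<^sup>2 - 1) + L * y)\<^sup>2) \<partial>\<mu>) \<le> ennreal (u\<^sup>2 + c\<^sup>2 * \<kappa> + 2 * L\<^sup>2)"
proof -
  have eq: "(\<lambda>y. (u + c * (y\<^sup>2 - 1) + L * y)\<^sup>2) = (\<lambda>y. c\<^sup>2 * y ^ 4 + 2 * c * L * y ^ 3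
      + (2 * u * c - 2 * c\<^sup>2 + L\<^sup>2) * y\<^sup>2 + (2 * u * L - 2 * c * L) * y + (u - c)\<^sup>2)"
    by (rule ext) (simp add: power2_eq_square power3_eq_cube power4_eq_xxxx algebra_simps)
  have "(\<integral>\<^sup>+ y. ennreal ((u + c * (y\<^sup>2 - 1) + L * y)\<^sup>2) \<partial>\<mu>)
      = ennreal (\<integral> y. (u + c * (y\<^sup>2 - 1) + L * y)\<^sup>2 \<partial>\<mu>)"
  proof (rule nn_integral_eq_integral)
    show "integrable \<mu> (\<lambda>y. (u + c * (y\<^sup>2 - 1) + L * y)\<^sup>2)"
      unfolding eq by (simp add: pow_simps fourth)
  qed simp
  also have "(\<integral> y. (u + c * (y\<^sup>2 - 1) + L * y)\<^sup>2 \<partial>\<mu>) =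
      c\<^sup>2 * m4 + 2 * c * L * m3 + (2 * u * c - 2 * c\<^sup>2 + L\<^sup>2) + (u - c)\<^sup>2"
    unfolding eq by (simp add: pow_simps fourth mean0 second1 prob_space m3_def m4_def)
  also have "\<dots> \<le> u\<^sup>2 + c\<^sup>2 * \<kappa> + 2 * L\<^sup>2"
  proof -
    \<comment> \<open>A skewed law correlates the square with the linear term; this absorbs the
      correlation and accounts for the factor 2 in front of \<open>L\<close> squared.\<close>
    have "0 \<le> (c * m3 - L)\<^sup>2" by simp
    then have "2 * c * L * m3 \<le> c\<^sup>2 * m3\<^sup>2 + L\<^sup>2"
      by (simp add: power2_eq_square algebra_simps)
    moreover have "0 \<le> c * c" by simp
    ultimately show ?thesis unfolding \<kappa>_def by (simp add: power2_eq_square algebra_simps del: zero_le_square)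
  qed
  finally show ?thesis by (simp add: ennreal_leI)
qed

sublocale product_sigma_finite "\<lambda>_. \<mu>"
  by unfold_locales

lemma nn_integral_linear_sq:
  fixes a :: "'i \<Rightarrow> real"
  assumes "finite K"
  shows "(\<integral>\<^sup>+ x. ennreal ((s + (\<Sum>k\<in>K. a k * x k))\<^sup>2) \<partial>PiM K (\<lambda>_. \<mu>)) = ennreal (s\<^sup>2 + (\<Sum>k\<in>K. (a k)\<^sup>2))"
  using assms
proof (induction K arbitrary: s)
  case empty
  show ?case by (subst nn_integral_empty) auto
next
  case (insert j K)
  have eq: "(\<Sum>k\<in>K. a k * (x(j := y)) k) = (\<Sum>k\<in>K. a k * x k)" for x y
    using insert by (intro sum.cong) auto
  have "(\<integral>\<^sup>+ x. ennreal ((s + (\<Sum>k\<in>insert j K. a k * x k))\<^sup>2) \<partial>PiM (insert j K) (\<lambda>_. \<mu>))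
      = (\<integral>\<^sup>+ x. \<integral>\<^sup>+ y. ennreal ((s + (\<Sum>k\<in>insert j K. a k * (x(j := y)) k))\<^sup>2) \<partial>\<mu> \<partial>PiM K (\<lambda>_. \<mu>))"
    using insert by (intro product_nn_integral_insert) auto
  also have "\<dots> = (\<integral>\<^sup>+ x. \<integral>\<^sup>+ y. ennreal ((s + (\<Sum>k\<in>K. a k * x k) + a j * y)\<^sup>2) \<partial>\<mu> \<partial>PiM K (\<lambda>_. \<mu>))"
    using insert by (simp add: eq add_ac del: fun_upd_apply) (simp add: add_ac)
  also have "\<dots> = (\<integral>\<^sup>+ x. ennreal ((s + (\<Sum>k\<in>K. a k * x k))\<^sup>2) + ennreal ((a j)\<^sup>2) \<partial>PiM K (\<lambda>_. \<mu>))"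
    by (simp add: nn_integral_affine_sq)
  also have "\<dots> = ennreal (s\<^sup>2 + (\<Sum>k\<in>K. (a k)\<^sup>2)) + ennreal ((a j)\<^sup>2)"
  proof -
    interpret P: prob_space "PiM K (\<lambda>_. \<mu>)" by (rule prob_space_PiM) (rule prob_space_axioms)
    show ?thesis by (subst nn_integral_add) (auto simp: insert.IH P.emeasure_space_1)
  qed
  also have "\<dots> = ennreal (s\<^sup>2 + (\<Sum>k\<in>insert j K. (a k)\<^sup>2))"
    using insert by (simp add: ennreal_plus[symmetric] sum_nonneg add_ac del: ennreal_plus)
  finally show ?case .
qed

text \<open>A variance bound by the squared Frobenius norm. Coordinates are added one at a time: the
  new one turns the centred form into \<open>u + c (y^2 - 1) + L y\<close>, the induction hypothesis
  treats \<open>u\<close>, and \<open>L\<close> is a linear form in the old coordinates. Nonnegative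
  integrals keep integrability out of the induction.\<close>

lemma nn_integral_quad_form_le:
  fixes C :: "'i \<Rightarrow> 'i \<Rightarrow> real"
  assumes "finite K"
  shows "(\<integral>\<^sup>+ x. ennreal (((\<Sum>j\<in>K. \<Sum>k\<in>K. C j k * x j * x k) - (\<Sum>j\<in>K. C j j))\<^sup>2) \<partial>PiM K (\<lambda>_. \<mu>))
    \<le> ennreal (\<kappa> * (\<Sum>j\<in>K. \<Sum>k\<in>K. (C j k)\<^sup>2))"
  using assms
proof (induction K)
  case empty
  show ?case by (simp add: nn_integral_empty)
next
  case (insert i K)
  interpret P: prob_space "PiM K (\<lambda>_. \<mu>)" by (rule prob_space_PiM) (rule prob_space_axioms)
  let ?u = "\<lambda>x. (\<Sum>j\<in>K. \<Sum>k\<in>K. C j k * x j * x k) - (\<Sum>j\<in>K. C j j)"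
  let ?L = "\<lambda>x. \<Sum>k\<in>K. (C i k + C k i) * x k"
  let ?F = "\<lambda>K. \<Sum>j\<in>K. \<Sum>k\<in>K. (C j k)\<^sup>2"
  have two: "2 * ennreal z = ennreal (2 * z)" if "0 \<le> z" for z
    using that by (simp add: ennreal_mult)
  have split: "(\<Sum>j\<in>insert i K. \<Sum>k\<in>insert i K. f j k) =
      (\<Sum>j\<in>K. \<Sum>k\<in>K. f j k) + f i i + (\<Sum>k\<in>K. f i k + f k i)" for f :: "'i \<Rightarrow> 'i \<Rightarrow> real"
    using insert by (simp add: sum.distrib)
  have eq: "(\<Sum>j\<in>insert i K. \<Sum>k\<in>insert i K. C j k * (x(i := y)) j * (x(i := y)) k) - (\<Sum>j\<in>insert i K. C j j)
      = ?u x + C i i * (y\<^sup>2 - 1) + ?L x * y" for x y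
  proof -
    have 1: "(\<Sum>j\<in>K. \<Sum>k\<in>K. C j k * (x(i := y)) j * (x(i := y)) k) = (\<Sum>j\<in>K. \<Sum>k\<in>K. C j k * x j * x k)"
      using insert by (intro sum.cong) auto
    have 2: "(\<Sum>k\<in>K. C i k * (x(i := y)) i * (x(i := y)) k + C k i * (x(i := y)) k * (x(i := y)) i) = ?L x * y"
      unfolding sum_distrib_right using insert by (intro sum.cong) (auto simp: algebra_simps)
    show ?thesis unfolding split 1 2 using insert by (simp add: power2_eq_square algebra_simps)
  qed
  have "(\<integral>\<^sup>+ x. ennreal (((\<Sum>j\<in>insert i K. \<Sum>k\<in>insert i K. C j k * x j * x k) - (\<Sum>j\<in>insert i K. C j j))\<^sup>2)
        \<partial>PiM (insert i K) (\<lambda>_. \<mu>))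
      = (\<integral>\<^sup>+ x. \<integral>\<^sup>+ y. ennreal ((?u x + C i i * (y\<^sup>2 - 1) + ?L x * y)\<^sup>2) \<partial>\<mu> \<partial>PiM K (\<lambda>_. \<mu>))"
    unfolding eq[symmetric] using insert by (intro product_nn_integral_insert) auto
  also have "\<dots> \<le> (\<integral>\<^sup>+ x. ennreal ((?u x)\<^sup>2 + (C i i)\<^sup>2 * \<kappa> + 2 * (?L x)\<^sup>2) \<partial>PiM K (\<lambda>_. \<mu>))"
    by (intro nn_integral_mono nn_integral_quad_sq_le)
  also have "\<dots> = (\<integral>\<^sup>+ x. ennreal ((?u x)\<^sup>2) + (ennreal ((C i i)\<^sup>2 * \<kappa>) + 2 * ennreal ((?L x)\<^sup>2)) \<partial>PiM K (\<lambda>_. \<mu>))"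
    unfolding two[OF zero_le_power2] using \<kappa>_pos
    by (intro nn_integral_cong) (simp add: ennreal_plus[symmetric] add_ac del: ennreal_plus)
  also have "\<dots> = (\<integral>\<^sup>+ x. ennreal ((?u x)\<^sup>2) \<partial>PiM K (\<lambda>_. \<mu>)) + (ennreal ((C i i)\<^sup>2 * \<kappa>) +
      2 * (\<integral>\<^sup>+ x. ennreal ((?L x)\<^sup>2) \<partial>PiM K (\<lambda>_. \<mu>)))"
    by (simp add: nn_integral_add nn_integral_cmult P.emeasure_space_1)
  also have "\<dots> \<le> ennreal (\<kappa> * ?F K) + (ennreal ((C i i)\<^sup>2 * \<kappa>) + 2 * ennreal (\<Sum>k\<in>K. (C i k + C k i)\<^sup>2))"
    using insert.IH nn_integral_linear_sq[OF \<open>finite K\<close>, of 0 "\<lambda>k. C i k + C k i"]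
    by (intro add_mono mult_left_mono) auto
  also have "\<dots> = ennreal (\<kappa> * ?F K + (C i i)\<^sup>2 * \<kappa> + 2 * (\<Sum>k\<in>K. (C i k + C k i)\<^sup>2))"
    unfolding two[OF sum_nonneg[OF zero_le_power2]] using \<kappa>_pos
    by (simp add: ennreal_plus[symmetric] sum_nonneg add_ac del: ennreal_plus)
  also have "\<dots> \<le> ennreal (\<kappa> * ?F (insert i K))"
  proof (rule ennreal_leI)
    have "2 * (\<Sum>k\<in>K. (C i k + C k i)\<^sup>2) \<le> \<kappa> * (\<Sum>k\<in>K. (C i k)\<^sup>2 + (C k i)\<^sup>2)"
      unfolding sum_distrib_left
    proof (rule sum_mono)
      fix k
      have "0 \<le> (C i k - C k i)\<^sup>2" by simp
      then have "2 * (C i k + C k i)\<^sup>2 \<le> 4 * ((C i k)\<^sup>2 + (C k i)\<^sup>2)"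
        by (simp add: power2_eq_square algebra_simps)
      also have "\<dots> \<le> \<kappa> * ((C i k)\<^sup>2 + (C k i)\<^sup>2)"
        unfolding \<kappa>_def using m4_nonneg by (intro mult_right_mono) auto
      finally show "2 * (C i k + C k i)\<^sup>2 \<le> \<kappa> * ((C i k)\<^sup>2 + (C k i)\<^sup>2)" .
    qed
    then show "\<kappa> * ?F K + (C i i)\<^sup>2 * \<kappa> + 2 * (\<Sum>k\<in>K. (C i k + C k i)\<^sup>2) \<le> \<kappa> * ?F (insert i K)"
      unfolding split by (simp add: algebra_simps)
  qed
  finally show ?case .
qed

end

section \<open>Conditioning on all rows but one\<close>

definition clear_row :: "nat \<Rightarrow> (nat \<times> nat \<Rightarrow> real) \<Rightarrow> nat \<times> nat \<Rightarrow> real" where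
  "clear_row i X = (\<lambda>(a, b). if a = i then 0 else X (a, b))"

lemma mat_clear_row: "Matrix.mat n d (clear_row i X) = zero_row i (Matrix.mat n d X)"
  by (intro eq_matI) (auto simp: clear_row_def zero_row_def)

text \<open>\<open>N\<close> is left abstract as the law of everything independent of
  \<open>X\<close>; the sketch \<open>W\<close> is put there later.\<close>

locale data_law = unit_entries \<mu> + N: prob_space N for \<mu> :: "real measure" and N :: "'b measure" +
  fixes n d :: nat
begin

abbreviation "MX \<equiv> iid_mat \<mu> n d"
abbreviation "\<Omega> \<equiv> MX \<Otimes>\<^sub>M N"

sublocale MX: prob_space MX
  unfolding iid_mat_def by (rule prob_space_PiM) (rule prob_space_axioms)

sublocale MXN: pair_prob_space MX N ..

lemma measurable_entry [measurable]:
  "i < n \<Longrightarrow> j < d \<Longrightarrow> (\<lambda>X. X (i, j)) \<in> borel_measurable MX"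
  unfolding iid_mat_def by (subst measurable_cong_sets[OF refl sets_mu[symmetric]]) (rule measurable_component_singleton, auto)

text \<open>Fubini with row \<open>i\<close> innermost: a comparison that holds conditionally on the
  other rows and on \<open>w\<close> holds on the whole space.\<close>

lemma nn_integral_row_le:
  fixes f g :: "(nat \<times> nat \<Rightarrow> real) \<times> 'b \<Rightarrow> ennreal"
  assumes i: "i < n" and [measurable]: "f \<in> borel_measurable \<Omega>" "g \<in> borel_measurable \<Omega>"
    and le: "\<And>X w. w \<in> space N \<Longrightarrow>
      (\<integral>\<^sup>+ y. f (merge (({..<n} - {i}) \<times> {..<d}) ({i} \<times> {..<d}) (X, y), w) \<partial>PiM ({i} \<times> {..<d}) (\<lambda>_. \<mu>)) \<le>
      (\<integral>\<^sup>+ y. g (merge (({..<n} - {i}) \<times> {..<d}) ({i} \<times> {..<d}) (X, y), w) \<partial>PiM ({i} \<times> {..<d}) (\<lambda>_. \<mu>))"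
  shows "(\<integral>\<^sup>+ \<omega>. f \<omega> \<partial>\<Omega>) \<le> (\<integral>\<^sup>+ \<omega>. g \<omega> \<partial>\<Omega>)"
proof -
  let ?I = "({..<n} - {i}) \<times> {..<d}" and ?J = "{i} \<times> {..<d}"
  have IJ: "?I \<union> ?J = {..<n} \<times> {..<d}" using i by auto
  have fold: "(\<integral>\<^sup>+ \<omega>. h \<omega> \<partial>\<Omega>) = (\<integral>\<^sup>+ w. \<integral>\<^sup>+ X. \<integral>\<^sup>+ y. h (merge ?I ?J (X, y), w)
      \<partial>PiM ?J (\<lambda>_. \<mu>) \<partial>PiM ?I (\<lambda>_. \<mu>) \<partial>N)" if [measurable]: "h \<in> borel_measurable \<Omega>" for h
  proof -
    have "(\<integral>\<^sup>+ \<omega>. h \<omega> \<partial>\<Omega>) = (\<integral>\<^sup>+ w. \<integral>\<^sup>+ X. h (X, w) \<partial>MX \<partial>N)"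
      by (rule MXN.nn_integral_snd[symmetric]) simp
    also have "\<dots> = (\<integral>\<^sup>+ w. \<integral>\<^sup>+ X. \<integral>\<^sup>+ y. h (merge ?I ?J (X, y), w) \<partial>PiM ?J (\<lambda>_. \<mu>) \<partial>PiM ?I (\<lambda>_. \<mu>) \<partial>N)"
    proof (rule nn_integral_cong)
      fix w assume w: "w \<in> space N"
      have "(\<lambda>X. h (X, w)) \<in> borel_measurable (PiM (?I \<union> ?J) (\<lambda>_. \<mu>))"
        unfolding IJ iid_mat_def[symmetric] using w by measurable
      from product_nn_integral_fold[OF _ _ _ this]
      show "(\<integral>\<^sup>+ X. h (X, w) \<partial>MX) = (\<integral>\<^sup>+ X. \<integral>\<^sup>+ y. h (merge ?I ?J (X, y), w) \<partial>PiM ?J (\<lambda>_. \<mu>) \<partial>PiM ?I (\<lambda>_. \<mu>))"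
        unfolding IJ iid_mat_def[symmetric] by auto
    qed
    finally show ?thesis .
  qed
  show ?thesis unfolding fold[OF assms(2)] fold[OF assms(3)]
    by (intro nn_integral_mono le)
qed

text \<open>The cleared matrix does not see the row being integrated, so whatever is built from it
  is a constant in the inner integral.\<close>

lemma clear_row_merge: "clear_row i (merge (({..<n} - {i}) \<times> {..<d}) ({i} \<times> {..<d}) (X, y))
    = clear_row i (merge (({..<n} - {i}) \<times> {..<d}) ({i} \<times> {..<d}) (X, y'))"
  by (rule ext) (auto simp: clear_row_def merge_def)

lemma row_merge: "j < d \<Longrightarrow> merge (({..<n} - {i}) \<times> {..<d}) ({i} \<times> {..<d}) (X, y) (i, j) = y (i, j)"
  by (auto simp: merge_def)

text \<open>The conditional form of \<open>nn_integral_quad_form_le\<close>. Independence of the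
  coefficients from row \<open>i\<close> is encoded by letting them take the cleared matrix as
  argument.\<close>

lemma nn_integral_row_quad_le:
  assumes i: "i < n"
    and [measurable]: "\<And>j k. j < d \<Longrightarrow> k < d \<Longrightarrow> (\<lambda>\<omega>. c (clear_row i (fst \<omega>)) (snd \<omega>) j k) \<in> borel_measurable \<Omega>"
  shows "(\<integral>\<^sup>+ \<omega>. ennreal (((\<Sum>j<d. \<Sum>k<d. c (clear_row i (fst \<omega>)) (snd \<omega>) j k * fst \<omega> (i, j) * fst \<omega> (i, k))
          - (\<Sum>j<d. c (clear_row i (fst \<omega>)) (snd \<omega>) j j))\<^sup>2) \<partial>\<Omega>)
    \<le> (\<integral>\<^sup>+ \<omega>. ennreal (\<kappa> * (\<Sum>j<d. \<Sum>k<d. (c (clear_row i (fst \<omega>)) (snd \<omega>) j k)\<^sup>2)) \<partial>\<Omega>)"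
proof (rule nn_integral_row_le[OF i])
  have [measurable]: "j < d \<Longrightarrow> (\<lambda>\<omega>. fst \<omega> (i, j)) \<in> borel_measurable \<Omega>" for j
    by (rule measurable_compose[OF measurable_fst measurable_entry[OF i]])
  show "(\<lambda>\<omega>. ennreal (((\<Sum>j<d. \<Sum>k<d. c (clear_row i (fst \<omega>)) (snd \<omega>) j k * fst \<omega> (i, j) * fst \<omega> (i, k))
          - (\<Sum>j<d. c (clear_row i (fst \<omega>)) (snd \<omega>) j j))\<^sup>2)) \<in> borel_measurable \<Omega>" by measurable
  show "(\<lambda>\<omega>. ennreal (\<kappa> * (\<Sum>j<d. \<Sum>k<d. (c (clear_row i (fst \<omega>)) (snd \<omega>) j k)\<^sup>2))) \<in> borel_measurable \<Omega>" by measurable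
next
  fix X w
  let ?I = "({..<n} - {i}) \<times> {..<d}" and ?J = "{i} \<times> {..<d}"
  interpret P: prob_space "PiM ?J (\<lambda>_. \<mu>)" by (rule prob_space_PiM) (rule prob_space_axioms)
  \<comment> \<open>The zero row is an arbitrary reference point; by \<open>clear_row_merge\<close>
    every row \<open>y\<close> gives the same coefficients.\<close>
  define C where "C = c (clear_row i (merge ?I ?J (X, \<lambda>_. 0))) w"
  have z: "c (clear_row i (merge ?I ?J (X, y))) w = C" for y
    unfolding C_def by (subst clear_row_merge[of i X y "\<lambda>_. 0"]) simp
  have J: "?J = Pair i ` {..<d}" by auto
  have re: "(\<Sum>a\<in>?J. f a) = (\<Sum>j<d. f (i, j))" for f :: "nat \<times> nat \<Rightarrow> real"
    unfolding J by (subst sum.reindex) (auto simp: inj_on_def)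
  have "(\<integral>\<^sup>+ y. ennreal (((\<Sum>j<d. \<Sum>k<d. C j k * y (i, j) * y (i, k)) - (\<Sum>j<d. C j j))\<^sup>2) \<partial>PiM ?J (\<lambda>_. \<mu>))
      \<le> ennreal (\<kappa> * (\<Sum>j<d. \<Sum>k<d. (C j k)\<^sup>2))"
    using nn_integral_quad_form_le[of ?J "\<lambda>a b. C (snd a) (snd b)"] unfolding re by simp
  then show "(\<integral>\<^sup>+ y. ennreal (((\<Sum>j<d. \<Sum>k<d. c (clear_row i (fst (merge ?I ?J (X, y), w))) (snd (merge ?I ?J (X, y), w)) j k
          * fst (merge ?I ?J (X, y), w) (i, j) * fst (merge ?I ?J (X, y), w) (i, k))
          - (\<Sum>j<d. c (clear_row i (fst (merge ?I ?J (X, y), w))) (snd (merge ?I ?J (X, y), w)) j j))\<^sup>2) \<partial>PiM ?J (\<lambda>_. \<mu>))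
      \<le> (\<integral>\<^sup>+ y. ennreal (\<kappa> * (\<Sum>j<d. \<Sum>k<d. (c (clear_row i (fst (merge ?I ?J (X, y), w))) (snd (merge ?I ?J (X, y), w)) j k)\<^sup>2))
          \<partial>PiM ?J (\<lambda>_. \<mu>))"
    by (simp add: z row_merge P.emeasure_space_1)
qed

lemma nn_integral_row_linear_le:
  assumes i: "i < n"
    and [measurable]: "\<And>j. j < d \<Longrightarrow> (\<lambda>\<omega>. a (clear_row i (fst \<omega>)) (snd \<omega>) j) \<in> borel_measurable \<Omega>"
  shows "(\<integral>\<^sup>+ \<omega>. ennreal ((\<Sum>j<d. a (clear_row i (fst \<omega>)) (snd \<omega>) j * fst \<omega> (i, j))\<^sup>2) \<partial>\<Omega>)
    \<le> (\<integral>\<^sup>+ \<omega>. ennreal (\<Sum>j<d. (a (clear_row i (fst \<omega>)) (snd \<omega>) j)\<^sup>2) \<partial>\<Omega>)"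
proof (rule nn_integral_row_le[OF i])
  have [measurable]: "j < d \<Longrightarrow> (\<lambda>\<omega>. fst \<omega> (i, j)) \<in> borel_measurable \<Omega>" for j
    by (rule measurable_compose[OF measurable_fst measurable_entry[OF i]])
  show "(\<lambda>\<omega>. ennreal ((\<Sum>j<d. a (clear_row i (fst \<omega>)) (snd \<omega>) j * fst \<omega> (i, j))\<^sup>2)) \<in> borel_measurable \<Omega>" by measurable
  show "(\<lambda>\<omega>. ennreal (\<Sum>j<d. (a (clear_row i (fst \<omega>)) (snd \<omega>) j)\<^sup>2)) \<in> borel_measurable \<Omega>" by measurable
next
  fix X w
  let ?I = "({..<n} - {i}) \<times> {..<d}" and ?J = "{i} \<times> {..<d}"
  interpret P: prob_space "PiM ?J (\<lambda>_. \<mu>)" by (rule prob_space_PiM) (rule prob_space_axioms)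
  define C where "C = a (clear_row i (merge ?I ?J (X, \<lambda>_. 0))) w"
  have z: "a (clear_row i (merge ?I ?J (X, y))) w = C" for y
    unfolding C_def by (subst clear_row_merge[of i X y "\<lambda>_. 0"]) simp
  have J: "?J = Pair i ` {..<d}" by auto
  have re: "(\<Sum>a\<in>?J. f a) = (\<Sum>j<d. f (i, j))" for f :: "nat \<times> nat \<Rightarrow> real"
    unfolding J by (subst sum.reindex) (auto simp: inj_on_def)
  have "(\<integral>\<^sup>+ y. ennreal ((\<Sum>j<d. C j * y (i, j))\<^sup>2) \<partial>PiM ?J (\<lambda>_. \<mu>)) = ennreal (\<Sum>j<d. (C j)\<^sup>2)"
    using nn_integral_linear_sq[of ?J 0 "\<lambda>a. C (snd a)"] unfolding re by simp
  then show "(\<integral>\<^sup>+ y. ennreal ((\<Sum>j<d. a (clear_row i (fst (merge ?I ?J (X, y), w))) (snd (merge ?I ?J (X, y), w)) j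
          * fst (merge ?I ?J (X, y), w) (i, j))\<^sup>2) \<partial>PiM ?J (\<lambda>_. \<mu>))
      \<le> (\<integral>\<^sup>+ y. ennreal (\<Sum>j<d. (a (clear_row i (fst (merge ?I ?J (X, y), w))) (snd (merge ?I ?J (X, y), w)) j)\<^sup>2)
          \<partial>PiM ?J (\<lambda>_. \<mu>))"
    by (simp add: z row_merge P.emeasure_space_1)
qed

end

section \<open>Measurability of matrix expressions\<close>

text \<open>The dimensions are demanded at every sample point and not only almost everywhere, so
  that entry formulas apply pointwise.\<close>

definition mat_measurable :: "'a measure \<Rightarrow> nat \<Rightarrow> nat \<Rightarrow> ('a \<Rightarrow> real Matrix.mat) \<Rightarrow> bool" where
  "mat_measurable M n k F \<longleftrightarrow> (\<forall>\<omega>. F \<omega> \<in> carrier_mat n k) \<and>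
     (\<forall>i<n. \<forall>j<k. (\<lambda>\<omega>. F \<omega> $$ (i, j)) \<in> borel_measurable M)"

lemma mat_measurableI:
  assumes "\<And>\<omega>. F \<omega> \<in> carrier_mat n k"
    and "\<And>i j. i < n \<Longrightarrow> j < k \<Longrightarrow> (\<lambda>\<omega>. F \<omega> $$ (i, j)) \<in> borel_measurable M"
  shows "mat_measurable M n k F"
  using assms by (auto simp: mat_measurable_def)

lemma mat_measurable_carrier: "mat_measurable M n k F \<Longrightarrow> F \<omega> \<in> carrier_mat n k"
  by (auto simp: mat_measurable_def)

lemma mat_measurable_entry:
  "mat_measurable M n k F \<Longrightarrow> i < n \<Longrightarrow> j < k \<Longrightarrow> (\<lambda>\<omega>. F \<omega> $$ (i, j)) \<in> borel_measurable M"
  by (auto simp: mat_measurable_def)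

lemma mat_measurable_const: "B \<in> carrier_mat n k \<Longrightarrow> mat_measurable M n k (\<lambda>_. B)"
  by (auto simp: mat_measurable_def)

lemma mat_measurable_mult:
  assumes F: "mat_measurable M n k F" and G: "mat_measurable M k m G"
  shows "mat_measurable M n m (\<lambda>\<omega>. F \<omega> * G \<omega>)"
proof (rule mat_measurableI)
  note [simp] = mat_measurable_carrier[OF F] mat_measurable_carrier[OF G]
  show "F \<omega> * G \<omega> \<in> carrier_mat n m" for \<omega> by (rule mult_carrier_mat[of _ n k]) simp_all
  fix i j assume ij: "i < n" "j < m"
  have "(\<lambda>\<omega>. (F \<omega> * G \<omega>) $$ (i, j)) = (\<lambda>\<omega>. \<Sum>r<k. F \<omega> $$ (i, r) * G \<omega> $$ (r, j))"
    using ij by (intro ext index_mult_mat_sum[of _ n k _ m]) simp_all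
  also have "\<dots> \<in> borel_measurable M"
    using ij by (intro borel_measurable_sum borel_measurable_times mat_measurable_entry[OF F] mat_measurable_entry[OF G]) auto
  finally show "(\<lambda>\<omega>. (F \<omega> * G \<omega>) $$ (i, j)) \<in> borel_measurable M" .
qed

lemma mat_measurable_transpose:
  assumes F: "mat_measurable M n k F"
  shows "mat_measurable M k n (\<lambda>\<omega>. transpose_mat (F \<omega>))"
  using mat_measurable_carrier[OF F] mat_measurable_entry[OF F]
  by (intro mat_measurableI) (auto simp: index_transpose_mat carrier_matD[OF mat_measurable_carrier[OF F]])

lemma mat_measurable_smult:
  assumes F: "mat_measurable M n k F" and c: "c \<in> borel_measurable M"
  shows "mat_measurable M n k (\<lambda>\<omega>. c \<omega> \<cdot>\<^sub>m F \<omega>)"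
  using mat_measurable_carrier[OF F] mat_measurable_entry[OF F] c
  by (intro mat_measurableI) (auto simp: carrier_matD[OF mat_measurable_carrier[OF F]])

lemma mat_measurable_add:
  assumes F: "mat_measurable M n k F" and G: "mat_measurable M n k G"
  shows "mat_measurable M n k (\<lambda>\<omega>. F \<omega> + G \<omega>)"
  using mat_measurable_carrier[OF F] mat_measurable_carrier[OF G] mat_measurable_entry[OF F] mat_measurable_entry[OF G]
  by (intro mat_measurableI) (auto simp: carrier_matD[OF mat_measurable_carrier[OF G]] carrier_matD[OF mat_measurable_carrier[OF F]])

lemma mat_measurable_minus:
  assumes F: "mat_measurable M n k F" and G: "mat_measurable M n k G"
  shows "mat_measurable M n k (\<lambda>\<omega>. F \<omega> - G \<omega>)"
  using mat_measurable_carrier[OF F] mat_measurable_carrier[OF G] mat_measurable_entry[OF F] mat_measurable_entry[OF G]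
  by (intro mat_measurableI)
    (auto simp: carrier_matD[OF mat_measurable_carrier[OF G]] carrier_matD[OF mat_measurable_carrier[OF F]]
      intro: minus_carrier_mat)

text \<open>Leibniz's expansion exhibits the determinant as a polynomial in the entries.\<close>

lemma borel_measurable_det:
  assumes F: "mat_measurable M n n F"
  shows "(\<lambda>\<omega>. Determinant.det (F \<omega>)) \<in> borel_measurable M"
proof -
  have "(\<lambda>\<omega>. Determinant.det (F \<omega>)) =
      (\<lambda>\<omega>. \<Sum>\<pi> | \<pi> permutes {0..<n}. signof \<pi> * (\<Prod>i = 0..<n. F \<omega> $$ (i, \<pi> i)))"
    using mat_measurable_carrier[OF F] by (intro ext det_def') auto
  also have "\<dots> \<in> borel_measurable M"
    by (intro borel_measurable_sum borel_measurable_times borel_measurable_const borel_measurable_prod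
        mat_measurable_entry[OF F]) (auto simp: permutes_in_image dest: permutes_nat_less)
  finally show ?thesis .
qed

lemma mat_measurable_adj:
  assumes F: "mat_measurable M n n F"
  shows "mat_measurable M n n (\<lambda>\<omega>. adj_mat (F \<omega>))"
proof (rule mat_measurableI)
  note c = mat_measurable_carrier[OF F]
  show "adj_mat (F \<omega>) \<in> carrier_mat n n" for \<omega> by (rule adj_mat(1)[OF c])
  fix i j assume ij: "i < n" "j < n"
  have del: "mat_measurable M (n - 1) (n - 1) (\<lambda>\<omega>. mat_delete (F \<omega>) j i)"
  proof (rule mat_measurableI)
    show "mat_delete (F \<omega>) j i \<in> carrier_mat (n - 1) (n - 1)" for \<omega>
      by (rule mat_delete_carrier[OF c])
    fix a b assume ab: "a < n - 1" "b < n - 1"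
    have "(\<lambda>\<omega>. mat_delete (F \<omega>) j i $$ (a, b)) = (\<lambda>\<omega>. F \<omega> $$ (insert_index j a, insert_index i b))"
      using ab ij by (intro ext) (auto simp: mat_delete_def insert_index_def carrier_matD[OF c])
    also have "\<dots> \<in> borel_measurable M"
      using ab ij by (intro mat_measurable_entry[OF F]) (auto simp: insert_index_def)
    finally show "(\<lambda>\<omega>. mat_delete (F \<omega>) j i $$ (a, b)) \<in> borel_measurable M" .
  qed
  have "(\<lambda>\<omega>. adj_mat (F \<omega>) $$ (i, j)) = (\<lambda>\<omega>. (-1) ^ (j + i) * Determinant.det (mat_delete (F \<omega>) j i))"
    using ij by (intro ext) (simp add: adj_mat_def cofactor_def carrier_matD[OF c])
  also have "\<dots> \<in> borel_measurable M"
    by (intro borel_measurable_times borel_measurable_const borel_measurable_det[OF del])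
  finally show "(\<lambda>\<omega>. adj_mat (F \<omega>) $$ (i, j)) \<in> borel_measurable M" .
qed

lemma mat_measurable_gram:
  assumes F: "mat_measurable M n d F"
  shows "mat_measurable M d d (\<lambda>\<omega>. gram (F \<omega>))"
  unfolding gram_def carrier_matD(1)[OF mat_measurable_carrier[OF F]]
  by (intro mat_measurable_smult mat_measurable_mult[of _ d n] mat_measurable_transpose F borel_measurable_const)

text \<open>By \<open>mat_inverse_ridge_adj\<close> the entries of the inverse are cofactors divided
  by the determinant at every sample point, so no null set intervenes.\<close>

lemma mat_measurable_resol:
  assumes W: "mat_measurable M p d W" and X: "mat_measurable M n d X" and "0 < n" "0 < l"
  shows "mat_measurable M d d (\<lambda>\<omega>. resol l (W \<omega>) (X \<omega>))"
proof -
  have r: "ridge d n p l (W \<omega>) (X \<omega>)" for \<omega>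
    using mat_measurable_carrier[OF W] mat_measurable_carrier[OF X] assms by unfold_locales auto
  have B: "mat_measurable M p p (\<lambda>\<omega>. ridge_matrix l (W \<omega>) (X \<omega>))"
    unfolding ridge_matrix_def carrier_matD(1)[OF mat_measurable_carrier[OF X]]
      carrier_matD(1)[OF mat_measurable_carrier[OF W]]
    by (intro mat_measurable_add mat_measurable_smult mat_measurable_mult[of _ p d] mat_measurable_mult[of _ p n]
        mat_measurable_transpose W X borel_measurable_const mat_measurable_const) auto
  have "mat_measurable M p p (\<lambda>\<omega>. the (mat_inverse (ridge_matrix l (W \<omega>) (X \<omega>))))"
    unfolding ridge.mat_inverse_ridge_adj[OF r]
    by (intro mat_measurable_smult mat_measurable_adj borel_measurable_divide borel_measurable_const
        borel_measurable_det[OF B] B)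
  then show ?thesis unfolding resol_def
    by (intro mat_measurable_mult[of _ d p] mat_measurable_mult[of _ p p] mat_measurable_transpose W)
qed

lemma borel_measurable_tr:
  assumes F: "mat_measurable M n n F"
  shows "(\<lambda>\<omega>. tr (F \<omega>)) \<in> borel_measurable M"
  unfolding tr_eq[OF mat_measurable_carrier[OF F]]
  by (intro borel_measurable_sum mat_measurable_entry[OF F]) auto

lemma borel_measurable_frob_sq:
  assumes F: "mat_measurable M n k F"
  shows "(\<lambda>\<omega>. frob_sq (F \<omega>)) \<in> borel_measurable M"
  unfolding frob_sq_eq[OF mat_measurable_carrier[OF F]]
  by (intro borel_measurable_sum borel_measurable_power mat_measurable_entry[OF F]) auto

text \<open>The bound on the mean of \<open>|Z|\<close> is Cauchy-Schwarz, in the form that the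
  variance of \<open>|Z|\<close> is nonnegative.\<close>

lemma (in prob_space) L1_le_of_nn_integral_sq:
  assumes Z [measurable]: "Z \<in> borel_measurable M" and c: "0 \<le> c"
    and le: "(\<integral>\<^sup>+ \<omega>. ennreal ((Z \<omega>)\<^sup>2) \<partial>M) \<le> ennreal c"
  shows "integrable M Z" "integrable M (\<lambda>\<omega>. (Z \<omega>)\<^sup>2)" "expectation (\<lambda>\<omega>. (Z \<omega>)\<^sup>2) \<le> c"
    "expectation (\<lambda>\<omega>. \<bar>Z \<omega>\<bar>) \<le> sqrt c"
proof -
  show sq: "integrable M (\<lambda>\<omega>. (Z \<omega>)\<^sup>2)"
  proof (rule integrableI_bounded)
    show "(\<integral>\<^sup>+ \<omega>. ennreal (norm ((Z \<omega>)\<^sup>2)) \<partial>M) < \<infinity>"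
      using le by (simp add: order_le_less_trans)
  qed simp
  show Zi: "integrable M Z" by (rule square_integrable_imp_integrable[OF Z sq])
  have "ennreal (expectation (\<lambda>\<omega>. (Z \<omega>)\<^sup>2)) \<le> ennreal c"
    using le by (subst nn_integral_eq_integral[symmetric, OF sq]) auto
  then show le': "expectation (\<lambda>\<omega>. (Z \<omega>)\<^sup>2) \<le> c" using c by simp
  have "variance (\<lambda>\<omega>. \<bar>Z \<omega>\<bar>) = expectation (\<lambda>\<omega>. (Z \<omega>)\<^sup>2) - (expectation (\<lambda>\<omega>. \<bar>Z \<omega>\<bar>))\<^sup>2"
    using variance_eq[of "\<lambda>\<omega>. \<bar>Z \<omega>\<bar>"] Zi sq by simp
  then have "(expectation (\<lambda>\<omega>. \<bar>Z \<omega>\<bar>))\<^sup>2 \<le> c"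
    using le' variance_positive[of "\<lambda>\<omega>. \<bar>Z \<omega>\<bar>"] by linarith
  then show "expectation (\<lambda>\<omega>. \<bar>Z \<omega>\<bar>) \<le> sqrt c" by (rule real_le_rsqrt)
qed

text \<open>\<open>X^T X\<close> and \<open>X X^T\<close> have the same Frobenius norm. The second
  matrix consists of inner products of rows, and different rows are independent.\<close>

lemma frob_sq_gram:
  assumes X: "X \<in> carrier_mat n d"
  shows "frob_sq (gram X) = (\<Sum>a<n. \<Sum>b<n. (\<Sum>j<d. X $$ (b, j) * X $$ (a, j))\<^sup>2) / (real n)\<^sup>2"
proof -
  have "frob_sq (gram X) = (\<Sum>j<d. \<Sum>k<d. \<Sum>a<n. \<Sum>b<n.
      X $$ (b, j) * X $$ (a, j) * (X $$ (b, k) * X $$ (a, k))) / (real n)\<^sup>2"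
    using X by (subst frob_sq_eq[of _ d d])
      (auto simp: gram_index power_divide power2_eq_square sum_product sum_divide_distrib mult_ac intro!: sum.cong)
  also have "(\<Sum>j<d. \<Sum>k<d. \<Sum>a<n. \<Sum>b<n. X $$ (b, j) * X $$ (a, j) * (X $$ (b, k) * X $$ (a, k)))
      = (\<Sum>j<d. \<Sum>a<n. \<Sum>b<n. \<Sum>k<d. X $$ (b, j) * X $$ (a, j) * (X $$ (b, k) * X $$ (a, k)))"
    by (rule sum.cong[OF refl], subst sum.swap, rule sum.cong[OF refl], rule sum.swap)
  also have "\<dots> = (\<Sum>a<n. \<Sum>b<n. \<Sum>j<d. \<Sum>k<d. X $$ (b, j) * X $$ (a, j) * (X $$ (b, k) * X $$ (a, k)))"
    by (subst sum.swap, rule sum.cong[OF refl], rule sum.swap)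
  also have "\<dots> = (\<Sum>a<n. \<Sum>b<n. (\<Sum>j<d. X $$ (b, j) * X $$ (a, j))\<^sup>2)"
    by (simp add: power2_eq_square sum_product)
  finally show ?thesis .
qed

text \<open>In terms of inner products of rows, clearing one row merely deletes summands. All
  leave-one-out bounds can thus be stated with the full Gram matrix.\<close>

lemma frob_sq_gram_zero_row_le:
  assumes X: "X \<in> carrier_mat n d"
  shows "frob_sq (gram (zero_row i X)) \<le> frob_sq (gram X)"
  unfolding frob_sq_gram[OF X] frob_sq_gram[OF zero_row_carrier[OF X]]
proof (intro divide_right_mono sum_mono)
  fix a b assume "a \<in> {..<n}" "b \<in> {..<n}"
  then have "(\<Sum>j<d. zero_row i X $$ (b, j) * zero_row i X $$ (a, j)) =
      (if a = i \<or> b = i then 0 else \<Sum>j<d. X $$ (b, j) * X $$ (a, j))"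
    using X by (auto simp: zero_row_def)
  then show "(\<Sum>j<d. zero_row i X $$ (b, j) * zero_row i X $$ (a, j))\<^sup>2 \<le> (\<Sum>j<d. X $$ (b, j) * X $$ (a, j))\<^sup>2"
    by auto
qed simp

section \<open>Second moment of the Gram matrix and fluctuation of quadratic forms in a row\<close>

context data_law
begin

lemma measurable_entry_\<Omega> [measurable]:
  "i < n \<Longrightarrow> j < d \<Longrightarrow> (\<lambda>\<omega>. fst \<omega> (i, j)) \<in> borel_measurable \<Omega>"
  by (rule measurable_compose[OF measurable_fst measurable_entry])

lemma nn_integral_entry:
  assumes ij: "i < n" "j < d" and [measurable]: "f \<in> borel_measurable borel"
  shows "(\<integral>\<^sup>+ \<omega>. f (fst \<omega> (i, j)) \<partial>\<Omega>) = (\<integral>\<^sup>+ t. f t \<partial>\<mu>)"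
proof -
  have "(\<integral>\<^sup>+ \<omega>. f (fst \<omega> (i, j)) \<partial>\<Omega>) = (\<integral>\<^sup>+ X. \<integral>\<^sup>+ w. f (X (i, j)) \<partial>N \<partial>MX)"
    using ij by (subst N.nn_integral_fst[symmetric]) auto
  also have "\<dots> = (\<integral>\<^sup>+ X. f (X (i, j)) \<partial>MX)" by (simp add: N.emeasure_space_1)
  also have "\<dots> = (\<integral>\<^sup>+ t. f t \<partial>distr MX \<mu> (\<lambda>X. X (i, j)))"
    using ij assms(3) by (subst nn_integral_distr)
      (auto simp: iid_mat_def measurable_cong_sets[OF sets_mu refl])
  also have "distr MX \<mu> (\<lambda>X. X (i, j)) = \<mu>"
    unfolding iid_mat_def using ij by (intro distr_PiM_component prob_space_axioms) auto
  finally show ?thesis .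
qed

text \<open>Among the n^2 inner products of rows, each is allotted second moment \<open>d\<close>
  and the n diagonal ones \<open>d^2 m4\<close> in addition; dividing by n^2 gives this value, of
  order d when d/n is bounded.\<close>

definition gram_bound :: real where "gram_bound = real d + (real d)\<^sup>2 * m4 / real n"

lemma gram_bound_nonneg: "0 \<le> gram_bound"
  unfolding gram_bound_def using m4_nonneg by simp

lemma nn_integral_frob_sq_gram_le:
  assumes n: "0 < n"
  shows "(\<integral>\<^sup>+ \<omega>. ennreal (frob_sq (gram (Matrix.mat n d (fst \<omega>)))) \<partial>\<Omega>) \<le> ennreal gram_bound"
proof -
  let ?t = "\<lambda>a b \<omega>. (\<Sum>j<d. fst \<omega> (b, j) * fst \<omega> (a, j))\<^sup>2 :: real"
  \<comment> \<open>Given row \<open>b\<close>, the inner product is a linear form in row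
    \<open>a\<close>, with the entries of row \<open>b\<close> as coefficients.\<close>
  have off_diag: "(\<integral>\<^sup>+ \<omega>. ennreal (?t a b \<omega>) \<partial>\<Omega>) \<le> ennreal (real d)" if ab: "a < n" "b < n" "a \<noteq> b" for a b
  proof -
    have z: "clear_row a X (b, j) = X (b, j)" for X j using ab by (simp add: clear_row_def)
    have "(\<integral>\<^sup>+ \<omega>. ennreal (?t a b \<omega>) \<partial>\<Omega>) \<le> (\<integral>\<^sup>+ \<omega>. ennreal (\<Sum>j<d. (fst \<omega> (b, j))\<^sup>2) \<partial>\<Omega>)"
      using nn_integral_row_linear_le[OF ab(1), of "\<lambda>X w j. X (b, j)"] ab unfolding z by simp
    also have "\<dots> = (\<Sum>j<d. \<integral>\<^sup>+ \<omega>. ennreal ((fst \<omega> (b, j))\<^sup>2) \<partial>\<Omega>)"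
      using ab by (subst nn_integral_sum[symmetric]) (auto simp: sum_ennreal)
    also have "\<dots> = (\<Sum>j<d. \<integral>\<^sup>+ t. ennreal (t\<^sup>2) \<partial>\<mu>)"
      using ab by (intro sum.cong refl nn_integral_entry) auto
    also have "(\<integral>\<^sup>+ t. ennreal (t\<^sup>2) \<partial>\<mu>) = 1"
      using nn_integral_affine_sq[of 0 1] by simp
    finally show ?thesis by (simp add: ennreal_of_nat_eq_real_of_nat)
  qed
  \<comment> \<open>Here both factors are the same row, and Cauchy-Schwarz against the constant 1
    leads to fourth moments.\<close>
  have diag: "(\<integral>\<^sup>+ \<omega>. ennreal (?t a a \<omega>) \<partial>\<Omega>) \<le> ennreal ((real d)\<^sup>2 * m4)" if a: "a < n" for a
  proof -
    have "(\<integral>\<^sup>+ \<omega>. ennreal (?t a a \<omega>) \<partial>\<Omega>) \<le> (\<integral>\<^sup>+ \<omega>. (\<Sum>j<d. ennreal (real d * fst \<omega> (a, j) ^ 4)) \<partial>\<Omega>)"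
    proof (rule nn_integral_mono)
      fix \<omega> :: "(nat \<times> nat \<Rightarrow> real) \<times> 'a"
      have "?t a a \<omega> \<le> (\<Sum>j<d. 1\<^sup>2) * (\<Sum>j<d. (fst \<omega> (a, j) * fst \<omega> (a, j))\<^sup>2)"
        using Cauchy_Schwarz_ineq_sum[of "\<lambda>_. 1" "\<lambda>j. fst \<omega> (a, j) * fst \<omega> (a, j)" "{..<d}"] by simp
      also have "\<dots> = (\<Sum>j<d. real d * fst \<omega> (a, j) ^ 4)"
        by (simp add: sum_distrib_left power2_eq_square power4_eq_xxxx mult_ac)
      finally show "ennreal (?t a a \<omega>) \<le> (\<Sum>j<d. ennreal (real d * fst \<omega> (a, j) ^ 4))"
        by (subst sum_ennreal) (auto intro: ennreal_leI)
    qed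
    also have "\<dots> = (\<Sum>j<d. \<integral>\<^sup>+ \<omega>. ennreal (real d * fst \<omega> (a, j) ^ 4) \<partial>\<Omega>)"
      using a by (subst nn_integral_sum) auto
    also have "\<dots> = (\<Sum>j<d. \<integral>\<^sup>+ t. ennreal (real d * t ^ 4) \<partial>\<mu>)"
      using a by (intro sum.cong refl nn_integral_entry) auto
    also have "(\<integral>\<^sup>+ t. ennreal (real d * t ^ 4) \<partial>\<mu>) = ennreal (real d * m4)"
      using fourth by (subst nn_integral_eq_integral) (auto simp: m4_def)
    finally show ?thesis
      by (simp add: ennreal_of_nat_eq_real_of_nat ennreal_mult'[symmetric] m4_nonneg power2_eq_square mult_ac)
  qed
  have "(\<integral>\<^sup>+ \<omega>. ennreal (frob_sq (gram (Matrix.mat n d (fst \<omega>)))) \<partial>\<Omega>)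
      = (\<integral>\<^sup>+ \<omega>. ennreal (1 / (real n)\<^sup>2) * (\<Sum>a<n. \<Sum>b<n. ennreal (?t a b \<omega>)) \<partial>\<Omega>)"
  proof (rule nn_integral_cong)
    fix \<omega> :: "(nat \<times> nat \<Rightarrow> real) \<times> 'a"
    have "frob_sq (gram (Matrix.mat n d (fst \<omega>))) = (\<Sum>a<n. \<Sum>b<n. ?t a b \<omega>) / (real n)\<^sup>2"
      by (subst frob_sq_gram[of _ n d]) auto
    then show "ennreal (frob_sq (gram (Matrix.mat n d (fst \<omega>)))) = ennreal (1 / (real n)\<^sup>2) * (\<Sum>a<n. \<Sum>b<n. ennreal (?t a b \<omega>))"
      by (simp add: sum_nonneg ennreal_mult''[symmetric])
  qed
  also have "\<dots> = ennreal (1 / (real n)\<^sup>2) * (\<Sum>a<n. \<Sum>b<n. \<integral>\<^sup>+ \<omega>. ennreal (?t a b \<omega>) \<partial>\<Omega>)"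
  proof -
    have [measurable]: "(\<lambda>\<omega>. ennreal (?t a b \<omega>)) \<in> borel_measurable \<Omega>" if "a < n" "b < n" for a b
      using that by measurable
    have "(\<integral>\<^sup>+ \<omega>. ennreal (1 / (real n)\<^sup>2) * (\<Sum>a<n. \<Sum>b<n. ennreal (?t a b \<omega>)) \<partial>\<Omega>) =
        ennreal (1 / (real n)\<^sup>2) * (\<integral>\<^sup>+ \<omega>. (\<Sum>a<n. \<Sum>b<n. ennreal (?t a b \<omega>)) \<partial>\<Omega>)"
      by (rule nn_integral_cmult) measurable
    also have "(\<integral>\<^sup>+ \<omega>. (\<Sum>a<n. \<Sum>b<n. ennreal (?t a b \<omega>)) \<partial>\<Omega>) =
        (\<Sum>a<n. \<integral>\<^sup>+ \<omega>. (\<Sum>b<n. ennreal (?t a b \<omega>)) \<partial>\<Omega>)"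
      by (rule nn_integral_sum) measurable
    also have "\<dots> = (\<Sum>a<n. \<Sum>b<n. \<integral>\<^sup>+ \<omega>. ennreal (?t a b \<omega>) \<partial>\<Omega>)"
      by (intro sum.cong refl nn_integral_sum) measurable
    finally show ?thesis .
  qed
  also have "\<dots> \<le> ennreal (1 / (real n)\<^sup>2) * (\<Sum>a<n. \<Sum>b<n. ennreal (real d + (if b = a then (real d)\<^sup>2 * m4 else 0)))"
  proof (intro mult_left_mono sum_mono)
    fix a b assume ab: "a \<in> {..<n}" "b \<in> {..<n}"
    show "(\<integral>\<^sup>+ \<omega>. ennreal (?t a b \<omega>) \<partial>\<Omega>) \<le> ennreal (real d + (if b = a then (real d)\<^sup>2 * m4 else 0))"
    proof (cases "a = b")
      case True
      have "(\<integral>\<^sup>+ \<omega>. ennreal (?t a b \<omega>) \<partial>\<Omega>) \<le> ennreal ((real d)\<^sup>2 * m4)"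
        using diag[of a] ab True by simp
      also have "\<dots> \<le> ennreal (real d + (real d)\<^sup>2 * m4)" by (rule ennreal_leI) simp
      finally show ?thesis using True by simp
    next
      case False
      then show ?thesis using off_diag[of a b] ab by auto
    qed
  qed simp
  also have "\<dots> = ennreal ((1 / (real n)\<^sup>2) * (\<Sum>a<n. \<Sum>b<n. real d + (if b = a then (real d)\<^sup>2 * m4 else 0)))"
  proof -
    have nn: "0 \<le> real d + (if b = a then (real d)\<^sup>2 * m4 else 0)" for a b using m4_nonneg by simp
    show ?thesis unfolding sum_ennreal[OF nn] sum_ennreal[OF sum_nonneg[OF nn]]
      by (rule ennreal_mult[symmetric]) (simp, intro sum_nonneg nn)
  qed
  also have "(1 / (real n)\<^sup>2) * (\<Sum>a<n. \<Sum>b<n. real d + (if b = a then (real d)\<^sup>2 * m4 else 0)) = gram_bound"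
    using n by (simp add: sum.distrib gram_bound_def power2_eq_square field_simps)
  finally show ?thesis .
qed

text \<open>All uses of the independence of a row and the rest go through this bound, except for
  linear forms. With \<open>c\<close> of order d the deviation is of order sqrt d.\<close>

lemma integral_row_quad_le:
  assumes i: "i < n" and c: "0 \<le> c"
    and B: "mat_measurable \<Omega> d d (\<lambda>\<omega>. B (clear_row i (fst \<omega>)) (snd \<omega>))"
    and le: "(\<integral>\<^sup>+ \<omega>. ennreal (frob_sq (B (clear_row i (fst \<omega>)) (snd \<omega>))) \<partial>\<Omega>) \<le> ennreal c"
  defines "Z \<equiv> (\<lambda>\<omega>. scalar_prod (Matrix.row (Matrix.mat n d (fst \<omega>)) i)
      (B (clear_row i (fst \<omega>)) (snd \<omega>) *\<^sub>v Matrix.row (Matrix.mat n d (fst \<omega>)) i) - tr (B (clear_row i (fst \<omega>)) (snd \<omega>)))"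
  shows "integrable \<Omega> Z" "(\<integral> \<omega>. \<bar>Z \<omega>\<bar> \<partial>\<Omega>) \<le> sqrt (\<kappa> * c)"
proof -
  note Bc = mat_measurable_carrier[OF B]
  note [measurable] = mat_measurable_entry[OF B]
  have Bc': "B (clear_row i X) w \<in> carrier_mat d d" for X w using Bc[of "(X, w)"] by simp
  have Z: "Z \<omega> = (\<Sum>j<d. \<Sum>k<d. B (clear_row i (fst \<omega>)) (snd \<omega>) $$ (j, k) * fst \<omega> (i, j) * fst \<omega> (i, k))
      - (\<Sum>j<d. B (clear_row i (fst \<omega>)) (snd \<omega>) $$ (j, j))" for \<omega>
  proof -
    let ?x = "Matrix.row (Matrix.mat n d (fst \<omega>)) i" and ?B = "B (clear_row i (fst \<omega>)) (snd \<omega>)"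
    have x: "?x \<in> carrier_vec d" by (simp add: carrier_vecI)
    have xj: "?x $ j = fst \<omega> (i, j)" if "j < d" for j using i that by simp
    have "scalar_prod ?x (?B *\<^sub>v ?x) = (\<Sum>j<d. ?x $ j * (?B *\<^sub>v ?x) $ j)"
      using Bc x by (intro scalar_prod_sum mult_mat_vec_carrier[of _ d d])
    also have "\<dots> = (\<Sum>j<d. \<Sum>k<d. ?B $$ (j, k) * fst \<omega> (i, j) * fst \<omega> (i, k))"
      by (intro sum.cong refl)
        (simp add: index_mult_mat_vec_sum[OF Bc x] xj sum_distrib_left mult_ac del: index_mult_mat_vec index_row row_mat)
    finally show ?thesis unfolding Z_def tr_eq[OF Bc] by simp
  qed
  have Zm: "Z \<in> borel_measurable \<Omega>"
    unfolding Z using i by measurable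
  have "(\<integral>\<^sup>+ \<omega>. ennreal ((Z \<omega>)\<^sup>2) \<partial>\<Omega>) \<le>
      (\<integral>\<^sup>+ \<omega>. ennreal (\<kappa> * (\<Sum>j<d. \<Sum>k<d. (B (clear_row i (fst \<omega>)) (snd \<omega>) $$ (j, k))\<^sup>2)) \<partial>\<Omega>)"
    unfolding Z using nn_integral_row_quad_le[OF i, of "\<lambda>X w j k. B X w $$ (j, k)"] by simp
  also have "\<dots> = (\<integral>\<^sup>+ \<omega>. ennreal \<kappa> * ennreal (frob_sq (B (clear_row i (fst \<omega>)) (snd \<omega>))) \<partial>\<Omega>)"
    using \<kappa>_pos by (intro nn_integral_cong) (simp add: frob_sq_eq[OF Bc'] ennreal_mult sum_nonneg)
  also have "\<dots> = ennreal \<kappa> * (\<integral>\<^sup>+ \<omega>. ennreal (frob_sq (B (clear_row i (fst \<omega>)) (snd \<omega>))) \<partial>\<Omega>)"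
    by (intro nn_integral_cmult measurable_compose[OF borel_measurable_frob_sq[OF B]]) simp
  also have "\<dots> \<le> ennreal \<kappa> * ennreal c" by (intro mult_left_mono le) simp
  also have "\<dots> = ennreal (\<kappa> * c)" using \<kappa>_pos c by (simp add: ennreal_mult)
  finally have "(\<integral>\<^sup>+ \<omega>. ennreal ((Z \<omega>)\<^sup>2) \<partial>\<Omega>) \<le> ennreal (\<kappa> * c)" .
  from MXN.L1_le_of_nn_integral_sq[OF Zm _ this] show "integrable \<Omega> Z" "(\<integral> \<omega>. \<bar>Z \<omega>\<bar> \<partial>\<Omega>) \<le> sqrt (\<kappa> * c)"
    using \<kappa>_pos c by simp_all
qed

end

section \<open>The random resolvent\<close>

locale sketch_law = data_law \<mu> N n d
  for \<mu> :: "real measure" and N :: "(nat \<times> nat \<Rightarrow> real) measure" and n d :: nat +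
  fixes p :: nat and l :: real
  assumes sets_N: "sets N = sets (PiM ({..<p} \<times> {..<d}) (\<lambda>_. borel))"
    and orth_N: "AE w in N. Matrix.mat p d w * transpose_mat (Matrix.mat p d w) = 1\<^sub>m p"
    and n: "0 < n" and l: "0 < l"
begin

definition Xm :: "(nat \<times> nat \<Rightarrow> real) \<times> (nat \<times> nat \<Rightarrow> real) \<Rightarrow> real Matrix.mat" where
  "Xm \<omega> = Matrix.mat n d (fst \<omega>)"
definition Wm :: "(nat \<times> nat \<Rightarrow> real) \<times> (nat \<times> nat \<Rightarrow> real) \<Rightarrow> real Matrix.mat" where
  "Wm \<omega> = Matrix.mat p d (snd \<omega>)"
definition Am :: "(nat \<times> nat \<Rightarrow> real) \<times> (nat \<times> nat \<Rightarrow> real) \<Rightarrow> real Matrix.mat" where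
  "Am \<omega> = resol l (Wm \<omega>) (Xm \<omega>)"
definition Mm :: "(nat \<times> nat \<Rightarrow> real) \<times> (nat \<times> nat \<Rightarrow> real) \<Rightarrow> real Matrix.mat" where
  "Mm \<omega> = Am \<omega> * gram (Xm \<omega>)"
definition res_trace :: "(nat \<times> nat \<Rightarrow> real) \<times> (nat \<times> nat \<Rightarrow> real) \<Rightarrow> real" where
  "res_trace \<omega> = tr (Am \<omega>) / real n"
definition noise_term :: "(nat \<times> nat \<Rightarrow> real) \<times> (nat \<times> nat \<Rightarrow> real) \<Rightarrow> real" where
  "noise_term \<omega> = (\<Sum>i<n. scalar_prod (Am \<omega> *\<^sub>v Matrix.row (Xm \<omega>) i) (Am \<omega> *\<^sub>v Matrix.row (Xm \<omega>) i)) / (real n)\<^sup>2"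

lemma carriers [simp]:
  "Xm \<omega> \<in> carrier_mat n d" "Wm \<omega> \<in> carrier_mat p d"
  by (auto simp: Xm_def Wm_def)

lemma ridge: "ridge d n p l (Wm \<omega>) (Xm \<omega>)"
  by unfold_locales (auto simp: n l)

lemma Am_carrier [simp]: "Am \<omega> \<in> carrier_mat d d"
  unfolding Am_def by (rule ridge.resol_carrier[OF ridge])

lemma Mm_carrier [simp]: "Mm \<omega> \<in> carrier_mat d d"
  unfolding Mm_def by (rule mult_carrier_mat[OF Am_carrier gram_carrier]) (rule carriers)

lemma measurable_snd_entry [measurable]:
  "a < p \<Longrightarrow> j < d \<Longrightarrow> (\<lambda>\<omega>. snd \<omega> (a, j)) \<in> borel_measurable \<Omega>"
proof -
  assume "a < p" "j < d"
  then have "(\<lambda>w. w (a, j)) \<in> borel_measurable N"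
    by (subst measurable_cong_sets[OF sets_N refl]) (rule measurable_component_singleton, auto)
  then show ?thesis by (rule measurable_compose[OF measurable_snd])
qed

lemma Xm_meas: "mat_measurable \<Omega> n d Xm"
  by (rule mat_measurableI) (auto simp: Xm_def measurable_entry_\<Omega>)

lemma Xz_meas: "mat_measurable \<Omega> n d (\<lambda>\<omega>. Matrix.mat n d (clear_row i (fst \<omega>)))"
proof (rule mat_measurableI)
  fix a j assume "a < n" "j < d"
  then show "(\<lambda>\<omega>. Matrix.mat n d (clear_row i (fst \<omega>)) $$ (a, j)) \<in> borel_measurable \<Omega>"
    by (cases "a = i") (auto simp: clear_row_def measurable_entry_\<Omega>)
qed auto

lemma Wm_meas: "mat_measurable \<Omega> p d Wm"
  by (rule mat_measurableI) (auto simp: Wm_def measurable_snd_entry)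

lemma Am_meas: "mat_measurable \<Omega> d d Am"
  unfolding Am_def by (rule mat_measurable_resol[OF Wm_meas Xm_meas n l])

lemma Mm_meas: "mat_measurable \<Omega> d d Mm"
  unfolding Mm_def by (intro mat_measurable_mult[of _ d d] Am_meas mat_measurable_gram[OF Xm_meas])

lemma row_Xm: "i < n \<Longrightarrow> j < d \<Longrightarrow> Matrix.row (Xm \<omega>) i $ j = fst \<omega> (i, j)"
  by (simp add: Xm_def)

lemma row_Xm_carrier [simp]: "Matrix.row (Xm \<omega>) i \<in> carrier_vec d"
  by (simp add: Xm_def carrier_vecI)

lemma res_trace_meas [measurable]: "res_trace \<in> borel_measurable \<Omega>"
  unfolding res_trace_def by (intro borel_measurable_divide borel_measurable_tr[OF Am_meas] borel_measurable_const)

lemma Am_vec_meas: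
  assumes i: "i < n" and k: "k < d"
  shows "(\<lambda>\<omega>. (Am \<omega> *\<^sub>v Matrix.row (Xm \<omega>) i) $ k) \<in> borel_measurable \<Omega>"
proof -
  have "(\<lambda>\<omega>. (Am \<omega> *\<^sub>v Matrix.row (Xm \<omega>) i) $ k) = (\<lambda>\<omega>. \<Sum>j<d. Am \<omega> $$ (k, j) * fst \<omega> (i, j))"
    using i k by (intro ext) (simp add: index_mult_mat_vec_sum[of _ d d] row_Xm del: index_mult_mat_vec)
  also have "\<dots> \<in> borel_measurable \<Omega>"
    using i k by (intro borel_measurable_sum borel_measurable_times mat_measurable_entry[OF Am_meas] measurable_entry_\<Omega>) auto
  finally show ?thesis .
qed

lemma noise_term_meas [measurable]: "noise_term \<in> borel_measurable \<Omega>"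
proof -
  have "scalar_prod (Am \<omega> *\<^sub>v Matrix.row (Xm \<omega>) i) (Am \<omega> *\<^sub>v Matrix.row (Xm \<omega>) i) =
      (\<Sum>k<d. (Am \<omega> *\<^sub>v Matrix.row (Xm \<omega>) i) $ k * (Am \<omega> *\<^sub>v Matrix.row (Xm \<omega>) i) $ k)" for \<omega> i
    by (intro scalar_prod_sum mult_mat_vec_carrier[of _ d d]) simp_all
  then show ?thesis unfolding noise_term_def
    by (simp only:) (intro borel_measurable_divide borel_measurable_sum borel_measurable_times Am_vec_meas borel_measurable_const, auto)
qed

lemma AE_orth: "AE \<omega> in \<Omega>. Wm \<omega> * transpose_mat (Wm \<omega>) = 1\<^sub>m p"
proof -
  obtain K where K: "K \<in> null_sets N" "{w \<in> space N. \<not> Matrix.mat p d w * transpose_mat (Matrix.mat p d w) = 1\<^sub>m p} \<subseteq> K"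
    using orth_N by (auto elim!: AE_E simp: null_sets_def)
  have "space MX \<times> K \<in> null_sets \<Omega>"
    using K(1) by (auto simp: null_sets_def N.emeasure_pair_measure_Times)
  then show ?thesis
    by (rule AE_I') (use K(2) in \<open>auto simp: Wm_def space_pair_measure\<close>)
qed

text \<open>The event on which all deterministic estimates are available; each passes to
  expectations through it.\<close>

lemma AE_ridge_orth: "AE \<omega> in \<Omega>. ridge_orth d n p l (Wm \<omega>) (Xm \<omega>)"
  using AE_orth
proof eventually_elim
  fix \<omega> assume "Wm \<omega> * transpose_mat (Wm \<omega>) = 1\<^sub>m p"
  then show "ridge_orth d n p l (Wm \<omega>) (Xm \<omega>)"
    by unfold_locales (auto simp: n l)
qed

text \<open>The data matrix and the sketch are separate arguments here, so that one row of the former can be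
  cleared inside an expectation over both.\<close>

definition Az :: "(nat \<times> nat \<Rightarrow> real) \<Rightarrow> (nat \<times> nat \<Rightarrow> real) \<Rightarrow> real Matrix.mat" where
  "Az X w = resol l (Matrix.mat p d w) (Matrix.mat n d X)"
definition Qz :: "(nat \<times> nat \<Rightarrow> real) \<Rightarrow> (nat \<times> nat \<Rightarrow> real) \<Rightarrow> real Matrix.mat" where
  "Qz X w = 1\<^sub>m d - transpose_mat (Matrix.mat p d w) * Matrix.mat p d w"
definition C1z :: "(nat \<times> nat \<Rightarrow> real) \<Rightarrow> (nat \<times> nat \<Rightarrow> real) \<Rightarrow> real Matrix.mat" where
  "C1z X w = Qz X w * gram (Matrix.mat n d X) * Az X w"
definition C2z :: "(nat \<times> nat \<Rightarrow> real) \<Rightarrow> (nat \<times> nat \<Rightarrow> real) \<Rightarrow> real Matrix.mat" where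
  "C2z X w = Qz X w * gram (Matrix.mat n d X) * Az X w * Az X w"

lemma Az_meas: "mat_measurable \<Omega> d d (\<lambda>\<omega>. Az (clear_row i (fst \<omega>)) (snd \<omega>))"
  unfolding Az_def Wm_def[symmetric] by (rule mat_measurable_resol[OF Wm_meas Xz_meas n l])

lemma Qz_meas: "mat_measurable \<Omega> d d (\<lambda>\<omega>. Qz (clear_row i (fst \<omega>)) (snd \<omega>))"
  unfolding Qz_def Wm_def[symmetric]
  by (intro mat_measurable_minus mat_measurable_const one_carrier_mat mat_measurable_mult[of _ d p]
      mat_measurable_transpose Wm_meas)

lemma C1z_meas: "mat_measurable \<Omega> d d (\<lambda>\<omega>. C1z (clear_row i (fst \<omega>)) (snd \<omega>))"
  unfolding C1z_def
  by (intro mat_measurable_mult[of _ d d] Qz_meas Az_meas mat_measurable_gram[OF Xz_meas])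

lemma C2z_meas: "mat_measurable \<Omega> d d (\<lambda>\<omega>. C2z (clear_row i (fst \<omega>)) (snd \<omega>))"
  unfolding C2z_def
  by (intro mat_measurable_mult[of _ d d] Qz_meas Az_meas mat_measurable_gram[OF Xz_meas])

lemma zero_row_Xm: "Matrix.mat n d (clear_row i (fst \<omega>)) = zero_row i (Xm \<omega>)"
  by (simp add: Xm_def mat_clear_row)

section \<open>Estimates at a sample point with orthonormal sketch\<close>

context
  fixes \<omega> assumes ro: "ridge_orth d n p l (Wm \<omega>) (Xm \<omega>)"
begin

interpretation O: ridge_orth d n p l "Wm \<omega>" "Xm \<omega>" by (rule ro)

interpretation Z: resolvent d l "transpose_mat (Wm \<omega>) * Wm \<omega>" "gram (zero_row i (Xm \<omega>))"
    "resol l (Wm \<omega>) (zero_row i (Xm \<omega>))" for i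
  by (rule O.zero_row_resolvent)

lemma Az_eq: "Az (clear_row i (fst \<omega>)) (snd \<omega>) = resol l (Wm \<omega>) (zero_row i (Xm \<omega>))"
  by (simp add: Az_def zero_row_Xm Wm_def)

lemma Qz_eq: "Qz X (snd \<omega>) = O.R.Q"
  unfolding Qz_def O.R.Q_def unfolding Wm_def ..

lemma C1z_eq: "C1z (clear_row i (fst \<omega>)) (snd \<omega>) = O.C1' i"
  by (simp add: C1z_def Z.C1_def Qz_eq Az_eq zero_row_Xm)

lemma C2z_eq: "C2z (clear_row i (fst \<omega>)) (snd \<omega>) = O.C2' i"
  by (simp add: C2z_def Z.C2_def Qz_eq Az_eq zero_row_Xm)

lemma frob_sq_Az_le: "frob_sq (Az (clear_row i (fst \<omega>)) (snd \<omega>)) \<le> real d / l\<^sup>2"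
  unfolding Az_eq by (rule Z.frob_sq_A_le)

lemma frob_sq_Qz_le: "frob_sq (Qz X (snd \<omega>)) \<le> real d"
  unfolding Qz_eq by (rule O.R.frob_sq_Q_le)

lemma frob_sq_C1z_le: "frob_sq (C1z (clear_row i (fst \<omega>)) (snd \<omega>)) \<le> 1 / l\<^sup>2 * frob_sq (gram (Xm \<omega>))"
  unfolding C1z_eq using Z.frob_sq_C1_le[of i] frob_sq_gram_zero_row_le[OF carriers(1), of i \<omega>] l
  by (simp add: field_simps)

lemma frob_sq_C2z_le: "frob_sq (C2z (clear_row i (fst \<omega>)) (snd \<omega>)) \<le> 1 / l ^ 4 * frob_sq (gram (Xm \<omega>))"
  unfolding C2z_eq using Z.frob_sq_C2_le[of i] frob_sq_gram_zero_row_le[OF carriers(1), of i \<omega>] l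
  by (simp add: field_simps flip: power_add)

lemma tr_Qz: "tr (Qz X (snd \<omega>)) = real d - real p"
  unfolding Qz_eq O.R.Q_def by (subst tr_minus[of _ d]) (auto simp: tr_one O.tr_P)

lemma tr_C1z: "tr (C1z (clear_row i (fst \<omega>)) (snd \<omega>)) = 0"
  unfolding C1z_eq by (rule Z.tr_C1)

lemma tr_C2z: "tr (C2z (clear_row i (fst \<omega>)) (snd \<omega>)) = 0"
  unfolding C2z_eq by (rule Z.tr_C2)

lemma noise_term_eq: "noise_term \<omega> = O.T" unfolding noise_term_def O.T_def Am_def ..

lemma noise_term_bounds: "0 \<le> noise_term \<omega>" "noise_term \<omega> \<le> 1 / l"
  unfolding noise_term_eq by (rule O.T_nonneg O.T_le)+

lemma tr_Mm: "tr (Mm \<omega>) = real p - l * tr (Am \<omega>)"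
  unfolding Mm_def Am_def by (rule O.tr_A_S)

lemma tr_Mm_nonneg: "0 \<le> tr (Mm \<omega>)"
  unfolding Mm_def Am_def tr_mult_gram[OF carriers(1) O.resol_carrier]
  by (intro divide_nonneg_nonneg sum_nonneg O.R.A_psd) auto

lemma res_trace_bounds: "0 \<le> res_trace \<omega>" "res_trace \<omega> \<le> real p / (l * real n)"
proof -
  show "0 \<le> res_trace \<omega>" unfolding res_trace_def Am_def using O.R.tr_A_nonneg by simp
  have "l * tr (Am \<omega>) \<le> real p" using tr_Mm tr_Mm_nonneg by simp
  then show "res_trace \<omega> \<le> real p / (l * real n)" using l n by (simp add: res_trace_def field_simps)
qed

lemma frob_sq_Mm_le: "frob_sq (Mm \<omega>) \<le> 1 / l\<^sup>2 * frob_sq (gram (Xm \<omega>))"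
  unfolding Mm_def Am_def using O.R.frob_sq_A_S_le by simp

lemma res_trace_fixed_point: "\<bar>l * res_trace \<omega> + res_trace \<omega> / (1 + res_trace \<omega>) - real p / real n\<bar> \<le>
    (\<Sum>i<n. \<bar>scalar_prod (Matrix.row (Xm \<omega>) i) (Az (clear_row i (fst \<omega>)) (snd \<omega>) *\<^sub>v Matrix.row (Xm \<omega>) i)
      - tr (Az (clear_row i (fst \<omega>)) (snd \<omega>))\<bar> / real n) / real n + 1 / (l * real n)"
  using O.fixed_point unfolding Az_eq res_trace_def Am_def .

text \<open>The traces, 0 for \<open>C1z\<close> and \<open>C2z\<close> and \<open>d - p\<close> for
  \<open>Qz\<close>, are inserted so that all three errors have the shape of a quadratic form minus
  its trace.\<close>

lemma frob_sq_Mm_approx: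
  "\<bar>frob_sq (Mm \<omega>) - (tr (Mm \<omega>) - l * real n * noise_term \<omega> + (real d - real p) * noise_term \<omega>)\<bar>
    \<le> (\<Sum>i<n. \<bar>scalar_prod (Matrix.row (Xm \<omega>) i) (Qz (clear_row i (fst \<omega>)) (snd \<omega>) *\<^sub>v Matrix.row (Xm \<omega>) i)
            - tr (Qz (clear_row i (fst \<omega>)) (snd \<omega>))\<bar> / l
        + (\<bar>scalar_prod (Matrix.row (Xm \<omega>) i) (C2z (clear_row i (fst \<omega>)) (snd \<omega>) *\<^sub>v Matrix.row (Xm \<omega>) i)
            - tr (C2z (clear_row i (fst \<omega>)) (snd \<omega>))\<bar>
          + \<bar>scalar_prod (Matrix.row (Xm \<omega>) i) (C1z (clear_row i (fst \<omega>)) (snd \<omega>) *\<^sub>v Matrix.row (Xm \<omega>) i)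
            - tr (C1z (clear_row i (fst \<omega>)) (snd \<omega>))\<bar> / l)) / real n"
  unfolding tr_C1z tr_C2z tr_Qz unfolding C1z_eq C2z_eq Qz_eq noise_term_eq
  using O.frob_sq_A_S unfolding Mm_def Am_def by simp

lemma quad_Mm_le:
  assumes u: "u \<in> carrier_vec d"
  shows "\<bar>scalar_prod u (Mm \<omega> *\<^sub>v u)\<bar> \<le>
    (\<Sum>i<n. \<bar>scalar_prod (Az (clear_row i (fst \<omega>)) (snd \<omega>) *\<^sub>v u) (Matrix.row (Xm \<omega>) i)\<bar> *
      \<bar>scalar_prod (Matrix.row (Xm \<omega>) i) u\<bar>) / real n"
  using O.quad_A_S_le[OF u] unfolding Mm_def Am_def Az_eq .

lemma sq_Az_le:
  assumes u: "u \<in> carrier_vec d"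
  shows "scalar_prod (Az (clear_row i (fst \<omega>)) (snd \<omega>) *\<^sub>v u) (Az (clear_row i (fst \<omega>)) (snd \<omega>) *\<^sub>v u) \<le> 1 / l\<^sup>2 * scalar_prod u u"
  unfolding Az_eq by (rule Z.A_norm_le[OF u])

end

end

section \<open>Expectations over the data and the sketch\<close>

context sketch_law
begin

lemma nn_integral_frob_le:
  assumes "AE \<omega> in \<Omega>. frob_sq (B \<omega>) \<le> c" and "0 \<le> c"
  shows "(\<integral>\<^sup>+ \<omega>. ennreal (frob_sq (B \<omega>)) \<partial>\<Omega>) \<le> ennreal c"
proof -
  have "(\<integral>\<^sup>+ \<omega>. ennreal (frob_sq (B \<omega>)) \<partial>\<Omega>) \<le> (\<integral>\<^sup>+ \<omega>. ennreal c \<partial>\<Omega>)"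
    using assms(1) by (intro nn_integral_mono_AE) (auto intro: ennreal_leI)
  then show ?thesis by (simp add: MXN.emeasure_space_1)
qed

lemma nn_integral_frob_le_gram:
  assumes "AE \<omega> in \<Omega>. frob_sq (B \<omega>) \<le> c * frob_sq (gram (Xm \<omega>))" and c: "0 \<le> c"
  shows "(\<integral>\<^sup>+ \<omega>. ennreal (frob_sq (B \<omega>)) \<partial>\<Omega>) \<le> ennreal (c * gram_bound)"
proof -
  have "(\<integral>\<^sup>+ \<omega>. ennreal (frob_sq (B \<omega>)) \<partial>\<Omega>) \<le> (\<integral>\<^sup>+ \<omega>. ennreal c * ennreal (frob_sq (gram (Xm \<omega>))) \<partial>\<Omega>)"
    using assms by (intro nn_integral_mono_AE) (auto intro: ennreal_leI simp: ennreal_mult[symmetric] frob_sq_nonneg)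
  also have "\<dots> = ennreal c * (\<integral>\<^sup>+ \<omega>. ennreal (frob_sq (gram (Xm \<omega>))) \<partial>\<Omega>)"
    by (intro nn_integral_cmult measurable_compose[OF borel_measurable_frob_sq[OF mat_measurable_gram[OF Xm_meas]]]) simp
  also have "\<dots> \<le> ennreal c * ennreal gram_bound"
    using nn_integral_frob_sq_gram_le[OF n] unfolding Xm_def by (rule mult_left_mono) simp
  also have "\<dots> = ennreal (c * gram_bound)" using c gram_bound_nonneg by (simp add: ennreal_mult)
  finally show ?thesis .
qed

lemma frob_sq_Mm:
  "integrable \<Omega> (\<lambda>\<omega>. frob_sq (Mm \<omega>))"
proof -
  have le: "(\<integral>\<^sup>+ \<omega>. ennreal (frob_sq (Mm \<omega>)) \<partial>\<Omega>) \<le> ennreal (1 / l\<^sup>2 * gram_bound)"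
    using AE_ridge_orth by (intro nn_integral_frob_le_gram) (auto elim!: eventually_mono dest: frob_sq_Mm_le)
  show ?thesis
  proof (rule integrableI_bounded)
    show "(\<lambda>\<omega>. frob_sq (Mm \<omega>)) \<in> borel_measurable \<Omega>" by (rule borel_measurable_frob_sq[OF Mm_meas])
    show "(\<integral>\<^sup>+ \<omega>. ennreal (norm (frob_sq (Mm \<omega>))) \<partial>\<Omega>) < \<infinity>"
      using le by (simp add: frob_sq_nonneg order_le_less_trans)
  qed
qed

abbreviation "quad_dev i B \<equiv> (\<lambda>\<omega>. scalar_prod (Matrix.row (Xm \<omega>) i)
      (B (clear_row i (fst \<omega>)) (snd \<omega>) *\<^sub>v Matrix.row (Xm \<omega>) i) - tr (B (clear_row i (fst \<omega>)) (snd \<omega>)))"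

lemma quad_dev_Az:
  assumes "i < n"
  shows "integrable \<Omega> (quad_dev i Az)" "(\<integral> \<omega>. \<bar>quad_dev i Az \<omega>\<bar> \<partial>\<Omega>) \<le> sqrt (\<kappa> * (real d / l\<^sup>2))"
proof -
  have "(\<integral>\<^sup>+ \<omega>. ennreal (frob_sq (Az (clear_row i (fst \<omega>)) (snd \<omega>))) \<partial>\<Omega>) \<le> ennreal (real d / l\<^sup>2)"
    using AE_ridge_orth by (intro nn_integral_frob_le) (auto elim!: eventually_mono dest: frob_sq_Az_le)
  from integral_row_quad_le[OF assms _ Az_meas this]
  show "integrable \<Omega> (quad_dev i Az)" "(\<integral> \<omega>. \<bar>quad_dev i Az \<omega>\<bar> \<partial>\<Omega>) \<le> sqrt (\<kappa> * (real d / l\<^sup>2))"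
    unfolding Xm_def by simp_all
qed

lemma quad_dev_Qz:
  assumes "i < n"
  shows "integrable \<Omega> (quad_dev i Qz)" "(\<integral> \<omega>. \<bar>quad_dev i Qz \<omega>\<bar> \<partial>\<Omega>) \<le> sqrt (\<kappa> * real d)"
proof -
  have "(\<integral>\<^sup>+ \<omega>. ennreal (frob_sq (Qz (clear_row i (fst \<omega>)) (snd \<omega>))) \<partial>\<Omega>) \<le> ennreal (real d)"
    using AE_ridge_orth by (intro nn_integral_frob_le) (auto elim!: eventually_mono dest: frob_sq_Qz_le)
  from integral_row_quad_le[OF assms _ Qz_meas this]
  show "integrable \<Omega> (quad_dev i Qz)" "(\<integral> \<omega>. \<bar>quad_dev i Qz \<omega>\<bar> \<partial>\<Omega>) \<le> sqrt (\<kappa> * real d)"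
    unfolding Xm_def by simp_all
qed

lemma quad_dev_C1z:
  assumes "i < n"
  shows "integrable \<Omega> (quad_dev i C1z)" "(\<integral> \<omega>. \<bar>quad_dev i C1z \<omega>\<bar> \<partial>\<Omega>) \<le> sqrt (\<kappa> * (1 / l\<^sup>2 * gram_bound))"
proof -
  have "(\<integral>\<^sup>+ \<omega>. ennreal (frob_sq (C1z (clear_row i (fst \<omega>)) (snd \<omega>))) \<partial>\<Omega>) \<le> ennreal (1 / l\<^sup>2 * gram_bound)"
    using AE_ridge_orth by (intro nn_integral_frob_le_gram) (auto elim!: eventually_mono dest: frob_sq_C1z_le)
  from integral_row_quad_le[OF assms _ C1z_meas this]
  show "integrable \<Omega> (quad_dev i C1z)" "(\<integral> \<omega>. \<bar>quad_dev i C1z \<omega>\<bar> \<partial>\<Omega>) \<le> sqrt (\<kappa> * (1 / l\<^sup>2 * gram_bound))"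
    unfolding Xm_def using gram_bound_nonneg by simp_all
qed

lemma quad_dev_C2z:
  assumes "i < n"
  shows "integrable \<Omega> (quad_dev i C2z)" "(\<integral> \<omega>. \<bar>quad_dev i C2z \<omega>\<bar> \<partial>\<Omega>) \<le> sqrt (\<kappa> * (1 / l ^ 4 * gram_bound))"
proof -
  have "(\<integral>\<^sup>+ \<omega>. ennreal (frob_sq (C2z (clear_row i (fst \<omega>)) (snd \<omega>))) \<partial>\<Omega>) \<le> ennreal (1 / l ^ 4 * gram_bound)"
    using AE_ridge_orth by (intro nn_integral_frob_le_gram) (auto elim!: eventually_mono dest: frob_sq_C2z_le)
  from integral_row_quad_le[OF assms _ C2z_meas this]
  show "integrable \<Omega> (quad_dev i C2z)" "(\<integral> \<omega>. \<bar>quad_dev i C2z \<omega>\<bar> \<partial>\<Omega>) \<le> sqrt (\<kappa> * (1 / l ^ 4 * gram_bound))"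
    unfolding Xm_def using gram_bound_nonneg by simp_all
qed

lemma res_trace_integrable: "integrable \<Omega> res_trace"
proof (rule MXN.integrable_const_bound)
  show "AE \<omega> in \<Omega>. norm (res_trace \<omega>) \<le> real p / (l * real n)"
    using AE_ridge_orth by eventually_elim (use res_trace_bounds in auto)
qed simp

lemma noise_term_integrable: "integrable \<Omega> noise_term"
proof (rule MXN.integrable_const_bound)
  show "AE \<omega> in \<Omega>. norm (noise_term \<omega>) \<le> 1 / l"
    using AE_ridge_orth by eventually_elim (use noise_term_bounds in auto)
qed simp

lemma tr_Mm_eq: "AE \<omega> in \<Omega>. tr (Mm \<omega>) = real p - l * real n * res_trace \<omega>"
  using AE_ridge_orth by eventually_elim (use n in \<open>simp add: tr_Mm res_trace_def\<close>)

lemma tr_Mm_integrable: "integrable \<Omega> (\<lambda>\<omega>. tr (Mm \<omega>))"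
  by (rule integrable_cong_AE_imp[of _ "\<lambda>\<omega>. real p - l * real n * res_trace \<omega>"])
    (use tr_Mm_eq res_trace_integrable borel_measurable_tr[OF Mm_meas] in \<open>auto elim!: eventually_mono\<close>)

lemma integral_tr_Mm: "(\<integral> \<omega>. tr (Mm \<omega>) \<partial>\<Omega>) = real p - l * real n * (\<integral> \<omega>. res_trace \<omega> \<partial>\<Omega>)"
proof -
  have "(\<integral> \<omega>. tr (Mm \<omega>) \<partial>\<Omega>) = (\<integral> \<omega>. real p - l * real n * res_trace \<omega> \<partial>\<Omega>)"
    by (rule integral_cong_AE) (use tr_Mm_eq borel_measurable_tr[OF Mm_meas] in auto)
  then show ?thesis using res_trace_integrable by (simp add: MXN.prob_space)
qed

text \<open>All rows obey the same bound in mean, so averaging over them loses nothing; the result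
  is of order n^(-1/2) when d/n is bounded.\<close>

lemma integral_fixed_point_le:
  "(\<integral> \<omega>. \<bar>l * res_trace \<omega> + res_trace \<omega> / (1 + res_trace \<omega>) - real p / real n\<bar> \<partial>\<Omega>)
    \<le> sqrt (\<kappa> * (real d / l\<^sup>2)) / real n + 1 / (l * real n)"
  "integrable \<Omega> (\<lambda>\<omega>. \<bar>l * res_trace \<omega> + res_trace \<omega> / (1 + res_trace \<omega>) - real p / real n\<bar>)"
proof -
  let ?f = "\<lambda>\<omega>. \<bar>l * res_trace \<omega> + res_trace \<omega> / (1 + res_trace \<omega>) - real p / real n\<bar>"
  let ?g = "\<lambda>\<omega>. (\<Sum>i<n. \<bar>quad_dev i Az \<omega>\<bar> / real n) / real n + 1 / (l * real n)"
  have gi: "integrable \<Omega> ?g"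
    by (intro Bochner_Integration.integrable_add integrable_divide Bochner_Integration.integrable_sum
        integrable_abs quad_dev_Az) auto
  have le: "AE \<omega> in \<Omega>. ?f \<omega> \<le> ?g \<omega>"
    using AE_ridge_orth by eventually_elim (rule res_trace_fixed_point)
  show fi: "integrable \<Omega> ?f"
    by (rule Bochner_Integration.integrable_bound[OF gi]) (use le in \<open>auto elim!: eventually_mono\<close>)
  have "(\<integral> \<omega>. ?f \<omega> \<partial>\<Omega>) \<le> (\<integral> \<omega>. ?g \<omega> \<partial>\<Omega>)" by (rule integral_mono_AE[OF fi gi le])
  also have "\<dots> = (\<Sum>i<n. (\<integral> \<omega>. \<bar>quad_dev i Az \<omega>\<bar> \<partial>\<Omega>) / real n) / real n + 1 / (l * real n)"
  proof -
    have "(\<integral> \<omega>. ?g \<omega> \<partial>\<Omega>) = (\<integral> \<omega>. (\<Sum>i<n. \<bar>quad_dev i Az \<omega>\<bar> / real n) / real n \<partial>\<Omega>) + (\<integral> \<omega>. 1 / (l * real n) \<partial>\<Omega>)"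
      by (intro Bochner_Integration.integral_add integrable_divide Bochner_Integration.integrable_sum
          integrable_abs quad_dev_Az) auto
    also have "(\<integral> \<omega>. (\<Sum>i<n. \<bar>quad_dev i Az \<omega>\<bar> / real n) / real n \<partial>\<Omega>) =
        (\<integral> \<omega>. (\<Sum>i<n. \<bar>quad_dev i Az \<omega>\<bar> / real n) \<partial>\<Omega>) / real n"
      by (rule integral_divide_zero)
    also have "(\<integral> \<omega>. (\<Sum>i<n. \<bar>quad_dev i Az \<omega>\<bar> / real n) \<partial>\<Omega>) = (\<Sum>i<n. (\<integral> \<omega>. \<bar>quad_dev i Az \<omega>\<bar> / real n \<partial>\<Omega>))"
      by (intro Bochner_Integration.integral_sum integrable_divide integrable_abs quad_dev_Az) auto
    finally show ?thesis by (simp add: MXN.prob_space)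
  qed
  also have "\<dots> \<le> (\<Sum>i<n. sqrt (\<kappa> * (real d / l\<^sup>2)) / real n) / real n + 1 / (l * real n)"
    using l by (intro add_mono divide_right_mono sum_mono quad_dev_Az) auto
  also have "\<dots> = sqrt (\<kappa> * (real d / l\<^sup>2)) / real n + 1 / (l * real n)" using n by simp
  finally show "(\<integral> \<omega>. ?f \<omega> \<partial>\<Omega>) \<le> sqrt (\<kappa> * (real d / l\<^sup>2)) / real n + 1 / (l * real n)" .
qed

text \<open>The right-hand side is of order sqrt d, as \<open>gram_bound\<close> is of order d, and
  disappears after division by d.\<close>

lemma integral_frob_sq_Mm_approx:
  "\<bar>(\<integral> \<omega>. frob_sq (Mm \<omega>) \<partial>\<Omega>) - ((\<integral> \<omega>. tr (Mm \<omega>) \<partial>\<Omega>) - l * real n * (\<integral> \<omega>. noise_term \<omega> \<partial>\<Omega>)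
      + (real d - real p) * (\<integral> \<omega>. noise_term \<omega> \<partial>\<Omega>))\<bar>
    \<le> sqrt (\<kappa> * real d) / l + (sqrt (\<kappa> * (1 / l ^ 4 * gram_bound)) + sqrt (\<kappa> * (1 / l\<^sup>2 * gram_bound)) / l)"
proof -
  let ?f = "\<lambda>\<omega>. frob_sq (Mm \<omega>) - (tr (Mm \<omega>) - l * real n * noise_term \<omega> + (real d - real p) * noise_term \<omega>)"
  let ?h = "\<lambda>i \<omega>. \<bar>quad_dev i Qz \<omega>\<bar> / l + (\<bar>quad_dev i C2z \<omega>\<bar> + \<bar>quad_dev i C1z \<omega>\<bar> / l)"
  let ?g = "\<lambda>\<omega>. (\<Sum>i<n. ?h i \<omega>) / real n"
  have hi: "integrable \<Omega> (?h i)" if "i < n" for i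
    using that by (intro Bochner_Integration.integrable_add integrable_divide integrable_abs
        quad_dev_Qz quad_dev_C1z quad_dev_C2z)
  have gi: "integrable \<Omega> ?g"
    by (intro integrable_divide Bochner_Integration.integrable_sum hi) auto
  have fi: "integrable \<Omega> ?f"
    using frob_sq_Mm tr_Mm_integrable noise_term_integrable by simp
  have le: "AE \<omega> in \<Omega>. \<bar>?f \<omega>\<bar> \<le> ?g \<omega>"
    using AE_ridge_orth by eventually_elim (rule frob_sq_Mm_approx)
  have "(\<integral> \<omega>. frob_sq (Mm \<omega>) \<partial>\<Omega>) - ((\<integral> \<omega>. tr (Mm \<omega>) \<partial>\<Omega>) - l * real n * (\<integral> \<omega>. noise_term \<omega> \<partial>\<Omega>)
      + (real d - real p) * (\<integral> \<omega>. noise_term \<omega> \<partial>\<Omega>)) = (\<integral> \<omega>. ?f \<omega> \<partial>\<Omega>)"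
    using frob_sq_Mm tr_Mm_integrable noise_term_integrable by simp
  then have "\<bar>(\<integral> \<omega>. frob_sq (Mm \<omega>) \<partial>\<Omega>) - ((\<integral> \<omega>. tr (Mm \<omega>) \<partial>\<Omega>) - l * real n * (\<integral> \<omega>. noise_term \<omega> \<partial>\<Omega>)
      + (real d - real p) * (\<integral> \<omega>. noise_term \<omega> \<partial>\<Omega>))\<bar> \<le> (\<integral> \<omega>. \<bar>?f \<omega>\<bar> \<partial>\<Omega>)"
    by (simp only: integral_abs_bound)
  also have "\<dots> \<le> (\<integral> \<omega>. ?g \<omega> \<partial>\<Omega>)"
    by (rule integral_mono_AE[OF integrable_abs[OF fi] gi le])
  also have "\<dots> = (\<integral> \<omega>. (\<Sum>i<n. ?h i \<omega>) \<partial>\<Omega>) / real n" by (rule integral_divide_zero)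
  also have "(\<integral> \<omega>. (\<Sum>i<n. ?h i \<omega>) \<partial>\<Omega>) = (\<Sum>i<n. \<integral> \<omega>. ?h i \<omega> \<partial>\<Omega>)"
    by (rule Bochner_Integration.integral_sum) (simp add: hi)
  also have "\<dots> / real n \<le> (\<Sum>i<n. sqrt (\<kappa> * real d) / l +
      (sqrt (\<kappa> * (1 / l ^ 4 * gram_bound)) + sqrt (\<kappa> * (1 / l\<^sup>2 * gram_bound)) / l)) / real n"
  proof (intro divide_right_mono sum_mono)
    fix i assume "i \<in> {..<n}"
    then have i: "i < n" by simp
    have "(\<integral> \<omega>. ?h i \<omega> \<partial>\<Omega>) = (\<integral> \<omega>. \<bar>quad_dev i Qz \<omega>\<bar> / l \<partial>\<Omega>) +
        (\<integral> \<omega>. \<bar>quad_dev i C2z \<omega>\<bar> + \<bar>quad_dev i C1z \<omega>\<bar> / l \<partial>\<Omega>)"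
      using i by (intro Bochner_Integration.integral_add Bochner_Integration.integrable_add integrable_divide
          integrable_abs quad_dev_Qz quad_dev_C1z quad_dev_C2z)
    also have "(\<integral> \<omega>. \<bar>quad_dev i C2z \<omega>\<bar> + \<bar>quad_dev i C1z \<omega>\<bar> / l \<partial>\<Omega>) =
        (\<integral> \<omega>. \<bar>quad_dev i C2z \<omega>\<bar> \<partial>\<Omega>) + (\<integral> \<omega>. \<bar>quad_dev i C1z \<omega>\<bar> / l \<partial>\<Omega>)"
      using i by (intro Bochner_Integration.integral_add integrable_divide integrable_abs quad_dev_C1z quad_dev_C2z)
    finally show "(\<integral> \<omega>. ?h i \<omega> \<partial>\<Omega>) \<le> sqrt (\<kappa> * real d) / l +
      (sqrt (\<kappa> * (1 / l ^ 4 * gram_bound)) + sqrt (\<kappa> * (1 / l\<^sup>2 * gram_bound)) / l)"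
      using l by (simp only: integral_divide_zero)
        (intro add_mono divide_right_mono quad_dev_Qz quad_dev_C1z quad_dev_C2z i, auto)
  qed simp
  finally show ?thesis using n by simp
qed

lemma Mm_entry:
  assumes "j < d" "k < d"
  shows "integrable \<Omega> (\<lambda>\<omega>. (Mm \<omega> $$ (j, k))\<^sup>2)" "integrable \<Omega> (\<lambda>\<omega>. Mm \<omega> $$ (j, k))"
proof -
  note m = mat_measurable_entry[OF Mm_meas assms]
  have le: "(Mm \<omega> $$ (j, k))\<^sup>2 \<le> frob_sq (Mm \<omega>)" for \<omega>
  proof -
    have "(Mm \<omega> $$ (j, k))\<^sup>2 \<le> (\<Sum>k<d. (Mm \<omega> $$ (j, k))\<^sup>2)"
      using assms by (intro member_le_sum) auto
    also have "\<dots> \<le> (\<Sum>j<d. \<Sum>k<d. (Mm \<omega> $$ (j, k))\<^sup>2)"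
      using assms by (intro member_le_sum[of j _ "\<lambda>j. \<Sum>k<d. (Mm \<omega> $$ (j, k))\<^sup>2"]) (auto intro: sum_nonneg)
    finally show ?thesis by (simp add: frob_sq_eq[OF Mm_carrier])
  qed
  show sq: "integrable \<Omega> (\<lambda>\<omega>. (Mm \<omega> $$ (j, k))\<^sup>2)"
    by (rule Bochner_Integration.integrable_bound[OF frob_sq_Mm])
      (use m le frob_sq_nonneg in \<open>auto intro: borel_measurable_power\<close>)
  show "integrable \<Omega> (\<lambda>\<omega>. Mm \<omega> $$ (j, k))"
    by (rule MXN.square_integrable_imp_integrable[OF m sq])
qed

text \<open>The test vector whose quadratic form adds up all entries of \<open>M\<close> and thereby
  detects a constant off-diagonal part.\<close>

definition one_vec :: "real Matrix.vec" where "one_vec = Matrix.vec d (\<lambda>_. 1)"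

lemma one_vec [simp]: "one_vec \<in> carrier_vec d" by (simp add: one_vec_def)

lemma quad_one: "scalar_prod one_vec (Mm \<omega> *\<^sub>v one_vec) = (\<Sum>j<d. \<Sum>k<d. Mm \<omega> $$ (j, k))"
proof -
  have o: "one_vec $ j = 1" if "j < d" for j using that by (simp add: one_vec_def)
  have "scalar_prod one_vec (Mm \<omega> *\<^sub>v one_vec) = (\<Sum>j<d. one_vec $ j * (Mm \<omega> *\<^sub>v one_vec) $ j)"
    by (intro scalar_prod_sum mult_mat_vec_carrier[of _ d d]) simp_all
  also have "\<dots> = (\<Sum>j<d. \<Sum>k<d. Mm \<omega> $$ (j, k))"
    by (intro sum.cong refl) (simp add: index_mult_mat_vec_sum[OF Mm_carrier one_vec] o del: index_mult_mat_vec)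
  finally show ?thesis .
qed

text \<open>A bound linear in d is what is wanted: the sum has d(d-1) off-diagonal terms with a
  common mean, which is therefore of order 1/d. Both linear forms in \<open>quad_Mm_le\<close> have
  second moment of order d.\<close>

lemma integral_quad_one_le:
  "\<bar>\<integral> \<omega>. scalar_prod one_vec (Mm \<omega> *\<^sub>v one_vec) \<partial>\<Omega>\<bar> \<le> real d / l"
proof -
  let ?Y = "\<lambda>i \<omega>. scalar_prod (Az (clear_row i (fst \<omega>)) (snd \<omega>) *\<^sub>v one_vec) (Matrix.row (Xm \<omega>) i)"
  let ?Z = "\<lambda>i \<omega>. scalar_prod (Matrix.row (Xm \<omega>) i) one_vec"
  note Ac = mat_measurable_carrier[OF Az_meas]
  have Av [measurable]: "(\<lambda>\<omega>. (Az (clear_row i (fst \<omega>)) (snd \<omega>) *\<^sub>v one_vec) $ j) \<in> borel_measurable \<Omega>" if "j < d" for i j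
  proof -
    have "(\<lambda>\<omega>. (Az (clear_row i (fst \<omega>)) (snd \<omega>) *\<^sub>v one_vec) $ j) = (\<lambda>\<omega>. \<Sum>k<d. Az (clear_row i (fst \<omega>)) (snd \<omega>) $$ (j, k) * one_vec $ k)"
      using that by (intro ext index_mult_mat_vec_sum[of _ d d] Ac) auto
    also have "\<dots> \<in> borel_measurable \<Omega>"
      using that by (intro borel_measurable_sum borel_measurable_times mat_measurable_entry[OF Az_meas] borel_measurable_const) auto
    finally show ?thesis .
  qed
  have Y: "?Y i \<omega> = (\<Sum>j<d. (Az (clear_row i (fst \<omega>)) (snd \<omega>) *\<^sub>v one_vec) $ j * fst \<omega> (i, j))" if "i < n" for i \<omega>
    using that by (subst scalar_prod_sum[of _ d]) (simp_all add: row_Xm del: index_mult_mat_vec)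
  have Z: "?Z i \<omega> = (\<Sum>j<d. 1 * fst \<omega> (i, j))" if "i < n" for i \<omega>
    using that by (subst scalar_prod_sum[of _ d]) (simp_all add: row_Xm one_vec_def)
  have Ym: "?Y i \<in> borel_measurable \<Omega>" and Zm: "?Z i \<in> borel_measurable \<Omega>" if i: "i < n" for i
    unfolding Y[OF i] Z[OF i] using i by measurable
  have one: "scalar_prod one_vec one_vec = real d"
    by (simp add: scalar_prod_sum[of _ d]) (simp add: one_vec_def)
  have Y2: "(\<integral>\<^sup>+ \<omega>. ennreal ((?Y i \<omega>)\<^sup>2) \<partial>\<Omega>) \<le> ennreal (1 / l\<^sup>2 * real d)" if i: "i < n" for i
  proof -
    have "(\<integral>\<^sup>+ \<omega>. ennreal ((?Y i \<omega>)\<^sup>2) \<partial>\<Omega>) \<le> (\<integral>\<^sup>+ \<omega>. ennreal (\<Sum>j<d. ((Az (clear_row i (fst \<omega>)) (snd \<omega>) *\<^sub>v one_vec) $ j)\<^sup>2) \<partial>\<Omega>)"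
      unfolding Y[OF i] by (rule nn_integral_row_linear_le[OF i, of "\<lambda>X w j. (Az X w *\<^sub>v one_vec) $ j"]) measurable
    also have "\<dots> \<le> (\<integral>\<^sup>+ \<omega>. ennreal (1 / l\<^sup>2 * real d) \<partial>\<Omega>)"
    proof (rule nn_integral_mono_AE)
      show "AE \<omega> in \<Omega>. ennreal (\<Sum>j<d. ((Az (clear_row i (fst \<omega>)) (snd \<omega>) *\<^sub>v one_vec) $ j)\<^sup>2) \<le> ennreal (1 / l\<^sup>2 * real d)"
        using AE_ridge_orth
      proof eventually_elim
        fix \<omega> assume ro: "ridge_orth d n p l (Wm \<omega>) (Xm \<omega>)"
        let ?v = "Az (clear_row i (fst \<omega>)) (snd \<omega>) *\<^sub>v one_vec"
        have "(\<Sum>j<d. (?v $ j)\<^sup>2) = scalar_prod ?v ?v"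
          using Ac by (subst scalar_prod_sum[of _ d]) (auto simp: power2_eq_square intro: mult_mat_vec_carrier[of _ d d])
        also have "\<dots> \<le> 1 / l\<^sup>2 * real d" using sq_Az_le[OF ro one_vec] unfolding one .
        finally show "ennreal (\<Sum>j<d. (?v $ j)\<^sup>2) \<le> ennreal (1 / l\<^sup>2 * real d)" by (rule ennreal_leI)
      qed
    qed
    finally show ?thesis by (simp add: MXN.emeasure_space_1)
  qed
  have Z2: "(\<integral>\<^sup>+ \<omega>. ennreal ((?Z i \<omega>)\<^sup>2) \<partial>\<Omega>) \<le> ennreal (real d)" if i: "i < n" for i
  proof -
    have "(\<integral>\<^sup>+ \<omega>. ennreal ((?Z i \<omega>)\<^sup>2) \<partial>\<Omega>) \<le> (\<integral>\<^sup>+ \<omega>. ennreal (\<Sum>j<d. (1::real)\<^sup>2) \<partial>\<Omega>)"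
      unfolding Z[OF i] by (rule nn_integral_row_linear_le[OF i, of "\<lambda>X w j. 1"]) measurable
    then show ?thesis by (simp add: MXN.emeasure_space_1)
  qed
  have c0: "0 \<le> 1 / l\<^sup>2 * real d" "0 \<le> real d" by simp_all
  note Y' = MXN.L1_le_of_nn_integral_sq[OF Ym c0(1) Y2] and Z' = MXN.L1_le_of_nn_integral_sq[OF Zm c0(2) Z2]
  \<comment> \<open>The weight \<open>l\<close> balances the second moments, \<open>d / l^2\<close>
    for \<open>?Y\<close> and \<open>d\<close> for \<open>?Z\<close>: each half contributes
    \<open>d / (2 l)\<close>.\<close>
  let ?h = "\<lambda>i \<omega>. (l * (?Y i \<omega>)\<^sup>2 + (?Z i \<omega>)\<^sup>2 / l) / 2"
  have hi: "integrable \<Omega> (?h i)" if "i < n" for i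
    using Y'(2)[OF that that] Z'(2)[OF that that] by simp
  have hle: "(\<integral> \<omega>. ?h i \<omega> \<partial>\<Omega>) \<le> real d / l" if i: "i < n" for i
  proof -
    have "(\<integral> \<omega>. ?h i \<omega> \<partial>\<Omega>) = (l * (\<integral> \<omega>. (?Y i \<omega>)\<^sup>2 \<partial>\<Omega>) + (\<integral> \<omega>. (?Z i \<omega>)\<^sup>2 \<partial>\<Omega>) / l) / 2"
      using Y'(2)[OF i i] Z'(2)[OF i i] by simp
    also have "\<dots> \<le> (l * (1 / l\<^sup>2 * real d) + real d / l) / 2"
      using Y'(3)[OF i i] Z'(3)[OF i i] l by (intro divide_right_mono add_mono mult_left_mono) auto
    also have "\<dots> = real d / l" using l by (simp add: power2_eq_square field_simps)
    finally show ?thesis .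
  qed
  have le: "AE \<omega> in \<Omega>. \<bar>scalar_prod one_vec (Mm \<omega> *\<^sub>v one_vec)\<bar> \<le> (\<Sum>i<n. ?h i \<omega>) / real n"
    using AE_ridge_orth
  proof eventually_elim
    fix \<omega> assume ro: "ridge_orth d n p l (Wm \<omega>) (Xm \<omega>)"
    have amgm: "\<bar>y\<bar> * \<bar>z\<bar> \<le> (l * y\<^sup>2 + z\<^sup>2 / l) / 2" for y z
    proof -
      have "0 \<le> (l * \<bar>y\<bar> - \<bar>z\<bar>)\<^sup>2 / l" using l by simp
      also have "(l * \<bar>y\<bar> - \<bar>z\<bar>)\<^sup>2 / l = l * y\<^sup>2 + z\<^sup>2 / l - 2 * (\<bar>y\<bar> * \<bar>z\<bar>)"
        using l by (simp add: power2_diff power_mult_distrib field_simps power2_eq_square)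
      finally show ?thesis by simp
    qed
    show "\<bar>scalar_prod one_vec (Mm \<omega> *\<^sub>v one_vec)\<bar> \<le> (\<Sum>i<n. ?h i \<omega>) / real n"
      by (rule order_trans[OF quad_Mm_le[OF ro one_vec]]) (intro divide_right_mono sum_mono amgm, simp)
  qed
  have "\<bar>\<integral> \<omega>. scalar_prod one_vec (Mm \<omega> *\<^sub>v one_vec) \<partial>\<Omega>\<bar> \<le> (\<integral> \<omega>. (\<Sum>i<n. ?h i \<omega>) / real n \<partial>\<Omega>)"
  proof -
    have fi: "integrable \<Omega> (\<lambda>\<omega>. scalar_prod one_vec (Mm \<omega> *\<^sub>v one_vec))"
      unfolding quad_one by (intro Bochner_Integration.integrable_sum Mm_entry) auto
    have "\<bar>\<integral> \<omega>. scalar_prod one_vec (Mm \<omega> *\<^sub>v one_vec) \<partial>\<Omega>\<bar> \<le> (\<integral> \<omega>. \<bar>scalar_prod one_vec (Mm \<omega> *\<^sub>v one_vec)\<bar> \<partial>\<Omega>)"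
      by (rule integral_abs_bound)
    also have "\<dots> \<le> (\<integral> \<omega>. (\<Sum>i<n. ?h i \<omega>) / real n \<partial>\<Omega>)"
      by (intro integral_mono_AE integrable_abs fi le integrable_divide Bochner_Integration.integrable_sum hi) simp
    finally show ?thesis .
  qed
  also have "\<dots> = (\<integral> \<omega>. (\<Sum>i<n. ?h i \<omega>) \<partial>\<Omega>) / real n" by (rule integral_divide_zero)
  also have "(\<integral> \<omega>. (\<Sum>i<n. ?h i \<omega>) \<partial>\<Omega>) = (\<Sum>i<n. \<integral> \<omega>. ?h i \<omega> \<partial>\<Omega>)"
    by (rule Bochner_Integration.integral_sum) (simp add: hi)
  also have "\<dots> / real n \<le> (\<Sum>i<n. real d / l) / real n"
    by (intro divide_right_mono sum_mono hle) auto
  also have "\<dots> = real d / l" using n by simp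
  finally show ?thesis .
qed

end

section \<open>Permutation invariance\<close>

lemma mult_orth_cancel:
  fixes U :: "real Matrix.mat"
  assumes Y: "Y \<in> carrier_mat m d" and Z: "Z \<in> carrier_mat k d" and U: "U \<in> carrier_mat d d"
    and orth: "U * transpose_mat U = 1\<^sub>m d"
  shows "(Y * U) * transpose_mat (Z * U) = Y * transpose_mat Z"
proof -
  have UT: "transpose_mat U \<in> carrier_mat d d" and ZT: "transpose_mat Z \<in> carrier_mat d k" using U Z by auto
  have "(Y * U) * transpose_mat (Z * U) = (Y * U) * (transpose_mat U * transpose_mat Z)"
    by (simp only: transpose_mult[OF Z U])
  also have "\<dots> = Y * (U * (transpose_mat U * transpose_mat Z))"
    by (rule assoc_mult_mat[OF Y U mult_carrier_mat[OF UT ZT]])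
  also have "U * (transpose_mat U * transpose_mat Z) = U * transpose_mat U * transpose_mat Z"
    by (rule assoc_mult_mat[OF U UT ZT, symmetric])
  also have "\<dots> = transpose_mat Z" unfolding orth by (rule left_mult_one_mat[OF ZT])
  finally show ?thesis .
qed

text \<open>Rotating \<open>W\<close> and \<open>X\<close> together leaves \<open>W X^T\<close>, and
  hence the ridge matrix, unchanged; only the outer factors pick up \<open>U\<close>.\<close>

lemma resol_gram_conj:
  fixes U :: "real Matrix.mat"
  assumes W: "W \<in> carrier_mat p d" and X: "X \<in> carrier_mat n d" and U: "U \<in> carrier_mat d d"
    and orth: "U * transpose_mat U = 1\<^sub>m d" and n: "0 < n" and l: "0 < l"
  shows "resol l (W * U) (X * U) * gram (X * U) = transpose_mat U * (resol l W X * gram X) * U"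
proof -
  interpret R: ridge d n p l W X using W X n l by unfold_locales
  have WU: "W * U \<in> carrier_mat p d" and XU: "X * U \<in> carrier_mat n d" and UT: "transpose_mat U \<in> carrier_mat d d"
    using W X U by auto
  interpret RU: ridge d n p l "W * U" "X * U" using WU XU n l by unfold_locales
  have eq: "ridge_matrix l (W * U) (X * U) = ridge_matrix l W X"
    unfolding ridge_matrix_def R.W_XT_X_WT RU.W_XT_X_WT
    unfolding mult_orth_cancel[OF W X U orth] using W X U by simp
  obtain I where I: "the (mat_inverse (ridge_matrix l W X)) = I" "I \<in> carrier_mat p p"
    by (rule R.mat_inverse_ridge) auto
  have IW: "I * W \<in> carrier_mat p d" by (rule mult_carrier_mat[OF I(2) W])
  have WT: "transpose_mat W \<in> carrier_mat d p" using W by simp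
  have A: "resol l W X = transpose_mat W * (I * W)" by (simp add: resol_def I)
  have Ac: "transpose_mat W * (I * W) \<in> carrier_mat d d" by (rule mult_carrier_mat[OF WT IW])
  have "resol l (W * U) (X * U) = transpose_mat (W * U) * (I * (W * U))"
    by (simp only: resol_def eq I)
  also have "\<dots> = transpose_mat U * transpose_mat W * (I * W * U)"
    by (simp only: transpose_mult[OF W U] assoc_mult_mat[OF I(2) W U])
  also have "\<dots> = transpose_mat U * (transpose_mat W * (I * W * U))"
    by (rule assoc_mult_mat[OF UT WT mult_carrier_mat[OF IW U]])
  also have "transpose_mat W * (I * W * U) = transpose_mat W * (I * W) * U"
    by (rule assoc_mult_mat[OF WT IW U, symmetric])
  finally have 1: "resol l (W * U) (X * U) = transpose_mat U * (resol l W X * U)" unfolding A .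
  have XT: "transpose_mat X \<in> carrier_mat d n" using X by simp
  have XX: "transpose_mat X * X \<in> carrier_mat d d" by (rule mult_carrier_mat[OF XT X])
  have "transpose_mat (X * U) * (X * U) = transpose_mat U * transpose_mat X * (X * U)"
    by (simp only: transpose_mult[OF X U])
  also have "\<dots> = transpose_mat U * (transpose_mat X * (X * U))"
    by (rule assoc_mult_mat[OF UT XT mult_carrier_mat[OF X U]])
  also have "transpose_mat X * (X * U) = transpose_mat X * X * U"
    by (rule assoc_mult_mat[OF XT X U, symmetric])
  finally have "gram (X * U) = (1 / real n) \<cdot>\<^sub>m (transpose_mat U * (transpose_mat X * X * U))"
    using X U by (simp add: gram_def del: assoc_mult_mat)
  also have "\<dots> = transpose_mat U * ((1 / real n) \<cdot>\<^sub>m (transpose_mat X * X * U))"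
    by (rule mult_smult_distrib[symmetric, OF UT mult_carrier_mat[OF XX U]])
  also have "(1 / real n) \<cdot>\<^sub>m (transpose_mat X * X * U) = gram X * U"
    using X mult_smult_assoc_mat[OF XX U, of "1 / real n"] by (simp add: gram_def del: assoc_mult_mat)
  finally have 2: "gram (X * U) = transpose_mat U * (gram X * U)" .
  let ?A = "resol l W X" and ?S = "gram X"
  have A': "?A \<in> carrier_mat d d" and S': "?S \<in> carrier_mat d d" using R.resol_carrier X by auto
  have AU: "?A * U \<in> carrier_mat d d" and SU: "?S * U \<in> carrier_mat d d"
    by (rule mult_carrier_mat[OF A' U] mult_carrier_mat[OF S' U])+
  have "resol l (W * U) (X * U) * gram (X * U) = transpose_mat U * (?A * U) * (transpose_mat U * (?S * U))"
    by (simp only: 1 2)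
  also have "\<dots> = transpose_mat U * (?A * U * (transpose_mat U * (?S * U)))"
    by (rule assoc_mult_mat[OF UT AU mult_carrier_mat[OF UT SU]])
  also have "?A * U * (transpose_mat U * (?S * U)) = ?A * (U * (transpose_mat U * (?S * U)))"
    by (rule assoc_mult_mat[OF A' U mult_carrier_mat[OF UT SU]])
  also have "U * (transpose_mat U * (?S * U)) = U * transpose_mat U * (?S * U)"
    by (rule assoc_mult_mat[OF U UT SU, symmetric])
  also have "\<dots> = ?S * U" unfolding orth by (rule left_mult_one_mat[OF SU])
  also have "?A * (?S * U) = ?A * ?S * U" by (rule assoc_mult_mat[OF A' S' U, symmetric])
  also have "transpose_mat U * (?A * ?S * U) = transpose_mat U * (?A * ?S) * U"
    by (rule assoc_mult_mat[OF UT mult_carrier_mat[OF A' S'] U, symmetric])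
  finally show ?thesis .
qed

text \<open>The convention is chosen so that multiplication on the right reads column
  \<open>\<tau> j\<close> into column \<open>j\<close>.\<close>

definition perm_mat :: "nat \<Rightarrow> (nat \<Rightarrow> nat) \<Rightarrow> real Matrix.mat" where
  "perm_mat d \<tau> = Matrix.mat d d (\<lambda>(i, j). if i = \<tau> j then 1 else 0)"

lemma perm_mat_carrier [simp]: "perm_mat d \<tau> \<in> carrier_mat d d"
  by (simp add: perm_mat_def)

lemma mult_perm_mat_index:
  assumes Y: "Y \<in> carrier_mat m d" and \<tau>: "\<tau> permutes {..<d}" and a: "a < m" and j: "j < d"
  shows "(Y * perm_mat d \<tau>) $$ (a, j) = Y $$ (a, \<tau> j)"
proof -
  have \<tau>j: "\<tau> j < d" using permutes_in_image[OF \<tau>, of j] j by simp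
  have "(Y * perm_mat d \<tau>) $$ (a, j) = (\<Sum>k<d. Y $$ (a, k) * perm_mat d \<tau> $$ (k, j))"
    by (rule index_mult_mat_sum[OF Y perm_mat_carrier a j])
  also have "\<dots> = (\<Sum>k<d. if k = \<tau> j then Y $$ (a, k) else 0)"
    using j by (intro sum.cong) (auto simp: perm_mat_def)
  also have "\<dots> = Y $$ (a, \<tau> j)" using \<tau>j by simp
  finally show ?thesis .
qed

lemma perm_mat_orth:
  assumes \<tau>: "\<tau> permutes {..<d}"
  shows "perm_mat d \<tau> * transpose_mat (perm_mat d \<tau>) = 1\<^sub>m d"
proof (rule eq_matI)
  fix i j assume "i < dim_row (1\<^sub>m d :: real Matrix.mat)" "j < dim_col (1\<^sub>m d :: real Matrix.mat)"
  then have ij: "i < d" "j < d" by auto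
  have "(perm_mat d \<tau> * transpose_mat (perm_mat d \<tau>)) $$ (i, j)
      = (\<Sum>k<d. perm_mat d \<tau> $$ (i, k) * transpose_mat (perm_mat d \<tau>) $$ (k, j))"
    using ij by (intro index_mult_mat_sum[of _ d d _ d]) auto
  also have "\<dots> = (\<Sum>k<d. (\<lambda>r. if i = r \<and> j = r then 1 else 0) (\<tau> k))"
    using ij by (intro sum.cong) (auto simp: perm_mat_def)
  also have "\<dots> = (\<Sum>r<d. if i = r \<and> j = r then 1 else 0)"
    by (rule sum.permute[OF \<tau>, unfolded comp_def, symmetric])
  also have "\<dots> = 1\<^sub>m d $$ (i, j)"
  proof (cases "i = j")
    case False
    then have "(\<Sum>r<d. if i = r \<and> j = r then 1 else 0) = (\<Sum>r<d. 0 :: real)" by (intro sum.cong) auto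
    then show ?thesis using ij False by simp
  qed (use ij in auto)
  finally show "(perm_mat d \<tau> * transpose_mat (perm_mat d \<tau>)) $$ (i, j) = 1\<^sub>m d $$ (i, j)" .
qed (auto simp: perm_mat_def)

lemma perm_mat_conj_index:
  assumes B: "B \<in> carrier_mat d d" and \<tau>: "\<tau> permutes {..<d}" and j: "j < d" and k: "k < d"
  shows "(transpose_mat (perm_mat d \<tau>) * B * perm_mat d \<tau>) $$ (j, k) = B $$ (\<tau> j, \<tau> k)"
proof -
  have \<tau>k: "\<tau> k < d" using permutes_in_image[OF \<tau>, of k] k by simp
  have UB: "transpose_mat (perm_mat d \<tau>) * B \<in> carrier_mat d d"
    by (rule mult_carrier_mat[of _ d d]) (simp_all add: B)
  have "(transpose_mat (perm_mat d \<tau>) * B * perm_mat d \<tau>) $$ (j, k) = (transpose_mat (perm_mat d \<tau>) * B) $$ (j, \<tau> k)"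
    by (rule mult_perm_mat_index[OF UB \<tau> j k])
  also have "\<dots> = (transpose_mat (transpose_mat B * perm_mat d \<tau>)) $$ (j, \<tau> k)"
    using transpose_mult[of "transpose_mat B" d d "perm_mat d \<tau>" d] B by simp
  also have "\<dots> = (transpose_mat B * perm_mat d \<tau>) $$ (\<tau> k, j)"
    using B \<tau>k j by (intro index_transpose_mat) (auto simp: perm_mat_def)
  also have "\<dots> = transpose_mat B $$ (\<tau> k, \<tau> j)"
    using B by (intro mult_perm_mat_index[OF _ \<tau> \<tau>k j]) auto
  also have "\<dots> = B $$ (\<tau> j, \<tau> k)"
    using B \<tau>k permutes_in_image[OF \<tau>, of j] j by simp
  finally show ?thesis .
qed

section \<open>The shape of the mean matrix\<close>

locale haar_law = sketch_law \<mu> N n d p l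
  for \<mu> :: "real measure" and N :: "(nat \<times> nat \<Rightarrow> real) measure" and n d p :: nat and l :: real +
  assumes inv: "\<And>U. U \<in> carrier_mat d d \<Longrightarrow> U * transpose_mat U = 1\<^sub>m d \<Longrightarrow>
      distr N N (\<lambda>w. restrict (\<lambda>ij. (Matrix.mat p d w * U) $$ ij) ({..<p} \<times> {..<d})) = N"
    and p_le: "p \<le> d"
begin

definition EM :: "nat \<Rightarrow> nat \<Rightarrow> real" where
  "EM j k = (\<integral> \<omega>. Mm \<omega> $$ (j, k) \<partial>\<Omega>)"

text \<open>Permuting the columns of \<open>X\<close> and of \<open>W\<close> simultaneously
  preserves the joint law, since the entries of \<open>X\<close> are i.i.d. and permutation matrices
  are orthogonal, while it conjugates \<open>M\<close> by the permutation.\<close>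

lemma EM_perm:
  assumes \<tau>: "\<tau> permutes {..<d}" and jk: "j < d" "k < d"
  shows "EM j k = EM (\<tau> j) (\<tau> k)"
proof -
  let ?RX = "{..<n} \<times> {..<d}" and ?RW = "{..<p} \<times> {..<d}" and ?U = "perm_mat d \<tau>"
  define f where "f = (\<lambda>(i :: nat, j). (i, \<tau> j))"
  define TX where "TX = (\<lambda>X :: nat \<times> nat \<Rightarrow> real. \<lambda>a\<in>?RX. X (f a))"
  define TW where "TW = (\<lambda>w. restrict (\<lambda>ij. (Matrix.mat p d w * ?U) $$ ij) ?RW)"
  have \<tau>d: "\<tau> j < d" if "j < d" for j using permutes_in_image[OF \<tau>, of j] that by simp
  have f: "inj_on f ?RX" "f \<in> ?RX \<rightarrow> ?RX"
    using permutes_inj[OF \<tau>] \<tau>d by (auto simp: f_def inj_on_def dest: injD)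
  have dX: "distr MX MX TX = MX"
    unfolding iid_mat_def TX_def using distr_PiM_reindex[OF _ f, of "\<lambda>_. \<mu>"] prob_space_axioms by simp
  have dW: "distr N N TW = N"
    unfolding TW_def by (rule inv[OF perm_mat_carrier perm_mat_orth[OF \<tau>]])
  have mX: "TX \<in> measurable MX MX"
    unfolding TX_def iid_mat_def using f(2)
    by (intro measurable_restrict measurable_component_singleton) auto
  have TW_eq: "TW w = (\<lambda>(a, j)\<in>?RW. w (a, \<tau> j))" for w
  proof -
    have "(Matrix.mat p d w * ?U) $$ (a, j) = w (a, \<tau> j)" if "a < p" "j < d" for a j
      using mult_perm_mat_index[OF mat_carrier \<tau> that, of w] \<tau>d that by simp
    then show ?thesis unfolding TW_def by (intro restrict_ext) auto
  qed
  have mW: "TW \<in> measurable N N"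
  proof -
    have "TW \<in> measurable (PiM ?RW (\<lambda>_. borel)) (PiM ?RW (\<lambda>_. borel))"
      unfolding TW_eq by (rule measurable_restrict) (auto intro!: measurable_component_singleton \<tau>d)
    then show ?thesis by (simp add: measurable_cong_sets[OF sets_N sets_N])
  qed
  have dT: "distr \<Omega> \<Omega> (\<lambda>(X, w). (TX X, TW w)) = \<Omega>"
    using pair_measure_distr[OF mX mW] N.sigma_finite_measure_axioms unfolding dX dW by simp
  have mT: "(\<lambda>(X, w). (TX X, TW w)) \<in> measurable \<Omega> \<Omega>"
    using mX mW by measurable
  have Xm: "Xm (TX X, w) = Matrix.mat n d X * ?U" for X w
  proof (rule eq_matI)
    fix i j assume "i < dim_row (Matrix.mat n d X * ?U)" "j < dim_col (Matrix.mat n d X * ?U)"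
    then have ij: "i < n" "j < d" by (auto simp: perm_mat_def)
    then show "Xm (TX X, w) $$ (i, j) = (Matrix.mat n d X * ?U) $$ (i, j)"
      unfolding mult_perm_mat_index[OF mat_carrier \<tau> ij] using \<tau>d by (simp add: Xm_def TX_def f_def)
  qed (auto simp: Xm_def perm_mat_def)
  have Wm: "Wm (X, TW w) = Matrix.mat p d w * ?U" for X w
    unfolding Wm_def by (intro eq_matI) (auto simp: TW_def perm_mat_def)
  have Mm: "Mm (TX X, TW w) $$ (j, k) = Mm (X, w) $$ (\<tau> j, \<tau> k)" for X w
  proof -
    have "Mm (TX X, TW w) = transpose_mat ?U * Mm (X, w) * ?U"
      unfolding Mm_def Am_def Xm Wm
      by (subst resol_gram_conj[of _ p d _ n, OF _ _ _ perm_mat_orth[OF \<tau>] n l]) (auto simp: Xm_def Wm_def)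
    then show ?thesis using perm_mat_conj_index[OF Mm_carrier \<tau> jk] by simp
  qed
  have "EM j k = (\<integral> \<omega>. Mm \<omega> $$ (j, k) \<partial>distr \<Omega> \<Omega> (\<lambda>(X, w). (TX X, TW w)))"
    unfolding EM_def dT ..
  also have "\<dots> = (\<integral> \<omega>. Mm ((\<lambda>(X, w). (TX X, TW w)) \<omega>) $$ (j, k) \<partial>\<Omega>)"
    by (rule integral_distr[OF mT mat_measurable_entry[OF Mm_meas jk]])
  also have "\<dots> = EM (\<tau> j) (\<tau> k)"
    unfolding EM_def by (intro Bochner_Integration.integral_cong refl) (auto simp: Mm)
  finally show ?thesis .
qed

lemma EM_diag: "j < d \<Longrightarrow> EM j j = EM 0 0"
  using EM_perm[of "Transposition.transpose 0 j" j j] permutes_swap_id[of 0 "{..<d}" j] by simp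

lemma EM_off_diag:
  assumes "j < d" "k < d" "j \<noteq> k"
  shows "EM j k = EM 0 1"
proof -
  \<comment> \<open>The position of \<open>k\<close> after \<open>j\<close> has been moved to 0. It
    is not 0, so a second transposition, which fixes 0, carries it to 1.\<close>
  define k1 where "k1 = Transposition.transpose 0 j k"
  have k1: "k1 < d" "k1 \<noteq> 0" using assms by (auto simp: k1_def Transposition.transpose_def)
  have "EM j k = EM 0 k1"
    using EM_perm[of "Transposition.transpose 0 j" j k] permutes_swap_id[of 0 "{..<d}" j] assms
    by (simp add: k1_def)
  also have "\<dots> = EM (Transposition.transpose 1 k1 0) (Transposition.transpose 1 k1 k1)"
    using k1 by (intro EM_perm permutes_swap_id) auto
  also have "\<dots> = EM 0 1" using k1 by (simp add: Transposition.transpose_def)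
  finally show ?thesis .
qed

text \<open>The flag tells \<open>f\<close> whether an entry is diagonal, so one computation serves
  the sum of the entries, the sum of their squares and the squared distance to the identity.\<close>

lemma sum_EM:
  fixes f :: "bool \<Rightarrow> real \<Rightarrow> real"
  assumes "0 < d"
  shows "(\<Sum>j<d. \<Sum>k<d. f (j = k) (EM j k)) = real d * f True (EM 0 0) + real d * (real d - 1) * f False (EM 0 1)"
proof -
  have "(\<Sum>k<d. f (j = k) (EM j k)) = f True (EM 0 0) + (real d - 1) * f False (EM 0 1)" if j: "j < d" for j
  proof -
    have "(\<Sum>k<d. f (j = k) (EM j k)) = f True (EM j j) + (\<Sum>k\<in>{..<d} - {j}. f (j = k) (EM j k))"
      using j by (subst sum.remove[of _ j]) auto
    also have "(\<Sum>k\<in>{..<d} - {j}. f (j = k) (EM j k)) = (\<Sum>k\<in>{..<d} - {j}. f False (EM 0 1))"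
    proof (intro sum.cong refl)
      fix k assume "k \<in> {..<d} - {j}"
      then have k: "k < d" "j \<noteq> k" by auto
      show "f (j = k) (EM j k) = f False (EM 0 1)" using EM_off_diag[OF j k] k by simp
    qed
    finally show ?thesis using j EM_diag[OF j] by (simp add: of_nat_diff)
  qed
  then have "(\<Sum>j<d. \<Sum>k<d. f (j = k) (EM j k)) = (\<Sum>j<d. f True (EM 0 0) + (real d - 1) * f False (EM 0 1))"
    by (intro sum.cong) auto
  then show ?thesis by (simp add: algebra_simps)
qed

definition m :: real where "m = (\<integral> \<omega>. tr (Mm \<omega>) \<partial>\<Omega>) / real d"

lemma m_eq: "0 < d \<Longrightarrow> m = EM 0 0"
proof -
  assume d: "0 < d"
  have "(\<integral> \<omega>. tr (Mm \<omega>) \<partial>\<Omega>) = (\<Sum>j<d. EM j j)"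
    unfolding tr_eq[OF Mm_carrier] EM_def by (rule Bochner_Integration.integral_sum) (simp add: Mm_entry)
  also have "\<dots> = (\<Sum>j<d. EM 0 0)" by (intro sum.cong refl EM_diag) simp
  also have "\<dots> = real d * EM 0 0" by simp
  finally show ?thesis using d by (simp add: m_def)
qed

text \<open>Below by positivity of \<open>A\<close>, above because the trace of \<open>A S\<close>
  is \<open>p - l tr A\<close> in mean and \<open>p \<le> d\<close>.\<close>

lemma m_bounds: "0 \<le> m" "m \<le> 1"
proof -
  have "0 \<le> (\<integral> \<omega>. tr (Mm \<omega>) \<partial>\<Omega>)"
    using AE_ridge_orth by (intro integral_nonneg_AE) (auto elim!: eventually_mono intro: tr_Mm_nonneg)
  then show "0 \<le> m" by (simp add: m_def)
  have "(\<integral> \<omega>. tr (Mm \<omega>) \<partial>\<Omega>) \<le> real p"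
  proof -
    have "0 \<le> (\<integral> \<omega>. res_trace \<omega> \<partial>\<Omega>)"
      using AE_ridge_orth by (intro integral_nonneg_AE) (auto elim!: eventually_mono intro: res_trace_bounds)
    then show ?thesis unfolding integral_tr_Mm using l by simp
  qed
  also have "real p \<le> real d" using p_le by simp
  finally show "m \<le> 1" unfolding m_def by (cases "d = 0") (auto simp: divide_le_eq)
qed

text \<open>The mean of \<open>1 . M 1\<close> is \<open>d m + d (d - 1) EM 0 1\<close>. It is at
  most \<open>d / l\<close> in size and \<open>m\<close> lies between 0 and 1, so division by d
  isolates the off-diagonal entry.\<close>

lemma off_diag_diag_le:
  assumes d: "0 < d"
  shows "(real d - 1) * \<bar>EM 0 1\<bar> \<le> 1 / l + 1"
proof -
  have "(\<integral> \<omega>. scalar_prod one_vec (Mm \<omega> *\<^sub>v one_vec) \<partial>\<Omega>) = (\<Sum>j<d. \<Sum>k<d. EM j k)"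
    unfolding quad_one EM_def
  proof -
    have "(\<integral> \<omega>. (\<Sum>j<d. \<Sum>k<d. Mm \<omega> $$ (j, k)) \<partial>\<Omega>) = (\<Sum>j<d. \<integral> \<omega>. (\<Sum>k<d. Mm \<omega> $$ (j, k)) \<partial>\<Omega>)"
      by (intro Bochner_Integration.integral_sum Bochner_Integration.integrable_sum Mm_entry) auto
    also have "\<dots> = (\<Sum>j<d. \<Sum>k<d. \<integral> \<omega>. Mm \<omega> $$ (j, k) \<partial>\<Omega>)"
      by (intro sum.cong refl Bochner_Integration.integral_sum Mm_entry) auto
    finally show "(\<integral> \<omega>. (\<Sum>j<d. \<Sum>k<d. Mm \<omega> $$ (j, k)) \<partial>\<Omega>) = (\<Sum>j<d. \<Sum>k<d. \<integral> \<omega>. Mm \<omega> $$ (j, k) \<partial>\<Omega>)" .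
  qed
  also have "\<dots> = real d * m + real d * (real d - 1) * EM 0 1"
    using sum_EM[OF d, of "\<lambda>_ x. x"] m_eq[OF d] by simp
  also have "\<dots> = real d * (m + (real d - 1) * EM 0 1)" by (simp add: algebra_simps)
  finally have "real d * \<bar>m + (real d - 1) * EM 0 1\<bar> \<le> real d / l"
    using integral_quad_one_le by (simp add: abs_mult)
  then have "real d * \<bar>m + (real d - 1) * EM 0 1\<bar> \<le> real d * (1 / l)" by simp
  then have "\<bar>m + (real d - 1) * EM 0 1\<bar> \<le> 1 / l" using d by (simp only: mult_le_cancel_left_pos of_nat_0_less_iff)
  then have "\<bar>(real d - 1) * EM 0 1\<bar> \<le> 1 / l + 1" using m_bounds by linarith
  then show ?thesis using d by (simp add: abs_mult)
qed

text \<open>The squares of the d(d-1) equal off-diagonal entries of the mean matrix, summed and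
  divided by d.\<close>

definition off_diag :: real where "off_diag = (real d - 1) * (EM 0 1)\<^sup>2"

lemma off_diag_bounds:
  assumes "1 < d"
  shows "0 \<le> off_diag" "off_diag \<le> (1 / l + 1)\<^sup>2 / (real d - 1)"
proof -
  show "0 \<le> off_diag" unfolding off_diag_def using assms by simp
  have "((real d - 1) * \<bar>EM 0 1\<bar>)\<^sup>2 \<le> (1 / l + 1)\<^sup>2"
    using assms by (intro power_mono off_diag_diag_le) auto
  then show "off_diag \<le> (1 / l + 1)\<^sup>2 / (real d - 1)"
  proof -
    have "(real d - 1) * off_diag = ((real d - 1) * \<bar>EM 0 1\<bar>)\<^sup>2"
      by (simp add: off_diag_def power_mult_distrib power2_eq_square)
    with \<open>((real d - 1) * \<bar>EM 0 1\<bar>)\<^sup>2 \<le> (1 / l + 1)\<^sup>2\<close>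
    show ?thesis using assms by (simp add: pos_le_divide_eq mult.commute)
  qed
qed

lemma sum_EM_sq:
  assumes d: "0 < d"
  shows "(\<Sum>j<d. \<Sum>k<d. (EM j k)\<^sup>2) / real d = m\<^sup>2 + off_diag"
  using sum_EM[OF d, of "\<lambda>_ x. x\<^sup>2"] d by (simp add: m_eq[OF d] off_diag_def add_divide_distrib)

lemma sum_EM_minus_one_sq:
  assumes d: "0 < d"
  shows "(\<Sum>j<d. \<Sum>k<d. (EM j k - (if j = k then 1 else 0))\<^sup>2) / real d = (m - 1)\<^sup>2 + off_diag"
  using sum_EM[OF d, of "\<lambda>e x. (x - (if e then 1 else 0))\<^sup>2"] d
  by (simp add: m_eq[OF d] off_diag_def add_divide_distrib)

end

section \<open>Bias and variance as moments of the random matrices\<close>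

text \<open>Shared by the three sources of randomness to be integrated out: the entries of
  \<open>x\<close> (variance 1), of \<open>\<theta>\<close> (variance \<alpha>^2/d) and of the noise
  (variance \<sigma>^2).\<close>

locale centered = prob_space \<rho> for \<rho> :: "real measure" +
  fixes v :: real
  assumes sets_rho [measurable_cong, simp]: "sets \<rho> = sets borel"
    and first: "integrable \<rho> (\<lambda>t. t)" "expectation (\<lambda>t. t) = 0"
    and second: "integrable \<rho> (\<lambda>t. t\<^sup>2)" "expectation (\<lambda>t. t\<^sup>2) = v"
begin

lemma iid_vec_prob: "prob_space (iid_vec \<rho> k)"
  unfolding iid_vec_def by (rule prob_space_PiM) (rule prob_space_axioms)

text \<open>The monomial is written as a product over all coordinates, with factor 1 away from
  \<open>a\<close> and \<open>b\<close>, so that the product rule applies; for \<open>a = b\<close>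
  the two factors meet in one coordinate as a square.\<close>

lemma iid_vec_cross:
  assumes a: "a < k" and b: "b < k"
  shows "integrable (iid_vec \<rho> k) (\<lambda>z. z a * z b)"
    and "(\<integral> z. z a * z b \<partial>iid_vec \<rho> k) = (if a = b then v else 0)"
proof -
  interpret product_sigma_finite "\<lambda>_ :: nat. \<rho>" by unfold_locales
  let ?f = "\<lambda>i t. (if i = a then t else 1) * (if i = b then t else 1) :: real"
  have eq: "z a * z b = (\<Prod>i<k. ?f i (z i))" for z :: "nat \<Rightarrow> real"
  proof -
    have d: "(\<Prod>i<k. if i = c then z i else 1) = z c" if "c < k" for c
      using that prod.delta[of "{..<k}" c z] by simp
    show ?thesis unfolding prod.distrib d[OF a] d[OF b] ..
  qed
  then have eqf: "(\<lambda>z :: nat \<Rightarrow> real. z a * z b) = (\<lambda>z. \<Prod>i<k. ?f i (z i))" by (rule ext)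
  have int: "integrable \<rho> (?f i)" for i
    using first(1) second(1) by (cases "i = a"; cases "i = b") (simp_all add: power2_eq_square)
  show "integrable (iid_vec \<rho> k) (\<lambda>z. z a * z b)"
    unfolding iid_vec_def eqf using int by (intro product_integrable_prod) auto
  have "(\<integral> z. z a * z b \<partial>iid_vec \<rho> k) = (\<Prod>i<k. expectation (?f i))"
    unfolding iid_vec_def eqf using int by (intro product_integral_prod) auto
  also have "\<dots> = (if a = b then v else 0)"
  proof (cases "a = b")
    case True
    have "(\<Prod>i<k. expectation (?f i)) = (\<Prod>i<k. if i = a then v else 1)"
    proof (intro prod.cong refl)
      fix i show "expectation (?f i) = (if i = a then v else 1)"
        using True second(2) by (cases "i = a") (simp_all add: power2_eq_square prob_space)
    qed
    then show ?thesis using True a by simp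
  next
    case False
    have "expectation (?f a) = 0" using False first(2) by simp
    then have "(\<Prod>i<k. expectation (?f i)) = 0" using a by (intro prod_zero bexI[where x = a]) simp_all
    then show ?thesis using False by simp
  qed
  finally show "(\<integral> z. z a * z b \<partial>iid_vec \<rho> k) = (if a = b then v else 0)" .
qed

lemma iid_vec_coord:
  assumes a: "a < k"
  shows "integrable (iid_vec \<rho> k) (\<lambda>z. z a)" and "(\<integral> z. z a \<partial>iid_vec \<rho> k) = 0"
proof -
  have d: "distr (iid_vec \<rho> k) \<rho> (\<lambda>z. z a) = \<rho>"
    unfolding iid_vec_def using a by (intro distr_PiM_component prob_space_axioms) auto
  have m: "(\<lambda>z. z a) \<in> measurable (iid_vec \<rho> k) \<rho>"
    unfolding iid_vec_def using a by (intro measurable_component_singleton) auto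
  show "integrable (iid_vec \<rho> k) (\<lambda>z. z a)"
    using integrable_distr[OF m, of "\<lambda>t. t"] first unfolding d by simp
  show "(\<integral> z. z a \<partial>iid_vec \<rho> k) = 0"
    using integral_distr[OF m, of "\<lambda>t. t"] first unfolding d by simp
qed

end

text \<open>The moments are pushed forward from the standard normal law, which covers the degenerate
  case \<open>s = 0\<close> uniformly.\<close>

lemma centered_normal: "centered (centered_normal s) (s\<^sup>2)"
proof -
  let ?N = "density lborel std_normal_density"
  interpret N: prob_space ?N by (rule prob_space_normal_density) simp
  have m: "(\<lambda>z. s * z) \<in> measurable ?N borel" by simp
  have ae: "AE z in lborel. 0 \<le> std_normal_density z" by simp
  have dens: "has_bochner_integral ?N f I"
    if "f \<in> borel_measurable borel" "has_bochner_integral lborel (\<lambda>z. std_normal_density z * f z) I"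
    for f :: "real \<Rightarrow> real" and I
  proof (rule has_bochner_integral_density)
    show "f \<in> borel_measurable lborel" using that(1) by simp
    show "has_bochner_integral lborel (\<lambda>z. std_normal_density z *\<^sub>R f z) I" using that(2) by simp
  qed (simp_all add: ae)
  have b1: "has_bochner_integral ?N (\<lambda>z. z) 0"
    using std_normal_moment_odd[of 0] by (intro dens) simp_all
  have b2: "has_bochner_integral ?N (\<lambda>z. z\<^sup>2) 1"
    using std_normal_moment_even[of 1] by (intro dens) simp_all
  have push: "has_bochner_integral (centered_normal s) f I"
    if "f \<in> borel_measurable borel" "has_bochner_integral ?N (\<lambda>z. f (s * z)) I" for f :: "real \<Rightarrow> real" and I
    unfolding centered_normal_def by (rule has_bochner_integral_distr[OF that(1) m that(2)])
  have c1: "has_bochner_integral (centered_normal s) (\<lambda>t. t) 0"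
    using has_bochner_integral_mult_right[OF b1, of s] by (intro push) simp_all
  have c2: "has_bochner_integral (centered_normal s) (\<lambda>t. t\<^sup>2) (s\<^sup>2)"
    using has_bochner_integral_mult_right[OF b2, of "s\<^sup>2"] by (intro push) (simp_all add: power_mult_distrib)
  interpret D: prob_space "centered_normal s"
    unfolding centered_normal_def by (rule N.prob_space_distr[OF m])
  show ?thesis
  proof
    show "sets (centered_normal s) = sets borel" by (simp add: centered_normal_def)
  qed (rule integrable.intros[OF c1] integrable.intros[OF c2] has_bochner_integral_integral_eq[OF c1]
      has_bochner_integral_integral_eq[OF c2])+
qed

lemma integrable_mult_of_sq:
  fixes f g :: "'a \<Rightarrow> real"
  assumes [measurable]: "f \<in> borel_measurable M" "g \<in> borel_measurable M"
    and "integrable M (\<lambda>x. (f x)\<^sup>2)" "integrable M (\<lambda>x. (g x)\<^sup>2)"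
  shows "integrable M (\<lambda>x. f x * g x)"
proof (rule Bochner_Integration.integrable_bound)
  show "integrable M (\<lambda>x. (f x)\<^sup>2 + (g x)\<^sup>2)" using assms by simp
  show "AE x in M. norm (f x * g x) \<le> norm ((f x)\<^sup>2 + (g x)\<^sup>2)"
  proof (rule AE_I2)
    fix x
    have "0 \<le> (\<bar>f x\<bar> - \<bar>g x\<bar>)\<^sup>2" by simp
    then have "2 * (\<bar>f x\<bar> * \<bar>g x\<bar>) \<le> (f x)\<^sup>2 + (g x)\<^sup>2" by (simp add: power2_diff)
    moreover have "0 \<le> \<bar>f x\<bar> * \<bar>g x\<bar>" by simp
    ultimately have "\<bar>f x\<bar> * \<bar>g x\<bar> \<le> (f x)\<^sup>2 + (g x)\<^sup>2" by linarith
    then show "norm (f x * g x) \<le> norm ((f x)\<^sup>2 + (g x)\<^sup>2)" by (simp add: abs_mult)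
  qed
qed measurable

lemma pair_product:
  fixes f :: "'a \<Rightarrow> real" and g :: "'b \<Rightarrow> real"
  assumes "prob_space A" "prob_space B" and f: "integrable A f" and g: "integrable B g"
  shows "integrable (A \<Otimes>\<^sub>M B) (\<lambda>z. f (fst z) * g (snd z))"
    and "(\<integral> z. f (fst z) * g (snd z) \<partial>(A \<Otimes>\<^sub>M B)) = (\<integral> x. f x \<partial>A) * (\<integral> y. g y \<partial>B)"
proof -
  interpret A: prob_space A by fact
  interpret B: prob_space B by fact
  interpret P: pair_prob_space A B ..
  have [measurable]: "f \<in> borel_measurable A" "g \<in> borel_measurable B" using f g by auto
  show i: "integrable (A \<Otimes>\<^sub>M B) (\<lambda>z. f (fst z) * g (snd z))"
  proof (rule P.Fubini_integrable)
    show "integrable A (\<lambda>x. \<integral> y. norm (f (fst (x, y)) * g (snd (x, y))) \<partial>B)"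
      using f g by (simp add: abs_mult)
    show "AE x in A. integrable B (\<lambda>y. f (fst (x, y)) * g (snd (x, y)))" using g by simp
  qed measurable
  show "(\<integral> z. f (fst z) * g (snd z) \<partial>(A \<Otimes>\<^sub>M B)) = (\<integral> x. f x \<partial>A) * (\<integral> y. g y \<partial>B)"
    using P.integral_fst'[OF i] by simp
qed

text \<open>\<open>train_law\<close> lists the noise between data and sketch, whereas the matrix
  estimates live on pairs of data and sketch; this exchanges the last two factors.\<close>

lemma distr_swap_inner:
  assumes "prob_space A" "prob_space B" "prob_space C"
  shows "distr (A \<Otimes>\<^sub>M (B \<Otimes>\<^sub>M C)) ((A \<Otimes>\<^sub>M C) \<Otimes>\<^sub>M B) (\<lambda>z. ((fst z, snd (snd z)), fst (snd z)))
    = (A \<Otimes>\<^sub>M C) \<Otimes>\<^sub>M B"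
proof (rule measure_eqI)
  interpret A: prob_space A by fact
  interpret B: prob_space B by fact
  interpret C: prob_space C by fact
  interpret BC: pair_prob_space B C ..
  interpret CB: pair_prob_space C B ..
  interpret AC: pair_prob_space A C ..
  fix S assume "S \<in> sets (distr (A \<Otimes>\<^sub>M (B \<Otimes>\<^sub>M C)) ((A \<Otimes>\<^sub>M C) \<Otimes>\<^sub>M B) (\<lambda>z. ((fst z, snd (snd z)), fst (snd z))))"
  then have S [measurable]: "S \<in> sets ((A \<Otimes>\<^sub>M C) \<Otimes>\<^sub>M B)" by simp
  let ?D = "distr (A \<Otimes>\<^sub>M (B \<Otimes>\<^sub>M C)) ((A \<Otimes>\<^sub>M C) \<Otimes>\<^sub>M B) (\<lambda>z. ((fst z, snd (snd z)), fst (snd z)))"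
  have "emeasure ?D S = (\<integral>\<^sup>+ z. indicator S z \<partial>?D)" by simp
  also have "\<dots> = (\<integral>\<^sup>+ z. indicator S ((fst z, snd (snd z)), fst (snd z)) \<partial>(A \<Otimes>\<^sub>M (B \<Otimes>\<^sub>M C)))"
    by (subst nn_integral_distr) auto
  also have "\<dots> = (\<integral>\<^sup>+ x. \<integral>\<^sup>+ z. indicator S ((x, snd z), fst z) \<partial>(B \<Otimes>\<^sub>M C) \<partial>A)"
    by (subst BC.nn_integral_fst[symmetric]) auto
  also have "\<dots> = (\<integral>\<^sup>+ x. \<integral>\<^sup>+ y. \<integral>\<^sup>+ w. indicator S ((x, w), y) \<partial>C \<partial>B \<partial>A)"
    by (intro nn_integral_cong) (subst C.nn_integral_fst[symmetric], auto)
  also have "\<dots> = (\<integral>\<^sup>+ x. \<integral>\<^sup>+ w. \<integral>\<^sup>+ y. indicator S ((x, w), y) \<partial>B \<partial>C \<partial>A)"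
    by (intro nn_integral_cong) (rule CB.Fubini', measurable)
  also have "\<dots> = (\<integral>\<^sup>+ z. \<integral>\<^sup>+ y. indicator S (z, y) \<partial>B \<partial>(A \<Otimes>\<^sub>M C))"
    by (subst C.nn_integral_fst[symmetric]) auto
  also have "\<dots> = (\<integral>\<^sup>+ z. indicator S z \<partial>((A \<Otimes>\<^sub>M C) \<Otimes>\<^sub>M B))"
    by (subst B.nn_integral_fst[symmetric]) auto
  finally show "emeasure ?D S = emeasure ((A \<Otimes>\<^sub>M C) \<Otimes>\<^sub>M B) S" by simp
qed simp

text \<open>In coordinates the prediction is bilinear in \<open>x\<close> and
  \<open>\<theta>\<close> plus bilinear in \<open>x\<close> and \<open>E\<close>, with coefficients
  depending on \<open>X\<close> and \<open>W\<close> alone. Expectations can then be taken monomial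
  by monomial.\<close>

lemma ridge_predictor_eq:
  assumes W: "W \<in> carrier_mat p d" and X: "X \<in> carrier_mat n d" and n: "0 < n" and l: "0 < l"
    and \<theta>: "\<theta> \<in> carrier_vec d" and E: "E \<in> carrier_vec n" and x: "x \<in> carrier_vec d"
  shows "ridge_predictor l W X (X *\<^sub>v \<theta> + E) x =
    (\<Sum>j<d. \<Sum>k<d. x $ j * \<theta> $ k * (resol l W X * gram X) $$ (j, k)) +
    (\<Sum>j<d. \<Sum>i<n. x $ j * ((resol l W X * transpose_mat X) $$ (j, i) / real n) * E $ i)"
proof -
  interpret R: ridge d n p l W X using W X n l by unfold_locales
  obtain I where I: "the (mat_inverse (ridge_matrix l W X)) = I" "I \<in> carrier_mat p p"
    by (rule R.mat_inverse_ridge) auto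
  let ?A = "resol l W X" and ?XT = "transpose_mat X" and ?WT = "transpose_mat W"
  have A: "?A \<in> carrier_mat d d" by (rule R.resol_carrier)
  have WT: "?WT \<in> carrier_mat d p" and XT: "?XT \<in> carrier_mat d n" using W X by auto
  have A_vec: "?WT *\<^sub>v (I *\<^sub>v (W *\<^sub>v y)) = ?A *\<^sub>v y" if y: "y \<in> carrier_vec d" for y
    unfolding resol_def I using W I(2) y
    by (simp add: assoc_mult_mat_vec[OF WT mult_carrier_mat[OF I(2) W] y] assoc_mult_mat_vec[OF I(2) W y])
  have Xv: "X *\<^sub>v \<theta> \<in> carrier_vec n" by (rule mult_mat_vec_carrier[OF X \<theta>])
  let ?Y = "X *\<^sub>v \<theta> + E"
  have Y: "?Y \<in> carrier_vec n" using Xv E by simp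
  have XTY: "?XT *\<^sub>v ?Y \<in> carrier_vec d" by (rule mult_mat_vec_carrier[OF XT Y])
  have "(1 / real n) \<cdot>\<^sub>v ((W * ?XT) *\<^sub>v ?Y) = W *\<^sub>v ((1 / real n) \<cdot>\<^sub>v (?XT *\<^sub>v ?Y))"
    by (simp only: assoc_mult_mat_vec[OF W XT Y] mult_mat_vec[OF W XTY])
  then have "ridge_predictor l W X ?Y x = scalar_prod x (?A *\<^sub>v ((1 / real n) \<cdot>\<^sub>v (?XT *\<^sub>v ?Y)))"
    using A_vec[of "(1 / real n) \<cdot>\<^sub>v (?XT *\<^sub>v ?Y)"] XTY I(1) X
    unfolding ridge_predictor_def Let_def ridge_matrix_def[symmetric] by simp
  also have "(1 / real n) \<cdot>\<^sub>v (?XT *\<^sub>v ?Y) = gram X *\<^sub>v \<theta> + (1 / real n) \<cdot>\<^sub>v (?XT *\<^sub>v E)"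
  proof -
    have "?XT *\<^sub>v ?Y = ?XT *\<^sub>v (X *\<^sub>v \<theta>) + ?XT *\<^sub>v E" by (rule mult_add_distrib_mat_vec[OF XT Xv E])
    also have "?XT *\<^sub>v (X *\<^sub>v \<theta>) = (?XT * X) *\<^sub>v \<theta>" by (rule assoc_mult_mat_vec[OF XT X \<theta>, symmetric])
    finally have "(1 / real n) \<cdot>\<^sub>v (?XT *\<^sub>v ?Y) = (1 / real n) \<cdot>\<^sub>v ((?XT * X) *\<^sub>v \<theta>) + (1 / real n) \<cdot>\<^sub>v (?XT *\<^sub>v E)"
      using X by (simp add: smult_add_distrib_vec[of _ d] mult_mat_vec_carrier[OF XT E]
          mult_mat_vec_carrier[OF mult_carrier_mat[OF XT X] \<theta>] del: assoc_mult_mat_vec)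
    also have "(1 / real n) \<cdot>\<^sub>v ((?XT * X) *\<^sub>v \<theta>) = gram X *\<^sub>v \<theta>"
      unfolding gram_def using X smult_mat_mult_vec[OF mult_carrier_mat[OF XT X] \<theta>] by simp
    finally show ?thesis .
  qed
  also have "?A *\<^sub>v (gram X *\<^sub>v \<theta> + (1 / real n) \<cdot>\<^sub>v (?XT *\<^sub>v E)) =
      (?A * gram X) *\<^sub>v \<theta> + (1 / real n) \<cdot>\<^sub>v ((?A * ?XT) *\<^sub>v E)"
    using mult_add_distrib_mat_vec[OF A mult_mat_vec_carrier[OF gram_carrier[OF X] \<theta>], of "(1 / real n) \<cdot>\<^sub>v (?XT *\<^sub>v E)"]
      mult_mat_vec[OF A mult_mat_vec_carrier[OF XT E]] assoc_mult_mat_vec[OF A gram_carrier[OF X] \<theta>]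
      assoc_mult_mat_vec[OF A XT E] mult_mat_vec_carrier[OF XT E] by simp
  finally have 1: "ridge_predictor l W X ?Y x =
      scalar_prod x ((?A * gram X) *\<^sub>v \<theta> + (1 / real n) \<cdot>\<^sub>v ((?A * ?XT) *\<^sub>v E))" .
  let ?M = "?A * gram X" and ?N = "?A * ?XT"
  have M: "?M \<in> carrier_mat d d" by (rule mult_carrier_mat[OF A gram_carrier[OF X]])
  have N: "?N \<in> carrier_mat d n" by (rule mult_carrier_mat[OF A XT])
  have c: "?M *\<^sub>v \<theta> \<in> carrier_vec d" "?N *\<^sub>v E \<in> carrier_vec d"
    by (rule mult_mat_vec_carrier[OF M \<theta>] mult_mat_vec_carrier[OF N E])+
  have "scalar_prod x (?M *\<^sub>v \<theta> + (1 / real n) \<cdot>\<^sub>v (?N *\<^sub>v E)) =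
      (\<Sum>j<d. x $ j * ((?M *\<^sub>v \<theta>) $ j + 1 / real n * (?N *\<^sub>v E) $ j))"
    using c by (subst scalar_prod_sum[of _ d]) (simp_all add: carrier_matD[OF A] del: index_mult_mat_vec)
  also have "\<dots> = (\<Sum>j<d. (\<Sum>k<d. x $ j * \<theta> $ k * ?M $$ (j, k)) + (\<Sum>i<n. x $ j * (?N $$ (j, i) / real n) * E $ i))"
    by (intro sum.cong refl)
      (simp add: index_mult_mat_vec_sum[OF M \<theta>] index_mult_mat_vec_sum[OF N E] distrib_left
        sum_distrib_left mult_ac del: index_mult_mat_vec)
  finally show ?thesis unfolding 1 by (simp add: sum.distrib)
qed

lemma sum_add_sum_sq:
  fixes f :: "'a \<Rightarrow> real" and g :: "'b \<Rightarrow> real"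
  shows "((\<Sum>u\<in>A. f u) + (\<Sum>v\<in>B. g v))\<^sup>2 =
    (\<Sum>u\<in>A. \<Sum>u'\<in>A. f u * f u') + 2 * (\<Sum>u\<in>A. \<Sum>v\<in>B. f u * g v) + (\<Sum>v\<in>B. \<Sum>v'\<in>B. g v * g v')"
  unfolding sum_product[symmetric] by (simp add: power2_eq_square algebra_simps)

lemma (in unit_entries) centered: "centered \<mu> 1"
  by unfold_locales (simp_all add: pow_simps mean0 second1)

section \<open>Integrating out the noise\<close>

context haar_law
begin

abbreviation "DD \<equiv> {..<d} \<times> {..<d}"
abbreviation "DN \<equiv> {..<d} \<times> {..<n}"

definition Nf :: "(nat \<times> nat \<Rightarrow> real) \<times> (nat \<times> nat \<Rightarrow> real) \<Rightarrow> nat \<times> nat \<Rightarrow> real" where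
  "Nf \<omega> v = (Am \<omega> * transpose_mat (Xm \<omega>)) $$ v / real n"

definition Mf :: "(nat \<times> nat \<Rightarrow> real) \<times> (nat \<times> nat \<Rightarrow> real) \<Rightarrow> nat \<times> nat \<Rightarrow> real" where
  "Mf \<omega> u = Mm \<omega> $$ u"

lemma Mf_meas: "u \<in> DD \<Longrightarrow> (\<lambda>\<omega>. Mf \<omega> u) \<in> borel_measurable \<Omega>"
  unfolding Mf_def using mat_measurable_entry[OF Mm_meas] by (cases u) auto

lemma Mf_sq: "u \<in> DD \<Longrightarrow> integrable \<Omega> (\<lambda>\<omega>. (Mf \<omega> u)\<^sup>2)"
  and Mf_int: "u \<in> DD \<Longrightarrow> integrable \<Omega> (\<lambda>\<omega>. Mf \<omega> u)"
  unfolding Mf_def using Mm_entry by (cases u; auto)+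

lemma Nf_meas: "v \<in> DN \<Longrightarrow> (\<lambda>\<omega>. Nf \<omega> v) \<in> borel_measurable \<Omega>"
proof -
  have "mat_measurable \<Omega> d n (\<lambda>\<omega>. Am \<omega> * transpose_mat (Xm \<omega>))"
    by (intro mat_measurable_mult[of _ d d] mat_measurable_transpose Am_meas Xm_meas)
  then show "v \<in> DN \<Longrightarrow> (\<lambda>\<omega>. Nf \<omega> v) \<in> borel_measurable \<Omega>"
    unfolding Nf_def by (cases v) (auto intro!: borel_measurable_divide mat_measurable_entry)
qed

lemma sum_Nf_sq: "(\<Sum>v\<in>DN. (Nf \<omega> v)\<^sup>2) = noise_term \<omega>"
proof -
  have XT: "transpose_mat (Xm \<omega>) \<in> carrier_mat d n" by simp
  have AX: "Am \<omega> * transpose_mat (Xm \<omega>) \<in> carrier_mat d n" by (rule mult_carrier_mat[OF Am_carrier XT])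
  have col: "Matrix.col (Am \<omega> * transpose_mat (Xm \<omega>)) i = Am \<omega> *\<^sub>v Matrix.row (Xm \<omega>) i" if "i < n" for i
    using that col_mult2[OF Am_carrier XT that, of \<omega>] carrier_matD[OF carriers(1)[of \<omega>]] by simp
  have "(\<Sum>v\<in>DN. (Nf \<omega> v)\<^sup>2) = (\<Sum>j<d. \<Sum>i<n. ((Am \<omega> * transpose_mat (Xm \<omega>)) $$ (j, i))\<^sup>2) / (real n)\<^sup>2"
    by (simp add: Nf_def power_divide sum_divide_distrib sum.cartesian_product case_prod_beta' del: index_mult_mat)
  also have "\<dots> = frob_sq (Am \<omega> * transpose_mat (Xm \<omega>)) / (real n)\<^sup>2"
    by (simp only: frob_sq_eq[OF AX])
  also have "\<dots> = noise_term \<omega>"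
    unfolding frob_sq_cols[OF AX] noise_term_def by (intro arg_cong2[of _ _ _ _ "(/)"] sum.cong refl) (simp_all only: col lessThan_iff)
  finally show ?thesis .
qed

lemma Nf_sq:
  assumes v: "v \<in> DN"
  shows "integrable \<Omega> (\<lambda>\<omega>. (Nf \<omega> v)\<^sup>2)"
proof (rule Bochner_Integration.integrable_bound[OF noise_term_integrable])
  show "(\<lambda>\<omega>. (Nf \<omega> v)\<^sup>2) \<in> borel_measurable \<Omega>" using Nf_meas[OF v] by simp
  show "AE \<omega> in \<Omega>. norm ((Nf \<omega> v)\<^sup>2) \<le> norm (noise_term \<omega>)"
  proof (rule AE_I2)
    fix \<omega>
    have "(Nf \<omega> v)\<^sup>2 \<le> (\<Sum>v\<in>DN. (Nf \<omega> v)\<^sup>2)"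
      using v by (intro member_le_sum[of v DN "\<lambda>v. (Nf \<omega> v)\<^sup>2"]) auto
    then show "norm ((Nf \<omega> v)\<^sup>2) \<le> norm (noise_term \<omega>)" unfolding sum_Nf_sq by simp
  qed
qed

lemma Nf_int: "v \<in> DN \<Longrightarrow> integrable \<Omega> (\<lambda>\<omega>. Nf \<omega> v)"
  by (rule MXN.square_integrable_imp_integrable[OF Nf_meas Nf_sq])

definition EMf :: "nat \<times> nat \<Rightarrow> real" where "EMf u = (\<integral> \<omega>. Mf \<omega> u \<partial>\<Omega>)"

definition reorder :: "'x \<times> 'y \<times> 'z \<Rightarrow> ('x \<times> 'z) \<times> 'y" where
  "reorder z = ((fst z, snd (snd z)), fst (snd z))"

definition G where
  "G \<theta> x z = (\<Sum>u\<in>DD. x (fst u) * \<theta> (snd u) * Mf (fst z) u) +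
     (\<Sum>v\<in>DN. x (fst v) * (Nf (fst z) v * snd z (snd v)))"

lemma prediction_eq: "prediction l n p d \<theta> x z = G \<theta> x (reorder z)"
proof -
  obtain X E w where z: "z = (X, E, w)" by (cases z)
  let ?W = "Matrix.mat p d w" and ?X = "Matrix.mat n d X"
  have "prediction l n p d \<theta> x z = (\<Sum>j<d. \<Sum>k<d. Matrix.vec d x $ j * Matrix.vec d \<theta> $ k * (resol l ?W ?X * gram ?X) $$ (j, k)) +
    (\<Sum>j<d. \<Sum>i<n. Matrix.vec d x $ j * ((resol l ?W ?X * transpose_mat ?X) $$ (j, i) / real n) * Matrix.vec n E $ i)"
    unfolding prediction_def z case_prod_conv by (rule ridge_predictor_eq[OF _ _ n l]) auto
  also have "\<dots> = (\<Sum>j<d. \<Sum>k<d. x j * \<theta> k * Mf (X, w) (j, k)) + (\<Sum>j<d. \<Sum>i<n. x j * (Nf (X, w) (j, i) * E i))"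
    by (intro arg_cong2[of _ _ _ _ "(+)"] sum.cong refl)
      (simp_all add: Mf_def Mm_def Nf_def Am_def Xm_def Wm_def mult_ac del: index_mult_mat)
  also have "\<dots> = G \<theta> x (reorder z)"
    by (simp add: G_def reorder_def z sum.cartesian_product case_prod_beta')
  finally show ?thesis .
qed

context
  fixes \<sigma> :: real
begin

abbreviation "EE \<equiv> iid_vec (centered_normal \<sigma>) n"

interpretation C: centered "centered_normal \<sigma>" "\<sigma>\<^sup>2" by (rule centered_normal)
interpretation EE: prob_space EE by (rule C.iid_vec_prob)

lemma prob_\<Omega>: "prob_space \<Omega>" by (rule MXN.prob_space_axioms)

lemma integral_train:
  fixes F :: "_ \<Rightarrow> real"
  assumes F: "F \<in> borel_measurable (\<Omega> \<Otimes>\<^sub>M EE)"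
  shows "(\<integral> z. F (reorder z) \<partial>train_law \<mu> \<sigma> N n d) = (\<integral> z. F z \<partial>(\<Omega> \<Otimes>\<^sub>M EE))"
proof -
  have m: "reorder \<in> measurable (train_law \<mu> \<sigma> N n d) (\<Omega> \<Otimes>\<^sub>M EE)"
    unfolding train_law_def reorder_def by measurable
  have "distr (train_law \<mu> \<sigma> N n d) (\<Omega> \<Otimes>\<^sub>M EE) reorder = \<Omega> \<Otimes>\<^sub>M EE"
    unfolding train_law_def reorder_def
    by (rule distr_swap_inner[OF MX.prob_space_axioms EE.prob_space_axioms N.prob_space_axioms])
  then show ?thesis using integral_distr[OF m F] by simp
qed

lemma pair_fst:
  assumes f: "integrable \<Omega> (f :: _ \<Rightarrow> real)"
  shows "integrable (\<Omega> \<Otimes>\<^sub>M EE) (\<lambda>z. f (fst z))" "(\<integral> z. f (fst z) \<partial>(\<Omega> \<Otimes>\<^sub>M EE)) = (\<integral> \<omega>. f \<omega> \<partial>\<Omega>)"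
proof -
  have g: "integrable EE (\<lambda>_. 1 :: real)" by simp
  show "integrable (\<Omega> \<Otimes>\<^sub>M EE) (\<lambda>z. f (fst z))" "(\<integral> z. f (fst z) \<partial>(\<Omega> \<Otimes>\<^sub>M EE)) = (\<integral> \<omega>. f \<omega> \<partial>\<Omega>)"
    using pair_product[OF prob_\<Omega> EE.prob_space_axioms f g] by (simp_all add: EE.prob_space)
qed

lemma pair_coord:
  assumes f: "integrable \<Omega> (f :: _ \<Rightarrow> real)" and i: "i < n"
  shows "integrable (\<Omega> \<Otimes>\<^sub>M EE) (\<lambda>z. f (fst z) * snd z i)" "(\<integral> z. f (fst z) * snd z i \<partial>(\<Omega> \<Otimes>\<^sub>M EE)) = 0"
  using pair_product[OF prob_\<Omega> EE.prob_space_axioms f C.iid_vec_coord(1)[OF i]] C.iid_vec_coord(2)[OF i] by simp_all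

lemma pair_cross:
  assumes f: "integrable \<Omega> (f :: _ \<Rightarrow> real)" and i: "i < n" and k: "k < n"
  shows "integrable (\<Omega> \<Otimes>\<^sub>M EE) (\<lambda>z. f (fst z) * (snd z i * snd z k))"
    "(\<integral> z. f (fst z) * (snd z i * snd z k) \<partial>(\<Omega> \<Otimes>\<^sub>M EE)) = (\<integral> \<omega>. f \<omega> \<partial>\<Omega>) * (if i = k then \<sigma>\<^sup>2 else 0)"
  using pair_product[OF prob_\<Omega> EE.prob_space_axioms f C.iid_vec_cross(1)[OF i k]] C.iid_vec_cross(2)[OF i k] by simp_all

lemma G_integrable: "integrable (\<Omega> \<Otimes>\<^sub>M EE) (G \<theta> x)"
proof -
  have "integrable (\<Omega> \<Otimes>\<^sub>M EE) (\<lambda>z. G \<theta> x z)"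
    unfolding G_def
    by (intro Bochner_Integration.integrable_add Bochner_Integration.integrable_sum integrable_mult_right
        pair_fst pair_coord Mf_int Nf_int) auto
  then show ?thesis .
qed

text \<open>The noise enters linearly, is centred and is independent of the matrices, so only the
  mean of \<open>M\<close> survives.\<close>

lemma mean_prediction_eq: "mean_prediction \<mu> \<sigma> N l n p d \<theta> x = (\<Sum>u\<in>DD. x (fst u) * \<theta> (snd u) * EMf u)"
proof -
  have i1: "integrable (\<Omega> \<Otimes>\<^sub>M EE) (\<lambda>z. x (fst u) * \<theta> (snd u) * Mf (fst z) u)" if "u \<in> DD" for u
    using that by (intro integrable_mult_right pair_fst Mf_int)
  have i2: "integrable (\<Omega> \<Otimes>\<^sub>M EE) (\<lambda>z. x (fst v) * (Nf (fst z) v * snd z (snd v)))" if "v \<in> DN" for v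
    using that by (intro integrable_mult_right pair_coord Nf_int) auto
  have "mean_prediction \<mu> \<sigma> N l n p d \<theta> x = (\<integral> z. G \<theta> x z \<partial>(\<Omega> \<Otimes>\<^sub>M EE))"
    unfolding mean_prediction_def prediction_eq using G_integrable by (intro integral_train) auto
  also have "\<dots> = (\<integral> z. (\<Sum>u\<in>DD. x (fst u) * \<theta> (snd u) * Mf (fst z) u) \<partial>(\<Omega> \<Otimes>\<^sub>M EE)) +
      (\<integral> z. (\<Sum>v\<in>DN. x (fst v) * (Nf (fst z) v * snd z (snd v))) \<partial>(\<Omega> \<Otimes>\<^sub>M EE))"
    unfolding G_def by (intro Bochner_Integration.integral_add Bochner_Integration.integrable_sum i1 i2)
  also have "(\<integral> z. (\<Sum>u\<in>DD. x (fst u) * \<theta> (snd u) * Mf (fst z) u) \<partial>(\<Omega> \<Otimes>\<^sub>M EE)) =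
      (\<Sum>u\<in>DD. \<integral> z. x (fst u) * \<theta> (snd u) * Mf (fst z) u \<partial>(\<Omega> \<Otimes>\<^sub>M EE))"
    by (intro Bochner_Integration.integral_sum i1)
  also have "\<dots> = (\<Sum>u\<in>DD. x (fst u) * \<theta> (snd u) * EMf u)"
    by (intro sum.cong refl) (simp only: integral_mult_right_zero pair_fst(2)[OF Mf_int] EMf_def)
  also have "(\<integral> z. (\<Sum>v\<in>DN. x (fst v) * (Nf (fst z) v * snd z (snd v))) \<partial>(\<Omega> \<Otimes>\<^sub>M EE)) =
      (\<Sum>v\<in>DN. \<integral> z. x (fst v) * (Nf (fst z) v * snd z (snd v)) \<partial>(\<Omega> \<Otimes>\<^sub>M EE))"
    by (intro Bochner_Integration.integral_sum i2)
  also have "\<dots> = (\<Sum>v\<in>DN. 0)"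
  proof (intro sum.cong refl)
    fix v assume v: "v \<in> DN"
    then have "snd v < n" by auto
    then show "(\<integral> z. x (fst v) * (Nf (fst z) v * snd z (snd v)) \<partial>(\<Omega> \<Otimes>\<^sub>M EE)) = 0"
      by (simp only: integral_mult_right_zero pair_coord(2)[OF Nf_int[OF v]] mult_zero_right)
  qed
  finally show ?thesis by simp
qed

definition Cov :: "nat \<times> nat \<Rightarrow> nat \<times> nat \<Rightarrow> real" where
  "Cov u u' = (\<integral> \<omega>. (Mf \<omega> u - EMf u) * (Mf \<omega> u' - EMf u') \<partial>\<Omega>)"

text \<open>Nothing is subtracted here, since the noise part of the prediction already has mean
  zero.\<close>

definition Kov :: "nat \<times> nat \<Rightarrow> nat \<times> nat \<Rightarrow> real" where
  "Kov v v' = (\<integral> \<omega>. Nf \<omega> v * Nf \<omega> v' \<partial>\<Omega>)"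

lemma D_meas: "u \<in> DD \<Longrightarrow> (\<lambda>\<omega>. Mf \<omega> u - EMf u) \<in> borel_measurable \<Omega>"
  by (intro borel_measurable_diff Mf_meas borel_measurable_const)

lemma D_sq: "u \<in> DD \<Longrightarrow> integrable \<Omega> (\<lambda>\<omega>. (Mf \<omega> u - EMf u)\<^sup>2)"
  using Mf_sq[of u] Mf_int[of u] by (simp add: power2_diff)

text \<open>With \<open>\<theta>\<close> and \<open>x\<close> fixed, the centred prediction is a
  signal sum plus a noise sum. Mixed products are linear in the noise and vanish; products of two
  noise terms survive only for the same noise coordinate.\<close>

lemma variance_inner:
  "(\<integral> z. (prediction l n p d \<theta> x z - mean_prediction \<mu> \<sigma> N l n p d \<theta> x)\<^sup>2 \<partial>train_law \<mu> \<sigma> N n d) =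
    (\<Sum>u\<in>DD. \<Sum>u'\<in>DD. Cov u u' * ((x (fst u) * x (fst u')) * (\<theta> (snd u) * \<theta> (snd u')))) +
    (\<Sum>v\<in>DN. \<Sum>v'\<in>DN. Kov v v' * (if snd v = snd v' then \<sigma>\<^sup>2 else 0) * (x (fst v) * x (fst v')))"
proof -
  let ?a = "\<lambda>u :: nat \<times> nat. x (fst u) * \<theta> (snd u)"
  let ?D = "\<lambda>u \<omega>. Mf \<omega> u - EMf u"
  let ?f = "\<lambda>u z. ?a u * ?D u (fst z)"
  let ?g = "\<lambda>v z. x (fst v) * (Nf (fst z) v * snd z (snd v)) :: real"
  let ?T = "\<Omega> \<Otimes>\<^sub>M EE"
  have diff: "G \<theta> x z - mean_prediction \<mu> \<sigma> N l n p d \<theta> x = (\<Sum>u\<in>DD. ?f u z) + (\<Sum>v\<in>DN. ?g v z)" for z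
    unfolding G_def mean_prediction_eq by (simp add: right_diff_distrib sum_subtractf)
  have ff: "integrable ?T (\<lambda>z. ?f u z * ?f u' z)"
      "(\<integral> z. ?f u z * ?f u' z \<partial>?T) = Cov u u' * ((x (fst u) * x (fst u')) * (\<theta> (snd u) * \<theta> (snd u')))"
    if u: "u \<in> DD" "u' \<in> DD" for u u'
  proof -
    have i: "integrable \<Omega> (\<lambda>\<omega>. ?D u \<omega> * ?D u' \<omega>)"
      by (rule integrable_mult_of_sq[OF D_meas[OF u(1)] D_meas[OF u(2)] D_sq[OF u(1)] D_sq[OF u(2)]])
    have eq: "(\<lambda>z. ?f u z * ?f u' z) = (\<lambda>z. (?a u * ?a u') * (?D u (fst z) * ?D u' (fst z)))"
      by (rule ext) (simp only: mult_ac)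
    show "integrable ?T (\<lambda>z. ?f u z * ?f u' z)"
      unfolding eq by (rule integrable_mult_right) (rule pair_fst(1)[OF i])
    show "(\<integral> z. ?f u z * ?f u' z \<partial>?T) = Cov u u' * ((x (fst u) * x (fst u')) * (\<theta> (snd u) * \<theta> (snd u')))"
      unfolding eq integral_mult_right_zero pair_fst(2)[OF i] Cov_def by (simp only: mult_ac)
  qed
  have fg: "integrable ?T (\<lambda>z. ?f u z * ?g v z)" "(\<integral> z. ?f u z * ?g v z \<partial>?T) = 0"
    if u: "u \<in> DD" "v \<in> DN" for u v
  proof -
    have i: "integrable \<Omega> (\<lambda>\<omega>. ?D u \<omega> * Nf \<omega> v)"
      by (rule integrable_mult_of_sq[OF D_meas[OF u(1)] Nf_meas[OF u(2)] D_sq[OF u(1)] Nf_sq[OF u(2)]])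
    have v: "snd v < n" using u by auto
    have eq: "(\<lambda>z. ?f u z * ?g v z) = (\<lambda>z. (?a u * x (fst v)) * ((?D u (fst z) * Nf (fst z) v) * snd z (snd v)))"
      by (rule ext) (simp only: mult_ac)
    show "integrable ?T (\<lambda>z. ?f u z * ?g v z)"
      unfolding eq by (rule integrable_mult_right) (rule pair_coord(1)[OF i v])
    show "(\<integral> z. ?f u z * ?g v z \<partial>?T) = 0"
      unfolding eq integral_mult_right_zero pair_coord(2)[OF i v] by simp
  qed
  have gg: "integrable ?T (\<lambda>z. ?g v z * ?g v' z)"
      "(\<integral> z. ?g v z * ?g v' z \<partial>?T) = Kov v v' * (if snd v = snd v' then \<sigma>\<^sup>2 else 0) * (x (fst v) * x (fst v'))"
    if u: "v \<in> DN" "v' \<in> DN" for v v'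
  proof -
    have i: "integrable \<Omega> (\<lambda>\<omega>. Nf \<omega> v * Nf \<omega> v')"
      by (rule integrable_mult_of_sq[OF Nf_meas[OF u(1)] Nf_meas[OF u(2)] Nf_sq[OF u(1)] Nf_sq[OF u(2)]])
    have v: "snd v < n" "snd v' < n" using u by auto
    have eq: "(\<lambda>z. ?g v z * ?g v' z) = (\<lambda>z. (x (fst v) * x (fst v')) * ((Nf (fst z) v * Nf (fst z) v') * (snd z (snd v) * snd z (snd v'))))"
      by (rule ext) (simp only: mult_ac)
    show "integrable ?T (\<lambda>z. ?g v z * ?g v' z)"
      unfolding eq by (rule integrable_mult_right) (rule pair_cross(1)[OF i v])
    show "(\<integral> z. ?g v z * ?g v' z \<partial>?T) = Kov v v' * (if snd v = snd v' then \<sigma>\<^sup>2 else 0) * (x (fst v) * x (fst v'))"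
      unfolding eq integral_mult_right_zero pair_cross(2)[OF i v] Kov_def by (simp only: mult_ac)
  qed
  have "(\<integral> z. (prediction l n p d \<theta> x z - mean_prediction \<mu> \<sigma> N l n p d \<theta> x)\<^sup>2 \<partial>train_law \<mu> \<sigma> N n d) =
      (\<integral> z. (G \<theta> x z - mean_prediction \<mu> \<sigma> N l n p d \<theta> x)\<^sup>2 \<partial>?T)"
    unfolding prediction_eq using G_integrable
    by (intro integral_train[where F = "\<lambda>z. (G \<theta> x z - mean_prediction \<mu> \<sigma> N l n p d \<theta> x)\<^sup>2"]) auto
  also have "\<dots> = (\<integral> z. (\<Sum>u\<in>DD. \<Sum>u'\<in>DD. ?f u z * ?f u' z) + 2 * (\<Sum>u\<in>DD. \<Sum>v\<in>DN. ?f u z * ?g v z)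
      + (\<Sum>v\<in>DN. \<Sum>v'\<in>DN. ?g v z * ?g v' z) \<partial>?T)"
    unfolding diff sum_add_sum_sq ..
  also have "\<dots> = (\<integral> z. (\<Sum>u\<in>DD. \<Sum>u'\<in>DD. ?f u z * ?f u' z) + 2 * (\<Sum>u\<in>DD. \<Sum>v\<in>DN. ?f u z * ?g v z) \<partial>?T)
      + (\<integral> z. (\<Sum>v\<in>DN. \<Sum>v'\<in>DN. ?g v z * ?g v' z) \<partial>?T)"
    by (intro Bochner_Integration.integral_add Bochner_Integration.integrable_add Bochner_Integration.integrable_sum
        integrable_mult_right ff(1) fg(1) gg(1))
  also have "(\<integral> z. (\<Sum>u\<in>DD. \<Sum>u'\<in>DD. ?f u z * ?f u' z) + 2 * (\<Sum>u\<in>DD. \<Sum>v\<in>DN. ?f u z * ?g v z) \<partial>?T) =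
      (\<integral> z. (\<Sum>u\<in>DD. \<Sum>u'\<in>DD. ?f u z * ?f u' z) \<partial>?T) + (\<integral> z. 2 * (\<Sum>u\<in>DD. \<Sum>v\<in>DN. ?f u z * ?g v z) \<partial>?T)"
    by (intro Bochner_Integration.integral_add Bochner_Integration.integrable_sum
        integrable_mult_right ff(1) fg(1))
  also have "(\<integral> z. 2 * (\<Sum>u\<in>DD. \<Sum>v\<in>DN. ?f u z * ?g v z) \<partial>?T) = 2 * (\<integral> z. (\<Sum>u\<in>DD. \<Sum>v\<in>DN. ?f u z * ?g v z) \<partial>?T)"
    by (rule integral_mult_right_zero)
  also have "(\<integral> z. (\<Sum>u\<in>DD. \<Sum>v\<in>DN. ?f u z * ?g v z) \<partial>?T) = (\<Sum>u\<in>DD. \<integral> z. (\<Sum>v\<in>DN. ?f u z * ?g v z) \<partial>?T)"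
    by (intro Bochner_Integration.integral_sum Bochner_Integration.integrable_sum fg(1))
  also have "\<dots> = (\<Sum>u\<in>DD. \<Sum>v\<in>DN. \<integral> z. ?f u z * ?g v z \<partial>?T)"
    by (rule sum.cong[OF refl], rule Bochner_Integration.integral_sum, rule fg(1))
  also have "\<dots> = (\<Sum>u\<in>DD. \<Sum>v\<in>DN. 0)"
    by (rule sum.cong[OF refl], rule sum.cong[OF refl], rule fg(2))
  also have "(\<integral> z. (\<Sum>u\<in>DD. \<Sum>u'\<in>DD. ?f u z * ?f u' z) \<partial>?T) = (\<Sum>u\<in>DD. \<integral> z. (\<Sum>u'\<in>DD. ?f u z * ?f u' z) \<partial>?T)"
    by (intro Bochner_Integration.integral_sum Bochner_Integration.integrable_sum ff(1))
  also have "\<dots> = (\<Sum>u\<in>DD. \<Sum>u'\<in>DD. \<integral> z. ?f u z * ?f u' z \<partial>?T)"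
    by (rule sum.cong[OF refl], rule Bochner_Integration.integral_sum, rule ff(1))
  also have "\<dots> = (\<Sum>u\<in>DD. \<Sum>u'\<in>DD. Cov u u' * ((x (fst u) * x (fst u')) * (\<theta> (snd u) * \<theta> (snd u'))))"
    by (rule sum.cong[OF refl], rule sum.cong[OF refl], rule ff(2))
  also have "(\<integral> z. (\<Sum>v\<in>DN. \<Sum>v'\<in>DN. ?g v z * ?g v' z) \<partial>?T) = (\<Sum>v\<in>DN. \<integral> z. (\<Sum>v'\<in>DN. ?g v z * ?g v' z) \<partial>?T)"
    by (intro Bochner_Integration.integral_sum Bochner_Integration.integrable_sum gg(1))
  also have "\<dots> = (\<Sum>v\<in>DN. \<Sum>v'\<in>DN. \<integral> z. ?g v z * ?g v' z \<partial>?T)"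
    by (rule sum.cong[OF refl], rule Bochner_Integration.integral_sum, rule gg(1))
  also have "\<dots> = (\<Sum>v\<in>DN. \<Sum>v'\<in>DN. Kov v v' * (if snd v = snd v' then \<sigma>\<^sup>2 else 0) * (x (fst v) * x (fst v')))"
    by (rule sum.cong[OF refl], rule sum.cong[OF refl], rule gg(2))
  finally show ?thesis by simp
qed

end

end

section \<open>Integrating out the signal and the test point\<close>

context haar_law
begin

context
  fixes \<alpha> :: real
  assumes d: "0 < d"
begin

abbreviation "TT \<equiv> iid_vec (centered_normal (\<alpha> / sqrt (real d))) d"
abbreviation "XX \<equiv> iid_vec \<mu> d"

interpretation T: centered "centered_normal (\<alpha> / sqrt (real d))" "(\<alpha> / sqrt (real d))\<^sup>2" by (rule centered_normal)
interpretation U: centered \<mu> 1 by (rule centered)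
interpretation TT: prob_space TT by (rule T.iid_vec_prob)
interpretation XX: prob_space XX by (rule U.iid_vec_prob)

lemma test_quad:
  assumes j: "j < d" "j' < d" and k: "k < d" "k' < d"
  shows "integrable (test_law \<mu> \<alpha> d) (\<lambda>z. (snd z j * snd z j') * (fst z k * fst z k'))"
    "(\<integral> z. (snd z j * snd z j') * (fst z k * fst z k') \<partial>test_law \<mu> \<alpha> d) =
      (if j = j' \<and> k = k' then \<alpha>\<^sup>2 / real d else 0)"
proof -
  have eq: "(\<lambda>z. (snd z j * snd z j') * (fst z k * fst z k')) =
      (\<lambda>z :: (nat \<Rightarrow> real) \<times> (nat \<Rightarrow> real). (fst z k * fst z k') * (snd z j * snd z j'))"
    by (rule ext) (simp only: mult_ac)
  note P = pair_product[OF TT.prob_space_axioms XX.prob_space_axioms T.iid_vec_cross(1)[OF k] U.iid_vec_cross(1)[OF j]]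
  show "integrable (test_law \<mu> \<alpha> d) (\<lambda>z. (snd z j * snd z j') * (fst z k * fst z k'))"
    unfolding test_law_def eq by (rule P(1))
  show "(\<integral> z. (snd z j * snd z j') * (fst z k * fst z k') \<partial>test_law \<mu> \<alpha> d) =
      (if j = j' \<and> k = k' then \<alpha>\<^sup>2 / real d else 0)"
    unfolding test_law_def eq P(2) T.iid_vec_cross(2)[OF k] U.iid_vec_cross(2)[OF j]
    by (simp add: power_divide)
qed

lemma test_sq:
  assumes j: "j < d" "j' < d"
  shows "integrable (test_law \<mu> \<alpha> d) (\<lambda>z. snd z j * snd z j')"
    "(\<integral> z. snd z j * snd z j' \<partial>test_law \<mu> \<alpha> d) = (if j = j' then 1 else 0)"
proof -
  have one: "integrable TT (\<lambda>_. 1 :: real)" by simp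
  note P = pair_product[OF TT.prob_space_axioms XX.prob_space_axioms one U.iid_vec_cross(1)[OF j]]
  show "integrable (test_law \<mu> \<alpha> d) (\<lambda>z. snd z j * snd z j')"
    "(\<integral> z. snd z j * snd z j' \<partial>test_law \<mu> \<alpha> d) = (if j = j' then 1 else 0)"
    unfolding test_law_def using P U.iid_vec_cross(2)[OF j] by (simp_all add: TT.prob_space)
qed

text \<open>The coordinates of \<open>x\<close> and \<open>\<theta>\<close> are independent and
  centred, so only pairs with \<open>u = u'\<close> remain, each weighted by the variance of one
  coordinate of \<open>\<theta>\<close>.\<close>

lemma test_quad_sum:
  fixes B :: "nat \<times> nat \<Rightarrow> nat \<times> nat \<Rightarrow> real"
  shows "integrable (test_law \<mu> \<alpha> d) (\<lambda>z. \<Sum>u\<in>DD. \<Sum>u'\<in>DD. B u u' *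
      ((snd z (fst u) * snd z (fst u')) * (fst z (snd u) * fst z (snd u'))))"
    "(\<integral> z. (\<Sum>u\<in>DD. \<Sum>u'\<in>DD. B u u' *
      ((snd z (fst u) * snd z (fst u')) * (fst z (snd u) * fst z (snd u')))) \<partial>test_law \<mu> \<alpha> d)
      = \<alpha>\<^sup>2 / real d * (\<Sum>u\<in>DD. B u u)"
proof -
  let ?h = "\<lambda>u u' z. B u u' * ((snd z (fst u) * snd z (fst u')) * (fst z (snd u) * fst z (snd u')))
    :: real"
  have i: "integrable (test_law \<mu> \<alpha> d) (?h u u')" if "u \<in> DD" "u' \<in> DD" for u u'
    using that by (intro integrable_mult_right test_quad) auto
  show "integrable (test_law \<mu> \<alpha> d) (\<lambda>z. \<Sum>u\<in>DD. \<Sum>u'\<in>DD. ?h u u' z)"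
    by (intro Bochner_Integration.integrable_sum i)
  have "(\<integral> z. (\<Sum>u\<in>DD. \<Sum>u'\<in>DD. ?h u u' z) \<partial>test_law \<mu> \<alpha> d) = (\<Sum>u\<in>DD. \<integral> z. (\<Sum>u'\<in>DD. ?h u u' z) \<partial>test_law \<mu> \<alpha> d)"
    by (intro Bochner_Integration.integral_sum Bochner_Integration.integrable_sum i)
  also have "\<dots> = (\<Sum>u\<in>DD. \<Sum>u'\<in>DD. \<integral> z. ?h u u' z \<partial>test_law \<mu> \<alpha> d)"
    by (rule sum.cong[OF refl], rule Bochner_Integration.integral_sum, rule i)
  also have "\<dots> = (\<Sum>u\<in>DD. \<Sum>u'\<in>DD. if u = u' then B u u * (\<alpha>\<^sup>2 / real d) else 0)"
  proof (rule sum.cong[OF refl], rule sum.cong[OF refl])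
    fix u u' assume "u \<in> DD" "u' \<in> DD"
    then have b: "fst u < d" "fst u' < d" "snd u < d" "snd u' < d" by auto
    show "(\<integral> z. ?h u u' z \<partial>test_law \<mu> \<alpha> d) = (if u = u' then B u u * (\<alpha>\<^sup>2 / real d) else 0)"
      unfolding integral_mult_right_zero test_quad(2)[OF b] prod_eq_iff[symmetric] by simp
  qed
  also have "\<dots> = (\<Sum>u\<in>DD. B u u * (\<alpha>\<^sup>2 / real d))" by (intro sum.cong refl) simp
  finally show "(\<integral> z. (\<Sum>u\<in>DD. \<Sum>u'\<in>DD. ?h u u' z) \<partial>test_law \<mu> \<alpha> d) = \<alpha>\<^sup>2 / real d * (\<Sum>u\<in>DD. B u u)"
    by (simp add: sum_distrib_left mult_ac)
qed

lemma sum_DD: "(\<Sum>u\<in>DD. f u) = (\<Sum>j<d. \<Sum>k<d. f (j, k))" for f :: "nat \<times> nat \<Rightarrow> real"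
  by (simp add: sum.cartesian_product case_prod_beta')

lemma bias_sq_eq: "bias_sq \<mu> \<alpha> \<sigma> N l n p d = \<alpha>\<^sup>2 * ((m - 1)\<^sup>2 + off_diag)"
proof -
  let ?b = "\<lambda>u :: nat \<times> nat. EMf u - (if fst u = snd u then 1 else 0)"
  have "(mean_prediction \<mu> \<sigma> N l n p d \<theta> x - scalar_prod (Matrix.vec d x) (Matrix.vec d \<theta>))\<^sup>2 =
      (\<Sum>u\<in>DD. \<Sum>u'\<in>DD. ?b u * ?b u' * ((x (fst u) * x (fst u')) * (\<theta> (snd u) * \<theta> (snd u'))))" for \<theta> x
  proof -
    have "scalar_prod (Matrix.vec d x) (Matrix.vec d \<theta>) = (\<Sum>j<d. x j * \<theta> j)"
      by (subst scalar_prod_sum[of _ d]) auto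
    also have "\<dots> = (\<Sum>u\<in>DD. x (fst u) * \<theta> (snd u) * (if fst u = snd u then 1 else 0))"
      unfolding sum_DD by (intro sum.cong refl) (auto simp: if_distrib[of "\<lambda>t. _ * t"] cong: if_cong)
    finally have "mean_prediction \<mu> \<sigma> N l n p d \<theta> x - scalar_prod (Matrix.vec d x) (Matrix.vec d \<theta>)
        = (\<Sum>u\<in>DD. x (fst u) * \<theta> (snd u) * ?b u)"
      unfolding mean_prediction_eq by (simp only: right_diff_distrib sum_subtractf)
    then show ?thesis
      unfolding power2_eq_square by (simp only: sum_product) (intro sum.cong refl, simp only: mult_ac)
  qed
  then have "bias_sq \<mu> \<alpha> \<sigma> N l n p d = (\<integral> z. (\<Sum>u\<in>DD. \<Sum>u'\<in>DD. ?b u * ?b u' *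
      ((snd z (fst u) * snd z (fst u')) * (fst z (snd u) * fst z (snd u')))) \<partial>test_law \<mu> \<alpha> d)"
    unfolding bias_sq_def by (simp only: split_def)
  also have "\<dots> = \<alpha>\<^sup>2 / real d * (\<Sum>u\<in>DD. ?b u * ?b u)"
    by (rule test_quad_sum(2))
  also have "(\<Sum>u\<in>DD. ?b u * ?b u) = (\<Sum>j<d. \<Sum>k<d. (EM j k - (if j = k then 1 else 0))\<^sup>2)"
    unfolding sum_DD by (simp add: EMf_def EM_def Mf_def power2_eq_square)
  also have "\<alpha>\<^sup>2 / real d * \<dots> = \<alpha>\<^sup>2 * (\<dots> / real d)" by simp
  finally show ?thesis by (simp only: sum_EM_minus_one_sq[OF d])
qed

lemma sum_Cov: "(\<Sum>u\<in>DD. Cov u u) = (\<integral> \<omega>. frob_sq (Mm \<omega>) \<partial>\<Omega>) - (\<Sum>j<d. \<Sum>k<d. (EM j k)\<^sup>2)"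
proof -
  have "Cov u u = (\<integral> \<omega>. (Mf \<omega> u)\<^sup>2 \<partial>\<Omega>) - (EMf u)\<^sup>2" if u: "u \<in> DD" for u
    using MXN.variance_eq[OF Mf_int[OF u] Mf_sq[OF u]] by (simp add: Cov_def EMf_def power2_eq_square)
  then have "(\<Sum>u\<in>DD. Cov u u) = (\<Sum>u\<in>DD. (\<integral> \<omega>. (Mf \<omega> u)\<^sup>2 \<partial>\<Omega>)) - (\<Sum>u\<in>DD. (EMf u)\<^sup>2)"
    by (simp add: sum_subtractf)
  also have "(\<Sum>u\<in>DD. (\<integral> \<omega>. (Mf \<omega> u)\<^sup>2 \<partial>\<Omega>)) = (\<integral> \<omega>. (\<Sum>u\<in>DD. (Mf \<omega> u)\<^sup>2) \<partial>\<Omega>)"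
    by (intro Bochner_Integration.integral_sum[symmetric] Mf_sq)
  also have "(\<lambda>\<omega>. \<Sum>u\<in>DD. (Mf \<omega> u)\<^sup>2) = (\<lambda>\<omega>. frob_sq (Mm \<omega>))"
    unfolding sum_DD Mf_def by (rule ext) (simp only: frob_sq_eq[OF Mm_carrier])
  also have "(\<Sum>u\<in>DD. (EMf u)\<^sup>2) = (\<Sum>j<d. \<Sum>k<d. (EM j k)\<^sup>2)"
    unfolding sum_DD by (simp add: EMf_def EM_def Mf_def)
  finally show ?thesis .
qed

lemma sum_Kov: "(\<Sum>v\<in>DN. Kov v v) = (\<integral> \<omega>. noise_term \<omega> \<partial>\<Omega>)"
proof -
  have "(\<Sum>v\<in>DN. Kov v v) = (\<integral> \<omega>. (\<Sum>v\<in>DN. (Nf \<omega> v)\<^sup>2) \<partial>\<Omega>)"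
    unfolding Kov_def power2_eq_square[symmetric]
    by (intro Bochner_Integration.integral_sum[symmetric] Nf_sq)
  then show ?thesis by (simp only: sum_Nf_sq)
qed

lemma variance_pred_eq:
  "variance_pred \<mu> \<alpha> \<sigma> N l n p d =
    \<alpha>\<^sup>2 * ((\<integral> \<omega>. frob_sq (Mm \<omega>) \<partial>\<Omega>) / real d - (m\<^sup>2 + off_diag)) + \<sigma>\<^sup>2 * (\<integral> \<omega>. noise_term \<omega> \<partial>\<Omega>)"
proof -
  let ?k = "\<lambda>v v' z. Kov v v' * (if snd v = snd v' then \<sigma>\<^sup>2 else 0) * (snd z (fst v) * snd z (fst v')) :: real"
  let ?L = "test_law \<mu> \<alpha> d"
  have ki: "integrable ?L (?k v v')" if "v \<in> DN" "v' \<in> DN" for v v'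
    using that by (intro integrable_mult_right test_sq) auto
  have "variance_pred \<mu> \<alpha> \<sigma> N l n p d = (\<integral> z. (\<Sum>u\<in>DD. \<Sum>u'\<in>DD. Cov u u' *
      ((snd z (fst u) * snd z (fst u')) * (fst z (snd u) * fst z (snd u')))) + (\<Sum>v\<in>DN. \<Sum>v'\<in>DN. ?k v v' z) \<partial>?L)"
    unfolding variance_pred_def variance_inner by (simp only: split_def)
  also have "\<dots> = (\<integral> z. (\<Sum>u\<in>DD. \<Sum>u'\<in>DD. Cov u u' *
      ((snd z (fst u) * snd z (fst u')) * (fst z (snd u) * fst z (snd u')))) \<partial>?L) +
      (\<integral> z. (\<Sum>v\<in>DN. \<Sum>v'\<in>DN. ?k v v' z) \<partial>?L)"
    by (intro Bochner_Integration.integral_add Bochner_Integration.integrable_sum ki test_quad_sum(1))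
  also have "(\<integral> z. (\<Sum>u\<in>DD. \<Sum>u'\<in>DD. Cov u u' *
      ((snd z (fst u) * snd z (fst u')) * (fst z (snd u) * fst z (snd u')))) \<partial>?L) = \<alpha>\<^sup>2 / real d * (\<Sum>u\<in>DD. Cov u u)"
    by (rule test_quad_sum(2))
  also have "(\<integral> z. (\<Sum>v\<in>DN. \<Sum>v'\<in>DN. ?k v v' z) \<partial>?L) = (\<Sum>v\<in>DN. \<integral> z. (\<Sum>v'\<in>DN. ?k v v' z) \<partial>?L)"
    by (intro Bochner_Integration.integral_sum Bochner_Integration.integrable_sum ki)
  also have "\<dots> = (\<Sum>v\<in>DN. \<Sum>v'\<in>DN. \<integral> z. ?k v v' z \<partial>?L)"
    by (rule sum.cong[OF refl], rule Bochner_Integration.integral_sum, rule ki)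
  also have "\<dots> = (\<Sum>v\<in>DN. \<Sum>v'\<in>DN. if v = v' then Kov v v * \<sigma>\<^sup>2 else 0)"
  proof (rule sum.cong[OF refl], rule sum.cong[OF refl])
    fix v v' assume "v \<in> DN" "v' \<in> DN"
    then have b: "fst v < d" "fst v' < d" by auto
    show "(\<integral> z. ?k v v' z \<partial>?L) = (if v = v' then Kov v v * \<sigma>\<^sup>2 else 0)"
      unfolding integral_mult_right_zero test_sq(2)[OF b]
      using prod_eq_iff[of v v'] by (cases "v = v'") simp_all
  qed
  also have "\<dots> = (\<Sum>v\<in>DN. Kov v v * \<sigma>\<^sup>2)" by (intro sum.cong refl) simp
  also have "\<dots> = \<sigma>\<^sup>2 * (\<Sum>v\<in>DN. Kov v v)" by (simp only: sum_distrib_left mult.commute)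
  also have "\<alpha>\<^sup>2 / real d * (\<Sum>u\<in>DD. Cov u u) =
      \<alpha>\<^sup>2 * ((\<integral> \<omega>. frob_sq (Mm \<omega>) \<partial>\<Omega>) / real d - (\<Sum>j<d. \<Sum>k<d. (EM j k)\<^sup>2) / real d)"
    unfolding sum_Cov by (simp only: diff_divide_distrib[symmetric] times_divide_eq_left times_divide_eq_right)
  finally show ?thesis unfolding sum_EM_sq[OF d] sum_Kov .
qed

end

end

section \<open>Passage to the limit\<close>

text \<open>At \<open>r = c / l\<close> the linear term alone already equals \<open>c\<close>, which
  gives the upper end for the intermediate value theorem.\<close>

lemma fixed_point_exists:
  fixes c l :: real
  assumes c: "0 < c" and l: "0 < l"
  obtains r where "0 \<le> r" "l * r + r / (1 + r) = c"
proof -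
  have "\<exists>r. 0 \<le> r \<and> r \<le> c / l \<and> l * r + r / (1 + r) = c"
  proof (rule IVT')
    show "l * 0 + 0 / (1 + 0) \<le> c" using c by simp
    show "c \<le> l * (c / l) + c / l / (1 + c / l)" using c l by simp
    show "0 \<le> c / l" using c l by simp
    show "continuous_on {0..c / l} (\<lambda>r. l * r + r / (1 + r))"
      by (intro continuous_intros) auto
  qed
  then show ?thesis using that by blast
qed

text \<open>The difference quotient is \<open>l + 1 / ((1 + r) (1 + s))\<close>, hence at least
  \<open>l\<close>: an approximate solution is close to the exact one, with a rate.\<close>

lemma fixed_point_dist_le:
  fixes r s l :: real
  assumes "0 \<le> r" "0 \<le> s" "0 < l"
  shows "l * \<bar>r - s\<bar> \<le> \<bar>(l * r + r / (1 + r)) - (l * s + s / (1 + s))\<bar>"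
proof -
  have "r / (1 + r) - s / (1 + s) = (r - s) / ((1 + r) * (1 + s))"
    using assms by (simp add: field_simps)
  then have "(l * r + r / (1 + r)) - (l * s + s / (1 + s)) = (r - s) * (l + 1 / ((1 + r) * (1 + s)))"
    by (simp add: algebra_simps)
  then have "\<bar>(l * r + r / (1 + r)) - (l * s + s / (1 + s))\<bar> = \<bar>r - s\<bar> * (l + 1 / ((1 + r) * (1 + s)))"
    using assms by (simp add: abs_mult)
  also have "\<dots> \<ge> \<bar>r - s\<bar> * l" using assms by (intro mult_left_mono) auto
  finally show ?thesis by (simp add: mult.commute)
qed

context haar_law
begin

lemma res_trace_dist_le:
  assumes s: "0 \<le> s"
  shows "\<bar>(\<integral> \<omega>. res_trace \<omega> \<partial>\<Omega>) - s\<bar> \<le> (sqrt (\<kappa> * (real d / l\<^sup>2)) / real n + 1 / (l * real n)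
    + \<bar>real p / real n - (l * s + s / (1 + s))\<bar>) / l"
proof -
  let ?f = "\<lambda>\<omega>. \<bar>l * res_trace \<omega> + res_trace \<omega> / (1 + res_trace \<omega>) - real p / real n\<bar>"
  let ?c = "\<bar>real p / real n - (l * s + s / (1 + s))\<bar>"
  have ri: "integrable \<Omega> (\<lambda>\<omega>. \<bar>res_trace \<omega> - s\<bar>)" using res_trace_integrable by simp
  have fi: "integrable \<Omega> (\<lambda>\<omega>. (?f \<omega> + ?c) / l)" using integral_fixed_point_le(2) by simp
  have "\<bar>(\<integral> \<omega>. res_trace \<omega> \<partial>\<Omega>) - s\<bar> = \<bar>\<integral> \<omega>. res_trace \<omega> - s \<partial>\<Omega>\<bar>"
    using res_trace_integrable by (simp add: MXN.prob_space)
  also have "\<dots> \<le> (\<integral> \<omega>. \<bar>res_trace \<omega> - s\<bar> \<partial>\<Omega>)" by (rule integral_abs_bound)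
  also have "\<dots> \<le> (\<integral> \<omega>. (?f \<omega> + ?c) / l \<partial>\<Omega>)"
  proof (rule integral_mono_AE[OF ri fi])
    show "AE \<omega> in \<Omega>. \<bar>res_trace \<omega> - s\<bar> \<le> (?f \<omega> + ?c) / l"
      using AE_ridge_orth
    proof eventually_elim
      fix \<omega> assume "ridge_orth d n p l (Wm \<omega>) (Xm \<omega>)"
      then have "l * \<bar>res_trace \<omega> - s\<bar> \<le> \<bar>(l * res_trace \<omega> + res_trace \<omega> / (1 + res_trace \<omega>)) - (l * s + s / (1 + s))\<bar>"
        using res_trace_bounds s l by (intro fixed_point_dist_le)
      then have "l * \<bar>res_trace \<omega> - s\<bar> \<le> ?f \<omega> + ?c" by linarith
      then show "\<bar>res_trace \<omega> - s\<bar> \<le> (?f \<omega> + ?c) / l" using l by (simp add: pos_le_divide_eq mult.commute)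
    qed
  qed
  also have "\<dots> = ((\<integral> \<omega>. ?f \<omega> \<partial>\<Omega>) + ?c) / l"
    using integral_fixed_point_le(2) by (simp add: MXN.prob_space)
  also have "\<dots> \<le> (sqrt (\<kappa> * (real d / l\<^sup>2)) / real n + 1 / (l * real n) + ?c) / l"
    using l integral_fixed_point_le(1) by (intro divide_right_mono add_mono) auto
  finally show ?thesis .
qed

lemma ETm_bounds: "0 \<le> (\<integral> \<omega>. noise_term \<omega> \<partial>\<Omega>)" "(\<integral> \<omega>. noise_term \<omega> \<partial>\<Omega>) \<le> 1 / l"
proof -
  show "0 \<le> (\<integral> \<omega>. noise_term \<omega> \<partial>\<Omega>)"
    using AE_ridge_orth by (intro integral_nonneg_AE) (auto elim!: eventually_mono intro: noise_term_bounds)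
  have "(\<integral> \<omega>. noise_term \<omega> \<partial>\<Omega>) \<le> (\<integral> \<omega>. 1 / l \<partial>\<Omega>)"
    using AE_ridge_orth by (intro integral_mono_AE noise_term_integrable) (auto elim!: eventually_mono intro: noise_term_bounds)
  then show "(\<integral> \<omega>. noise_term \<omega> \<partial>\<Omega>) \<le> 1 / l" by (simp add: MXN.prob_space)
qed

lemma m_res_trace: "m = real p / real d - l * (real n / real d) * (\<integral> \<omega>. res_trace \<omega> \<partial>\<Omega>)"
  unfolding m_def integral_tr_Mm by (simp add: diff_divide_distrib)

lemma frob_sq_dist_le:
  assumes d: "0 < d"
  shows "\<bar>(\<integral> \<omega>. frob_sq (Mm \<omega>) \<partial>\<Omega>) / real d -
      (m + (1 - real p / real d - l * (real n / real d)) * (\<integral> \<omega>. noise_term \<omega> \<partial>\<Omega>))\<bar>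
    \<le> (sqrt (\<kappa> * real d) / l + (sqrt (\<kappa> * (1 / l ^ 4 * gram_bound)) + sqrt (\<kappa> * (1 / l\<^sup>2 * gram_bound)) / l)) / real d"
proof -
  let ?x = "(\<integral> \<omega>. frob_sq (Mm \<omega>) \<partial>\<Omega>)" and ?t = "(\<integral> \<omega>. tr (Mm \<omega>) \<partial>\<Omega>)" and ?T = "(\<integral> \<omega>. noise_term \<omega> \<partial>\<Omega>)"
  have "?x / real d - (m + (1 - real p / real d - l * (real n / real d)) * ?T) =
      (?x - (?t - l * real n * ?T + (real d - real p) * ?T)) / real d"
    using d by (simp add: m_def field_simps)
  then show ?thesis using integral_frob_sq_Mm_approx d by (simp add: divide_right_mono)
qed

end

lemma tendsto_zeroI:
  fixes f g :: "nat \<Rightarrow> real"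
  assumes "eventually (\<lambda>d. \<bar>f d\<bar> \<le> g d) sequentially" and "g \<longlonglongrightarrow> 0"
  shows "f \<longlonglongrightarrow> 0"
  by (rule Lim_null_comparison[OF _ assms(2)]) (use assms(1) in simp)

section \<open>Convergence of bias and variance at \<open>lam\<close>\<close>

theorem mainTheorem10:
  fixes \<alpha> \<sigma> \<pi> \<delta> \<eta> lam :: real
    and p n :: "nat \<Rightarrow> nat"
    and \<mu> :: "real measure"
    and \<nu> :: "nat \<Rightarrow> (nat \<times> nat \<Rightarrow> real) measure"
  assumes "\<alpha> > 0" and "\<sigma> \<ge> 0"
    and "0 < \<pi>" and "\<pi> \<le> 1" and "0 < \<delta>"
    and "\<And>d. p d \<le> d"
    and "(\<lambda>d. real (p d) / real d) \<longlonglongrightarrow> \<pi>"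
    and "(\<lambda>d. real d / real (n d)) \<longlonglongrightarrow> \<delta>"
    and "prob_space \<mu>" and "sets \<mu> = sets borel"
    and "prob_space.expectation \<mu> (\<lambda>t. t) = 0"
    and "prob_space.variance \<mu> (\<lambda>t. t) = 1"
    and "\<eta> > 0" and "integrable \<mu> (\<lambda>t. \<bar>t\<bar> powr (8 + \<eta>))"
    and "\<And>d. uniform_orthonormal_rows (p d) d (\<nu> d)"
    and "lam = \<delta> * (1 - \<pi> + \<sigma>\<^sup>2 / \<alpha>\<^sup>2)" and "lam > 0"
  shows "convergent (\<lambda>d. bias_sq \<mu> \<alpha> \<sigma> (\<nu> d) lam (n d) (p d) d) \<and>
         convergent (\<lambda>d. variance_pred \<mu> \<alpha> \<sigma> (\<nu> d) lam (n d) (p d) d) \<and>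
         (let Bias = sqrt (lim (\<lambda>d. bias_sq \<mu> \<alpha> \<sigma> (\<nu> d) lam (n d) (p d) d));
              Var = lim (\<lambda>d. variance_pred \<mu> \<alpha> \<sigma> (\<nu> d) lam (n d) (p d) d)
          in Var = Bias * (\<alpha> - Bias))"
proof -
  interpret mu: prob_space \<mu> by fact
  have meas: "(\<lambda>t :: real. t ^ 4) \<in> borel_measurable \<mu>"
    by (subst measurable_cong_sets[OF assms(10) refl]) simp
  have fourth: "integrable \<mu> (\<lambda>t. t ^ 4)"
  proof (rule Bochner_Integration.integrable_bound)
    show "integrable \<mu> (\<lambda>t. 1 + \<bar>t\<bar> powr (8 + \<eta>))" using assms(14) by simp
    show "AE t in \<mu>. norm (t ^ 4) \<le> norm (1 + \<bar>t\<bar> powr (8 + \<eta>))"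
    proof (rule AE_I2)
      fix t :: real
      have "\<bar>t\<bar> ^ 4 \<le> 1 + \<bar>t\<bar> powr (8 + \<eta>)"
      proof (cases "\<bar>t\<bar> \<le> 1")
        case True
        then have "\<bar>t\<bar> ^ 4 \<le> 1" by (intro power_le_one) auto
        then show ?thesis by (smt (verit) powr_ge_zero)
      next
        case False
        then have "\<bar>t\<bar> ^ 4 = \<bar>t\<bar> powr 4" by (simp add: powr_numeral)
        also have "\<dots> \<le> \<bar>t\<bar> powr (8 + \<eta>)" using False assms(13) by (intro powr_mono) auto
        finally show ?thesis by simp
      qed
      then show "norm (t ^ 4) \<le> norm (1 + \<bar>t\<bar> powr (8 + \<eta>))" by (simp add: power_abs)
    qed
  qed (rule meas)
  interpret mu: unit_entries \<mu>
    by unfold_locales (use assms(10,11,12) fourth in simp_all)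
  have l: "0 < lam" by fact
  have d_large: "eventually (\<lambda>d. 2 \<le> d) sequentially" by (rule eventually_ge_at_top)
  \<comment> \<open>Division by zero gives 0, so a quotient bounded away from 0 rules out
    \<open>n d = 0\<close>.\<close>
  have "eventually (\<lambda>d. \<delta> / 2 < real d / real (n d)) sequentially"
    using assms(5,8) by (intro order_tendstoD(1)) auto
  then have n_pos: "eventually (\<lambda>d. 0 < n d) sequentially"
    by eventually_elim (use assms(5) in \<open>auto intro: gr0I\<close>)
  have law: "haar_law \<mu> (\<nu> d) (n d) d (p d) lam" if "0 < n d" for d
  proof -
    have u: "uniform_orthonormal_rows (p d) d (\<nu> d)" by fact
    then interpret nu: prob_space "\<nu> d" by (simp add: uniform_orthonormal_rows_def)
    show ?thesis
      using u that l assms(6)[of d] unfolding uniform_orthonormal_rows_def by unfold_locales auto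
  qed
  define m where "m d = haar_law.m \<mu> (\<nu> d) (n d) d (p d) lam" for d
  define off_diag where "off_diag d = haar_law.off_diag \<mu> (\<nu> d) (n d) d (p d) lam" for d
  define V where "V d = (\<integral> \<omega>. frob_sq (sketch_law.Mm (n d) d (p d) lam \<omega>) \<partial>(iid_mat \<mu> (n d) d \<Otimes>\<^sub>M \<nu> d)) / real d" for d
  define T where "T d = (\<integral> \<omega>. sketch_law.noise_term (n d) d (p d) lam \<omega> \<partial>(iid_mat \<mu> (n d) d \<Otimes>\<^sub>M \<nu> d))" for d
  define R where "R d = (\<integral> \<omega>. sketch_law.res_trace (n d) d (p d) lam \<omega> \<partial>(iid_mat \<mu> (n d) d \<Otimes>\<^sub>M \<nu> d))" for d
  define c where "c d = 1 - real (p d) / real d - lam * (real (n d) / real d)" for d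
  \<comment> \<open>Error terms: \<open>e\<close> for the fixed-point equation, \<open>F\<close> for
    \<open>gram_bound\<close> divided by d^2, and \<open>h\<close> for the squared norm of
    \<open>M\<close> divided by d.\<close>
  define e where "e d = sqrt (mu.\<kappa> * (real d / lam\<^sup>2)) / real (n d) + 1 / (lam * real (n d))" for d
  define F where "F d = 1 / real d + mu.m4 * (1 / real (n d))" for d
  define h where "h d = sqrt (mu.\<kappa> / real d) / lam +
    (sqrt (mu.\<kappa> * (1 / lam ^ 4) * F d) + sqrt (mu.\<kappa> * (1 / lam\<^sup>2) * F d) / lam)" for d
  \<comment> \<open>The limiting fixed-point equation, with \<open>\<pi> * \<delta>\<close> as the
    limit of p/n.\<close>
  obtain s where s: "0 \<le> s" "lam * s + s / (1 + s) = \<pi> * \<delta>"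
    using fixed_point_exists[of "\<pi> * \<delta>" lam] assms(3,5) l by auto
  \<comment> \<open>The bound on \<open>off_diag\<close> divides by \<open>d - 1\<close>, hence
    \<open>2 \<le> d\<close>.\<close>
  have fin: "eventually (\<lambda>d. 2 \<le> d \<and> 0 < n d) sequentially"
    using d_large n_pos by eventually_elim simp
  have facts: "bias_sq \<mu> \<alpha> \<sigma> (\<nu> d) lam (n d) (p d) d = \<alpha>\<^sup>2 * ((m d - 1)\<^sup>2 + off_diag d)"
    "variance_pred \<mu> \<alpha> \<sigma> (\<nu> d) lam (n d) (p d) d = \<alpha>\<^sup>2 * (V d - ((m d)\<^sup>2 + off_diag d)) + \<sigma>\<^sup>2 * T d"
    "m d = real (p d) / real d - lam * (real (n d) / real d) * R d"
    "0 \<le> m d" "m d \<le> 1" "\<bar>off_diag d\<bar> \<le> (1 / lam + 1)\<^sup>2 / (real d - 1)" "\<bar>T d\<bar> \<le> 1 / lam"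
    "\<bar>R d - s\<bar> \<le> (e d + \<bar>real (p d) / real (n d) - \<pi> * \<delta>\<bar>) / lam"
    "\<bar>V d - (m d + c d * T d)\<bar> \<le> h d"
    if d: "2 \<le> d \<and> 0 < n d" for d
  proof -
    interpret H: haar_law \<mu> "\<nu> d" "n d" d "p d" lam using d by (intro law) simp
    have d0: "0 < d" and d1: "1 < d" using d by auto
    show "bias_sq \<mu> \<alpha> \<sigma> (\<nu> d) lam (n d) (p d) d = \<alpha>\<^sup>2 * ((m d - 1)\<^sup>2 + off_diag d)"
      unfolding m_def off_diag_def by (rule H.bias_sq_eq[OF d0])
    show "variance_pred \<mu> \<alpha> \<sigma> (\<nu> d) lam (n d) (p d) d = \<alpha>\<^sup>2 * (V d - ((m d)\<^sup>2 + off_diag d)) + \<sigma>\<^sup>2 * T d"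
      unfolding m_def off_diag_def V_def T_def by (rule H.variance_pred_eq[OF d0])
    show "m d = real (p d) / real d - lam * (real (n d) / real d) * R d"
      unfolding m_def R_def by (rule H.m_res_trace)
    show "0 \<le> m d" "m d \<le> 1" unfolding m_def by (rule H.m_bounds)+
    show "\<bar>off_diag d\<bar> \<le> (1 / lam + 1)\<^sup>2 / (real d - 1)"
      unfolding off_diag_def using H.off_diag_bounds[OF d1] by simp
    show "\<bar>T d\<bar> \<le> 1 / lam" unfolding T_def using H.ETm_bounds by simp
    show "\<bar>R d - s\<bar> \<le> (e d + \<bar>real (p d) / real (n d) - \<pi> * \<delta>\<bar>) / lam"
      unfolding R_def e_def using H.res_trace_dist_le[OF s(1)] unfolding s(2) .
    have root: "sqrt (mu.\<kappa> * (w * H.gram_bound)) / real d = sqrt (mu.\<kappa> * w * F d)" for w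
    proof -
      have "mu.\<kappa> * w * F d = mu.\<kappa> * (w * H.gram_bound) / (real d)\<^sup>2"
        using d0 d by (simp add: H.gram_bound_def F_def power2_eq_square field_simps)
      then show ?thesis by (simp add: real_sqrt_divide)
    qed
    have root': "sqrt (mu.\<kappa> * real d) / real d = sqrt (mu.\<kappa> / real d)"
    proof -
      have "mu.\<kappa> / real d = mu.\<kappa> * real d / (real d)\<^sup>2" using d0 by (simp add: power2_eq_square)
      then show ?thesis by (simp add: real_sqrt_divide)
    qed
    have "h d = (sqrt (mu.\<kappa> * real d) / lam + (sqrt (mu.\<kappa> * (1 / lam ^ 4 * H.gram_bound)) +
        sqrt (mu.\<kappa> * (1 / lam\<^sup>2 * H.gram_bound)) / lam)) / real d"
      unfolding h_def root[symmetric] root'[symmetric] by (simp add: add_divide_distrib mult.commute)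
    then show "\<bar>V d - (m d + c d * T d)\<bar> \<le> h d"
      using H.frob_sq_dist_le[OF d0] unfolding V_def m_def c_def T_def by simp
  qed
  have inv_d: "(\<lambda>d. 1 / real d) \<longlonglongrightarrow> 0" by (rule lim_1_over_n)
  have inv_n: "(\<lambda>d. 1 / real (n d)) \<longlonglongrightarrow> 0"
  proof (rule Lim_transform_eventually)
    show "(\<lambda>d. real d / real (n d) * (1 / real d)) \<longlonglongrightarrow> 0"
      using tendsto_mult[OF assms(8) inv_d] by simp
    show "eventually (\<lambda>d. real d / real (n d) * (1 / real d) = 1 / real (n d)) sequentially"
      using fin by eventually_elim simp
  qed
  have nd: "(\<lambda>d. real (n d) / real d) \<longlonglongrightarrow> 1 / \<delta>"
    using tendsto_inverse[OF assms(8)] assms(5) by (simp add: inverse_eq_divide)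
  have pn: "(\<lambda>d. real (p d) / real (n d)) \<longlonglongrightarrow> \<pi> * \<delta>"
  proof (rule Lim_transform_eventually)
    show "(\<lambda>d. real (p d) / real d * (real d / real (n d))) \<longlonglongrightarrow> \<pi> * \<delta>"
      by (rule tendsto_mult[OF assms(7,8)])
    show "eventually (\<lambda>d. real (p d) / real d * (real d / real (n d)) = real (p d) / real (n d)) sequentially"
      using fin by eventually_elim simp
  qed
  have e_lim: "e \<longlonglongrightarrow> 0"
  proof -
    have "(\<lambda>d. sqrt (mu.\<kappa> / lam\<^sup>2 * (real d / real (n d)) * (1 / real (n d))) + 1 / lam * (1 / real (n d)))
        \<longlonglongrightarrow> sqrt (mu.\<kappa> / lam\<^sup>2 * \<delta> * 0) + 1 / lam * 0"
      by (intro tendsto_intros assms(8) inv_n)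
    moreover have "sqrt (mu.\<kappa> / lam\<^sup>2 * (real d / real (n d)) * (1 / real (n d))) + 1 / lam * (1 / real (n d)) = e d" for d
      by (simp add: e_def real_sqrt_divide real_sqrt_mult power2_eq_square)
    ultimately show ?thesis by simp
  qed
  have F_lim: "F \<longlonglongrightarrow> 0"
    unfolding F_def using tendsto_add[OF inv_d tendsto_mult_right_zero[OF inv_n, of mu.m4]] by simp
  have h_lim: "h \<longlonglongrightarrow> 0"
  proof -
    have "(\<lambda>d. sqrt (mu.\<kappa> * (1 / real d)) / lam +
        (sqrt (mu.\<kappa> * (1 / lam ^ 4) * F d) + sqrt (mu.\<kappa> * (1 / lam\<^sup>2) * F d) / lam))
      \<longlonglongrightarrow> sqrt (mu.\<kappa> * 0) / lam +
        (sqrt (mu.\<kappa> * (1 / lam ^ 4) * 0) + sqrt (mu.\<kappa> * (1 / lam\<^sup>2) * 0) / lam)"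
      using l by (intro tendsto_intros inv_d F_lim) auto
    then show ?thesis unfolding h_def by simp
  qed
  have R_lim: "R \<longlonglongrightarrow> s"
  proof (rule Lim_transform_eventually[OF _ always_eventually])
    have "(\<lambda>d. R d - s) \<longlonglongrightarrow> 0"
    proof (rule tendsto_zeroI)
      show "eventually (\<lambda>d. \<bar>R d - s\<bar> \<le> (e d + \<bar>real (p d) / real (n d) - \<pi> * \<delta>\<bar>) / lam) sequentially"
        using fin by eventually_elim (rule facts(8))
      have "(\<lambda>d. (e d + \<bar>real (p d) / real (n d) - \<pi> * \<delta>\<bar>) / lam) \<longlonglongrightarrow> (0 + \<bar>\<pi> * \<delta> - \<pi> * \<delta>\<bar>) / lam"
        using l by (intro tendsto_intros e_lim pn) auto
      then show "(\<lambda>d. (e d + \<bar>real (p d) / real (n d) - \<pi> * \<delta>\<bar>) / lam) \<longlonglongrightarrow> 0" by simp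
    qed
    from tendsto_add[OF this tendsto_const[of s]] show "(\<lambda>d. R d - s + s) \<longlonglongrightarrow> s" by simp
  qed simp
  \<comment> \<open>The limit of the normalised trace of \<open>A S\<close>, read off from
    \<open>facts(3)\<close> with n/d tending to \<open>1 / \<delta>\<close>.\<close>
  define M where "M = \<pi> - lam * (1 / \<delta>) * s"
  have m_lim: "m \<longlonglongrightarrow> M"
  proof (rule Lim_transform_eventually)
    show "(\<lambda>d. real (p d) / real d - lam * (real (n d) / real d) * R d) \<longlonglongrightarrow> M"
      unfolding M_def by (intro tendsto_intros assms(7) nd R_lim)
    show "eventually (\<lambda>d. real (p d) / real d - lam * (real (n d) / real d) * R d = m d) sequentially"
      using fin by eventually_elim (simp add: facts(3))
  qed
  \<comment> \<open>Fixes the sign when the square root of the limiting bias is taken.\<close>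
  have M_le: "M \<le> 1"
  proof (rule tendsto_upperbound[OF m_lim])
    show "eventually (\<lambda>d. m d \<le> 1) sequentially"
      using fin by eventually_elim (rule facts(5))
  qed simp
  have off_diag_lim: "off_diag \<longlonglongrightarrow> 0"
  proof (rule tendsto_zeroI)
    show "eventually (\<lambda>d. \<bar>off_diag d\<bar> \<le> (1 / lam + 1)\<^sup>2 / (real d - 1)) sequentially"
      using fin by eventually_elim (rule facts(6))
    show "(\<lambda>d. (1 / lam + 1)\<^sup>2 / (real d - 1)) \<longlonglongrightarrow> 0"
      by (intro tendsto_divide_0[OF tendsto_const] filterlim_at_top_imp_at_infinity
          filterlim_tendsto_add_at_top[of "\<lambda>_. -1" "-1", simplified] filterlim_real_sequentially)
  qed
  \<comment> \<open>The place where the value of \<open>lam\<close> enters: it is the root of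
    \<open>\<alpha>\<^sup>2 * (1 - \<pi> - lam / \<delta>) + \<sigma>\<^sup>2 = 0\<close>.\<close>
  have c_lim: "(\<lambda>d. \<alpha>\<^sup>2 * c d + \<sigma>\<^sup>2) \<longlonglongrightarrow> 0"
  proof -
    have "(\<lambda>d. \<alpha>\<^sup>2 * c d + \<sigma>\<^sup>2) \<longlonglongrightarrow> \<alpha>\<^sup>2 * (1 - \<pi> - lam * (1 / \<delta>)) + \<sigma>\<^sup>2"
      unfolding c_def by (intro tendsto_intros assms(7) nd)
    also have "\<alpha>\<^sup>2 * (1 - \<pi> - lam * (1 / \<delta>)) + \<sigma>\<^sup>2 = 0"
      unfolding assms(16) using assms(1,5) by (simp add: field_simps)
    finally show ?thesis .
  qed
  \<comment> \<open>A bounded \<open>T\<close> against a vanishing coefficient; no limit of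
    \<open>T\<close> is involved.\<close>
  have cT_lim: "(\<lambda>d. (\<alpha>\<^sup>2 * c d + \<sigma>\<^sup>2) * T d) \<longlonglongrightarrow> 0"
  proof (rule tendsto_zeroI)
    show "eventually (\<lambda>d. \<bar>(\<alpha>\<^sup>2 * c d + \<sigma>\<^sup>2) * T d\<bar> \<le> \<bar>\<alpha>\<^sup>2 * c d + \<sigma>\<^sup>2\<bar> * (1 / lam)) sequentially"
      using fin by eventually_elim (unfold abs_mult, intro mult_left_mono facts(7), auto)
    show "(\<lambda>d. \<bar>\<alpha>\<^sup>2 * c d + \<sigma>\<^sup>2\<bar> * (1 / lam)) \<longlonglongrightarrow> 0"
      by (rule tendsto_mult_left_zero[OF tendsto_rabs_zero[OF c_lim]])
  qed
  have V_lim: "(\<lambda>d. V d - (m d + c d * T d)) \<longlonglongrightarrow> 0"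
  proof (rule tendsto_zeroI[OF _ h_lim])
    show "eventually (\<lambda>d. \<bar>V d - (m d + c d * T d)\<bar> \<le> h d) sequentially"
      using fin by eventually_elim (rule facts(9))
  qed
  have bias_lim: "(\<lambda>d. bias_sq \<mu> \<alpha> \<sigma> (\<nu> d) lam (n d) (p d) d) \<longlonglongrightarrow> (\<alpha> * (1 - M))\<^sup>2"
  proof (rule Lim_transform_eventually)
    have "(\<lambda>d. \<alpha>\<^sup>2 * ((m d - 1)\<^sup>2 + off_diag d)) \<longlonglongrightarrow> \<alpha>\<^sup>2 * ((M - 1)\<^sup>2 + 0)"
      by (intro tendsto_intros m_lim off_diag_lim)
    also have "\<alpha>\<^sup>2 * ((M - 1)\<^sup>2 + 0) = (\<alpha> * (1 - M))\<^sup>2"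
      by (simp add: power_mult_distrib power2_commute)
    finally show "(\<lambda>d. \<alpha>\<^sup>2 * ((m d - 1)\<^sup>2 + off_diag d)) \<longlonglongrightarrow> (\<alpha> * (1 - M))\<^sup>2" .
    show "eventually (\<lambda>d. \<alpha>\<^sup>2 * ((m d - 1)\<^sup>2 + off_diag d) = bias_sq \<mu> \<alpha> \<sigma> (\<nu> d) lam (n d) (p d) d) sequentially"
      using fin by eventually_elim (simp add: facts(1))
  qed
  \<comment> \<open>The variance is regrouped so that each piece has a known limit:
    \<open>c d * T d\<close> is subtracted with the approximation of \<open>V d\<close> and added
    back to the noise term, where the coefficient vanishes.\<close>
  have var_lim: "(\<lambda>d. variance_pred \<mu> \<alpha> \<sigma> (\<nu> d) lam (n d) (p d) d) \<longlonglongrightarrow> \<alpha>\<^sup>2 * (M - M\<^sup>2)"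
  proof (rule Lim_transform_eventually)
    show "(\<lambda>d. \<alpha>\<^sup>2 * (m d - (m d)\<^sup>2) + \<alpha>\<^sup>2 * (V d - (m d + c d * T d)) + (\<alpha>\<^sup>2 * c d + \<sigma>\<^sup>2) * T d - \<alpha>\<^sup>2 * off_diag d)
        \<longlonglongrightarrow> \<alpha>\<^sup>2 * (M - M\<^sup>2)"
    proof -
      have "(\<lambda>d. \<alpha>\<^sup>2 * (m d - (m d)\<^sup>2) + \<alpha>\<^sup>2 * (V d - (m d + c d * T d)) + (\<alpha>\<^sup>2 * c d + \<sigma>\<^sup>2) * T d - \<alpha>\<^sup>2 * off_diag d)
        \<longlonglongrightarrow> \<alpha>\<^sup>2 * (M - M\<^sup>2) + \<alpha>\<^sup>2 * 0 + 0 - \<alpha>\<^sup>2 * 0"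
        by (intro tendsto_add tendsto_diff tendsto_mult tendsto_power tendsto_const m_lim off_diag_lim cT_lim V_lim)
      then show ?thesis by simp
    qed
    show "eventually (\<lambda>d. \<alpha>\<^sup>2 * (m d - (m d)\<^sup>2) + \<alpha>\<^sup>2 * (V d - (m d + c d * T d)) + (\<alpha>\<^sup>2 * c d + \<sigma>\<^sup>2) * T d - \<alpha>\<^sup>2 * off_diag d
        = variance_pred \<mu> \<alpha> \<sigma> (\<nu> d) lam (n d) (p d) d) sequentially"
      using fin by eventually_elim (simp add: facts(2) algebra_simps)
  qed
  have root: "sqrt ((\<alpha> * (1 - M))\<^sup>2) = \<alpha> * (1 - M)"
    using assms(1) M_le by (intro real_sqrt_unique) auto
  have "\<alpha>\<^sup>2 * (M - M\<^sup>2) = \<alpha> * (1 - M) * (\<alpha> - \<alpha> * (1 - M))"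
    by (simp add: power2_eq_square algebra_simps)
  then show ?thesis
    unfolding Let_def limI[OF bias_lim] limI[OF var_lim] root
    using bias_lim var_lim by (blast intro: convergentI)
qed

end
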